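(* Let $\mathcal A$ be a unital $C^*$-algebra and $\delta$ an endomorphism of $\mathcal A$ such that the pair $(\mathcal A,\delta)$ is finely representable, with complete transfer operator $\delta_*$. Then the $*$-epimorphism $$\phi:\mathcal A\times_\delta\mathbb Z\to\mathcal A\times_{\delta,\delta_*}\mathbb N$$ determined by $\phi(\hat U)=\dot S$ and $\phi(\hat a)=\dot a$ for all $a\in\mathcal A$ is a $*$-isomorphism between $\mathcal A\times_\delta\mathbb Z$ and Exel's crossed product $\mathcal A\times_{\delta,\delta_*}\mathbb N$.
   Context: Endomorphisms of $C^*$-algebras are $*$-endomorphisms and need not be unital. A transfer operator for $(\mathcal A,\delta)$ is a continuous positive linear map $\delta_*:\mathcal A\to\mathcal A$ with $\delta_*(\delta(a)b)=a\delta_*(b)$ for all $a,b\in\mathcal A$. It is complete if $\delta\delta_*(a)=\delta(1)a\delta(1)$ for all $a\in\mathcal A$; a complete transfer operator is unique if it exists. The pair $(\mathcal A,\delta)$ is finely representable if there are a Hilbert space $H$, a faithful non-degenerate representation $\pi:\mathcal A\to L(H)$ and $U\in L(H)$ with $\pi(\delta(a))=U\pi(a)U^*$, $U^*\pi(a)U\in\pi(\mathcal A)$ and $U\pi(a)=\pi(\delta(a))U$ for all $a\in\mathcal A$; this is known to be equivalent to the existence of a complete transfer operator for $(\mathcal A,\delta)$. The crossed product $\mathcal A\times_\delta\mathbb Z$ is the universal unital $C^*$-algebra generated by a copy of $\mathcal A$ and a partial isometry $U$ subject to $\delta(a)=UaU^*$, $\delta_*(a)=U^*aU$ for $a\in\mathcal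 A$, where $\delta_*$ is the complete transfer operator; canonical images are denoted $\hat a$, $\hat U$. Exel's crossed product: for an endomorphism $\alpha$ of a unital $C^*$-algebra $A$ and a transfer operator $\mathcal L$ for $(A,\alpha)$, $\mathcal T(A,\alpha,\mathcal L)$ is the universal $C^*$-algebra generated by a copy of $A$ and an element $S$ subject to $Sa=\alpha(a)S$ and $S^*aS=\mathcal L(a)$ for all $a\in A$. A redundancy is a pair $(a,k)\in\overline{A\alpha(A)A}\times\overline{ASS^*A}$ (closed linear spans) such that $abS=kbS$ for all $b\in A$. $A\times_{\alpha,\mathcal L}\mathbb N$ is the quotient of $\mathcal T(A,\alpha,\mathcal L)$ by the closed two-sided ideal generated by all $a-k$ with $(a,k)$ a redundancy. $\dot a$ and $\dot S$ denote the canonical images of $a$ and $S$ in this quotient. *)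

theory Defs
  imports
    "HOL-Analysis.Analysis"
    "HOL-Algebra.QuotRing"
    "HOL-Library.Poly_Mapping"
begin

section \<open>Complex Banach spaces, Hilbert spaces and unital C*-algebras\<close>

class scaleC =
  fixes scaleC :: "complex \<Rightarrow> 'a \<Rightarrow> 'a" (infixr \<open>*\<^sub>C\<close> 75)

class complex_vector = real_vector + scaleC +
  assumes scaleC_add_right: "c *\<^sub>C (x + y) = c *\<^sub>C x + c *\<^sub>C y"
    and scaleC_add_left: "(c + d) *\<^sub>C x = c *\<^sub>C x + d *\<^sub>C x"
    and scaleC_scaleC: "c *\<^sub>C (d *\<^sub>C x) = (c * d) *\<^sub>C x"
    and scaleR_scaleC: "r *\<^sub>R x = complex_of_real r *\<^sub>C x"

class complex_banach = complex_vector + banach +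
  assumes norm_scaleC: "norm (c *\<^sub>C x) = cmod c * norm x"

text \<open>The inner product is conjugate-linear in the first argument.\<close>

class complex_hilbert_space = complex_banach +
  fixes cinner :: "'a \<Rightarrow> 'a \<Rightarrow> complex"
  assumes cinner_commute: "cinner x y = cnj (cinner y x)"
    and cinner_add_right: "cinner x (y + z) = cinner x y + cinner x z"
    and cinner_scaleC_right: "cinner x (c *\<^sub>C y) = c * cinner x y"
    and cinner_self: "cinner x x = complex_of_real ((norm x)\<^sup>2)"

class cstar =
  fixes cstar :: "'a \<Rightarrow> 'a" (\<open>(_\<^sup>\<star>)\<close> [1000] 999)

text \<open>Unlike in \<^class>\<open>real_normed_algebra_1\<close>, the zero algebra is allowed.\<close>

class unital_cstar_algebra = real_normed_algebra + monoid_mult + complex_banach + cstar +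
  assumes mult_scaleC_left: "(c *\<^sub>C x) * y = c *\<^sub>C (x * y)"
    and mult_scaleC_right: "x * (c *\<^sub>C y) = c *\<^sub>C (x * y)"
    and cstar_add: "(x + y)\<^sup>\<star> = x\<^sup>\<star> + y\<^sup>\<star>"
    and cstar_scaleC: "(c *\<^sub>C x)\<^sup>\<star> = cnj c *\<^sub>C x\<^sup>\<star>"
    and cstar_mult: "(x * y)\<^sup>\<star> = y\<^sup>\<star> * x\<^sup>\<star>"
    and cstar_cstar: "(x\<^sup>\<star>)\<^sup>\<star> = x"
    and cstar_identity: "norm (x\<^sup>\<star> * x) = (norm x)\<^sup>2"

definition clinear :: "('a::complex_vector \<Rightarrow> 'b::complex_vector) \<Rightarrow> bool" where
  "clinear f \<longleftrightarrow> (\<forall>x y. f (x + y) = f x + f y) \<and> (\<forall>c x. f (c *\<^sub>C x) = c *\<^sub>C f x)"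

definition cspan :: "'a::complex_vector set \<Rightarrow> 'a set" where
  "cspan X = Modules.module.span scaleC X"


section \<open>Endomorphisms, transfer operators, fine representability\<close>

definition star_endomorphism :: "('a::unital_cstar_algebra \<Rightarrow> 'a) \<Rightarrow> bool" where
  "star_endomorphism \<delta> \<longleftrightarrow>
     clinear \<delta> \<and> (\<forall>a b. \<delta> (a * b) = \<delta> a * \<delta> b) \<and> (\<forall>a. \<delta> (a\<^sup>\<star>) = (\<delta> a)\<^sup>\<star>)"

definition positive_element :: "'a::unital_cstar_algebra \<Rightarrow> bool" where
  "positive_element a \<longleftrightarrow> (\<exists>b. a = b\<^sup>\<star> * b)"

definition transfer_operator ::
    "('a::unital_cstar_algebra \<Rightarrow> 'a) \<Rightarrow> ('a \<Rightarrow> 'a) \<Rightarrow> bool" where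
  "transfer_operator \<delta> L \<longleftrightarrow>
     clinear L \<and> continuous_on UNIV L \<and>
     (\<forall>a. positive_element a \<longrightarrow> positive_element (L a)) \<and>
     (\<forall>a b. L (\<delta> a * b) = a * L b)"

definition complete_transfer_operator ::
    "('a::unital_cstar_algebra \<Rightarrow> 'a) \<Rightarrow> ('a \<Rightarrow> 'a) \<Rightarrow> bool" where
  "complete_transfer_operator \<delta> L \<longleftrightarrow>
     transfer_operator \<delta> L \<and> (\<forall>a. \<delta> (L a) = \<delta> 1 * a * \<delta> 1)"

definition bounded_operator :: "('h::complex_hilbert_space \<Rightarrow> 'h) \<Rightarrow> bool" where
  "bounded_operator T \<longleftrightarrow> clinear T \<and> (\<exists>K. \<forall>x. norm (T x) \<le> K * norm x)"

definition hilbert_adjoint ::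
    "('h::complex_hilbert_space \<Rightarrow> 'h) \<Rightarrow> ('h \<Rightarrow> 'h)" where
  "hilbert_adjoint T = (THE G. \<forall>x y. cinner (G x) y = cinner x (T y))"

definition hilbert_representation ::
    "('a::unital_cstar_algebra \<Rightarrow> 'h::complex_hilbert_space \<Rightarrow> 'h) \<Rightarrow> bool" where
  "hilbert_representation \<pi> \<longleftrightarrow>
     (\<forall>a. bounded_operator (\<pi> a)) \<and>
     (\<forall>a b x. \<pi> (a + b) x = \<pi> a x + \<pi> b x) \<and>
     (\<forall>c a x. \<pi> (c *\<^sub>C a) x = c *\<^sub>C \<pi> a x) \<and>
     (\<forall>a b. \<pi> (a * b) = \<pi> a \<circ> \<pi> b) \<and>
     (\<forall>a. \<pi> (a\<^sup>\<star>) = hilbert_adjoint (\<pi> a))"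

definition nondegenerate ::
    "('a::unital_cstar_algebra \<Rightarrow> 'h::complex_hilbert_space \<Rightarrow> 'h) \<Rightarrow> bool" where
  "nondegenerate \<pi> \<longleftrightarrow> closure (cspan {\<pi> a x | a x. True}) = UNIV"

text \<open>The Hilbert space is the type \<open>'h\<close>.  As fine representability occurs only as a
  hypothesis, ``there is a Hilbert space'' amounts to leaving \<open>'h\<close> a free type variable.\<close>

definition finely_representable ::
    "'h::complex_hilbert_space itself \<Rightarrow> ('a::unital_cstar_algebra \<Rightarrow> 'a) \<Rightarrow> bool" where
  "finely_representable _ \<delta> \<longleftrightarrow>
     (\<exists>(\<pi> :: 'a \<Rightarrow> 'h \<Rightarrow> 'h) U.
        hilbert_representation \<pi> \<and> inj \<pi> \<and> nondegenerate \<pi> \<and> bounded_operator U \<and>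
        (\<forall>a. \<pi> (\<delta> a) = U \<circ> \<pi> a \<circ> hilbert_adjoint U) \<and>
        (\<forall>a. hilbert_adjoint U \<circ> \<pi> a \<circ> U \<in> range \<pi>) \<and>
        (\<forall>a. U \<circ> \<pi> a = \<pi> (\<delta> a) \<circ> U))"


section \<open>*-algebras with explicit carrier\<close>

text \<open>Universal C*-algebras and their quotients depend on \<open>\<delta>\<close>, so they cannot be types; they are
  rings in the sense of HOL-Algebra with scalar multiplication, involution and norm added.\<close>

record 'c star_alg = "'c ring" +
  scal :: "complex \<Rightarrow> 'c \<Rightarrow> 'c"
  invol :: "'c \<Rightarrow> 'c"
  nrm :: "'c \<Rightarrow> real"

definition star_hom :: "'c star_alg \<Rightarrow> 'd star_alg \<Rightarrow> ('c \<Rightarrow> 'd) set" where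
  "star_hom R S = {\<phi> \<in> ring_hom R S.
     (\<forall>c. \<forall>x\<in>carrier R. \<phi> (scal R c x) = scal S c (\<phi> x)) \<and>
     (\<forall>x\<in>carrier R. \<phi> (invol R x) = invol S (\<phi> x))}"

definition star_iso :: "'c star_alg \<Rightarrow> 'd star_alg \<Rightarrow> ('c \<Rightarrow> 'd) set" where
  "star_iso R S = {\<phi> \<in> star_hom R S. bij_betw \<phi> (carrier R) (carrier S)}"

text \<open>The quotient by a closed self-adjoint ideal with the quotient norm; scalar multiplication
  and involution are given on cosets in the same way as multiplication in \<^const>\<open>FactRing\<close>.\<close>

definition star_quotient :: "'c star_alg \<Rightarrow> 'c set \<Rightarrow> 'c set star_alg" where
  "star_quotient R I = \<lparr>
     carrier = carrier (R Quot I), mult = mult (R Quot I), one = one (R Quot I),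
     zero = zero (R Quot I), add = add (R Quot I),
     scal = (\<lambda>c X. \<Union>x\<in>X. I +>\<^bsub>R\<^esub> scal R c x),
     invol = (\<lambda>X. \<Union>x\<in>X. I +>\<^bsub>R\<^esub> invol R x),
     nrm = (\<lambda>X. Inf (nrm R ` X))\<rparr>"

definition nrm_closure :: "'c star_alg \<Rightarrow> 'c set \<Rightarrow> 'c set" where
  "nrm_closure R X = {x \<in> carrier R. \<forall>e>0. \<exists>y\<in>X. nrm R (x \<ominus>\<^bsub>R\<^esub> y) < e}"

inductive_set lin_span :: "'c star_alg \<Rightarrow> 'c set \<Rightarrow> 'c set" for R :: "'c star_alg" and X where
  zero: "\<zero>\<^bsub>R\<^esub> \<in> lin_span R X"
| add: "x \<in> X \<Longrightarrow> y \<in> lin_span R X \<Longrightarrow> scal R c x \<oplus>\<^bsub>R\<^esub> y \<in> lin_span R X"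

definition closed_ideal_generated :: "'c star_alg \<Rightarrow> 'c set \<Rightarrow> 'c set" where
  "closed_ideal_generated R X = \<Inter>{I. ideal I R \<and> nrm_closure R I \<subseteq> I \<and> X \<subseteq> I}"


section \<open>Universal unital C*-algebras given by generators and relations\<close>

text \<open>A word is a list of letters; the letter \<open>(g, False)\<close> is the generator \<open>g\<close> and \<open>(g, True)\<close>
  is its formal adjoint.  Words are written additively because \<^typ>\<open>'a \<Rightarrow>\<^sub>0 'b\<close> takes its
  convolution product from the addition of the exponents.\<close>

datatype 'g word = Word (letters: "('g \<times> bool) list")

instantiation word :: (type) monoid_add
begin

definition zero_word :: "'a word" where
  "0 = Word []"

definition plus_word :: "'a word \<Rightarrow> 'a word \<Rightarrow> 'a word" where
  "v + w = Word (letters v @ letters w)"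

instance
  by standard (simp_all add: zero_word_def plus_word_def)

end

type_synonym 'g free_star_alg = "'g word \<Rightarrow>\<^sub>0 complex"

definition star_word :: "'g word \<Rightarrow> 'g word" where
  "star_word w = Word (rev (map (\<lambda>(g, b). (g, \<not> b)) (letters w)))"

definition free_gen :: "'g \<Rightarrow> 'g free_star_alg" where
  "free_gen g = Poly_Mapping.single (Word [(g, False)]) 1"

definition free_scal :: "complex \<Rightarrow> 'g free_star_alg \<Rightarrow> 'g free_star_alg" where
  "free_scal c x = Poly_Mapping.single 0 c * x"

text \<open>The coefficient of \<open>x\<^sup>*\<close> at \<open>w\<close> is the conjugate of the coefficient of \<open>x\<close> at \<open>w\<^sup>*\<close>.\<close>

definition free_star :: "'g free_star_alg \<Rightarrow> 'g free_star_alg" where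
  "free_star x = Poly_Mapping.map cnj (Poly_Mapping.map_key star_word x)"

text \<open>The C*-seminorms on the free *-algebra are exactly the functions \<open>x \<mapsto> \<parallel>\<rho>(x)\<parallel>\<close> for \<open>\<rho>\<close> a
  unital *-homomorphism into a unital C*-algebra.\<close>

definition cstar_seminorm :: "('g free_star_alg \<Rightarrow> real) \<Rightarrow> bool" where
  "cstar_seminorm p \<longleftrightarrow>
     (\<forall>x. 0 \<le> p x) \<and>
     (\<forall>x y. p (x + y) \<le> p x + p y) \<and>
     (\<forall>c x. p (free_scal c x) = cmod c * p x) \<and>
     (\<forall>x y. p (x * y) \<le> p x * p y) \<and>
     (\<forall>x. p (free_star x * x) = (p x)\<^sup>2)"

text \<open>The relations are the equations \<open>r = 0\<close> for \<open>r \<in> Rel\<close>; the supremum is finite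
  whenever the relations bound every generator.\<close>

definition universal_seminorm :: "'g free_star_alg set \<Rightarrow> 'g free_star_alg \<Rightarrow> real" where
  "universal_seminorm Rel x = Sup {p x | p. cstar_seminorm p \<and> (\<forall>r\<in>Rel. p r = 0)}"

definition cauchy_alg :: "('g free_star_alg \<Rightarrow> real) \<Rightarrow> (nat \<Rightarrow> 'g free_star_alg) star_alg" where
  "cauchy_alg p = \<lparr>
     carrier = {X. \<forall>e>0. \<exists>N. \<forall>m\<ge>N. \<forall>n\<ge>N. p (X m - X n) < e},
     mult = (\<lambda>X Y n. X n * Y n), one = (\<lambda>n. 1),
     zero = (\<lambda>n. 0), add = (\<lambda>X Y n. X n + Y n),
     scal = (\<lambda>c X n. free_scal c (X n)),
     invol = (\<lambda>X n. free_star (X n)),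
     nrm = (\<lambda>X. lim (\<lambda>n. p (X n)))\<rparr>"

definition null_sequences :: "('g free_star_alg \<Rightarrow> real) \<Rightarrow> (nat \<Rightarrow> 'g free_star_alg) set" where
  "null_sequences p = {X. (\<lambda>n. p (X n)) \<longlonglongrightarrow> 0}"

definition hausdorff_completion ::
    "('g free_star_alg \<Rightarrow> real) \<Rightarrow> (nat \<Rightarrow> 'g free_star_alg) set star_alg" where
  "hausdorff_completion p = star_quotient (cauchy_alg p) (null_sequences p)"

definition universal_cstar_algebra ::
    "'g free_star_alg set \<Rightarrow> (nat \<Rightarrow> 'g free_star_alg) set star_alg" where
  "universal_cstar_algebra Rel = hausdorff_completion (universal_seminorm Rel)"

definition universal_elem ::
    "'g free_star_alg set \<Rightarrow> 'g free_star_alg \<Rightarrow> (nat \<Rightarrow> 'g free_star_alg) set" where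
  "universal_elem Rel x =
     null_sequences (universal_seminorm Rel) +>\<^bsub>cauchy_alg (universal_seminorm Rel)\<^esub> (\<lambda>_. x)"


section \<open>The two crossed products\<close>

text \<open>The generators are the elements of the given algebra and one further element, called
  \<open>U\<close> in \<open>A \<times>\<^sub>\<delta> Z\<close> and \<open>S\<close> in \<open>T(A, \<alpha>, L)\<close>.\<close>

datatype 'a generator = Elem 'a | Extra

abbreviation el :: "'a \<Rightarrow> 'a generator free_star_alg" where
  "el a \<equiv> free_gen (Elem a)"

abbreviation ext :: "'a generator free_star_alg" where
  "ext \<equiv> free_gen Extra"

text \<open>These say that \<open>a \<mapsto> el a\<close> becomes a *-homomorphism taking the unit of the given algebra
  to the unit of the universal one.\<close>

definition algebra_relations :: "'a::unital_cstar_algebra generator free_star_alg set" where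
  "algebra_relations =
     {el (a + b) - (el a + el b) | a b. True} \<union>
     {el (c *\<^sub>C a) - free_scal c (el a) | c a. True} \<union>
     {el (a * b) - el a * el b | a b. True} \<union>
     {el (a\<^sup>\<star>) - free_star (el a) | a. True} \<union>
     {el 1 - 1}"

definition crossed_relations ::
    "('a::unital_cstar_algebra \<Rightarrow> 'a) \<Rightarrow> ('a \<Rightarrow> 'a) \<Rightarrow> 'a generator free_star_alg set" where
  "crossed_relations \<delta> L = algebra_relations \<union>
     {ext * free_star ext * ext - ext} \<union>
     {el (\<delta> a) - ext * el a * free_star ext | a. True} \<union>
     {el (L a) - free_star ext * el a * ext | a. True}"

definition crossed_product ::
    "('a::unital_cstar_algebra \<Rightarrow> 'a) \<Rightarrow> ('a \<Rightarrow> 'a) \<Rightarrow>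
     (nat \<Rightarrow> 'a generator free_star_alg) set star_alg" where
  "crossed_product \<delta> L = universal_cstar_algebra (crossed_relations \<delta> L)"

definition crossed_elem ::
    "('a::unital_cstar_algebra \<Rightarrow> 'a) \<Rightarrow> ('a \<Rightarrow> 'a) \<Rightarrow> 'a \<Rightarrow>
     (nat \<Rightarrow> 'a generator free_star_alg) set" where
  "crossed_elem \<delta> L a = universal_elem (crossed_relations \<delta> L) (el a)"

definition crossed_U ::
    "('a::unital_cstar_algebra \<Rightarrow> 'a) \<Rightarrow> ('a \<Rightarrow> 'a) \<Rightarrow>
     (nat \<Rightarrow> 'a generator free_star_alg) set" where
  "crossed_U \<delta> L = universal_elem (crossed_relations \<delta> L) ext"

definition toeplitz_relations ::
    "('a::unital_cstar_algebra \<Rightarrow> 'a) \<Rightarrow> ('a \<Rightarrow> 'a) \<Rightarrow> 'a generator free_star_alg set" where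
  "toeplitz_relations \<alpha> L = algebra_relations \<union>
     {ext * el a - el (\<alpha> a) * ext | a. True} \<union>
     {free_star ext * el a * ext - el (L a) | a. True}"

definition toeplitz_algebra ::
    "('a::unital_cstar_algebra \<Rightarrow> 'a) \<Rightarrow> ('a \<Rightarrow> 'a) \<Rightarrow>
     (nat \<Rightarrow> 'a generator free_star_alg) set star_alg" where
  "toeplitz_algebra \<alpha> L = universal_cstar_algebra (toeplitz_relations \<alpha> L)"

definition toeplitz_elem ::
    "('a::unital_cstar_algebra \<Rightarrow> 'a) \<Rightarrow> ('a \<Rightarrow> 'a) \<Rightarrow> 'a \<Rightarrow>
     (nat \<Rightarrow> 'a generator free_star_alg) set" where
  "toeplitz_elem \<alpha> L a = universal_elem (toeplitz_relations \<alpha> L) (el a)"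

definition toeplitz_S ::
    "('a::unital_cstar_algebra \<Rightarrow> 'a) \<Rightarrow> ('a \<Rightarrow> 'a) \<Rightarrow>
     (nat \<Rightarrow> 'a generator free_star_alg) set" where
  "toeplitz_S \<alpha> L = universal_elem (toeplitz_relations \<alpha> L) ext"

definition redundancy ::
    "('a::unital_cstar_algebra \<Rightarrow> 'a) \<Rightarrow> ('a \<Rightarrow> 'a) \<Rightarrow> 'a \<Rightarrow>
     (nat \<Rightarrow> 'a generator free_star_alg) set \<Rightarrow> bool" where
  "redundancy \<alpha> L a k \<longleftrightarrow>
     (let T = toeplitz_algebra \<alpha> L; j = toeplitz_elem \<alpha> L; S = toeplitz_S \<alpha> L in
       a \<in> closure (cspan {x * \<alpha> y * z | x y z. True}) \<and>
       k \<in> nrm_closure T (lin_span T {j x \<otimes>\<^bsub>T\<^esub> S \<otimes>\<^bsub>T\<^esub> invol T S \<otimes>\<^bsub>T\<^esub> j y | x y. True}) \<and>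
       (\<forall>b. j a \<otimes>\<^bsub>T\<^esub> j b \<otimes>\<^bsub>T\<^esub> S = k \<otimes>\<^bsub>T\<^esub> j b \<otimes>\<^bsub>T\<^esub> S))"

definition redundancy_ideal ::
    "('a::unital_cstar_algebra \<Rightarrow> 'a) \<Rightarrow> ('a \<Rightarrow> 'a) \<Rightarrow>
     (nat \<Rightarrow> 'a generator free_star_alg) set set" where
  "redundancy_ideal \<alpha> L =
     closed_ideal_generated (toeplitz_algebra \<alpha> L)
       {toeplitz_elem \<alpha> L a \<ominus>\<^bsub>toeplitz_algebra \<alpha> L\<^esub> k | a k. redundancy \<alpha> L a k}"

definition exel_crossed_product ::
    "('a::unital_cstar_algebra \<Rightarrow> 'a) \<Rightarrow> ('a \<Rightarrow> 'a) \<Rightarrow>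
     (nat \<Rightarrow> 'a generator free_star_alg) set set star_alg" where
  "exel_crossed_product \<alpha> L = star_quotient (toeplitz_algebra \<alpha> L) (redundancy_ideal \<alpha> L)"

definition exel_elem ::
    "('a::unital_cstar_algebra \<Rightarrow> 'a) \<Rightarrow> ('a \<Rightarrow> 'a) \<Rightarrow> 'a \<Rightarrow>
     (nat \<Rightarrow> 'a generator free_star_alg) set set" where
  "exel_elem \<alpha> L a = redundancy_ideal \<alpha> L +>\<^bsub>toeplitz_algebra \<alpha> L\<^esub> toeplitz_elem \<alpha> L a"

definition exel_S ::
    "('a::unital_cstar_algebra \<Rightarrow> 'a) \<Rightarrow> ('a \<Rightarrow> 'a) \<Rightarrow>
     (nat \<Rightarrow> 'a generator free_star_alg) set set" where
  "exel_S \<alpha> L = redundancy_ideal \<alpha> L +>\<^bsub>toeplitz_algebra \<alpha> L\<^esub> toeplitz_S \<alpha> L"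

end

theory Submission
  imports Defs "HOL-Library.Function_Algebras"
begin

text \<open>Write \<open>X\<close> for \<open>A \<times>\<^sub>\<delta> Z\<close>, \<open>T\<close> for the Toeplitz algebra of
  \<open>(A, \<delta>, \<delta>\<^sub>*)\<close> and \<open>I\<close> for the ideal of redundancies, so that Exel's crossed product is
  \<open>T / I\<close>.  The relations of \<open>T\<close> hold in \<open>X\<close>: because
  \<open>a \<delta>\<^sub>*(1) = \<delta>\<^sub>*(\<delta>(a))\<close>, the projection \<open>U\<^sup>* U = \<delta>\<^sub>*(1)\<close> commutes
  with \<open>A\<close>, and this gives \<open>U a = \<delta>(a) U\<close>
  (\<open>crossed_seminorm.covariance\<close>).  Hence there is a *-homomorphism
  \<open>\<pi> : T \<rightarrow> X\<close> fixing the generators, and the theorem amounts to saying that \<open>\<pi>\<close>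
  is onto with kernel \<open>I\<close>; then \<open>\<phi>\<close> is the inverse of the bijection induced by \<open>\<pi>\<close>.

  That \<open>\<pi>\<close> kills redundancies (\<open>redundancy_in_kernel\<close>): if \<open>d = a - k\<close> is the
  difference of a redundancy, then \<open>d A U = 0\<close> in \<open>X\<close>, while \<open>d\<close> lies in the closed
  span of \<open>A U U\<^sup>* A\<close>; so \<open>d d\<^sup>* = 0\<close>.

  That nothing else is killed (\<open>kernel_subset_redundancy_ideal\<close>): completeness of
  \<open>\<delta>\<^sub>*\<close> makes \<open>(\<delta>(a), S a S\<^sup>*)\<close> a redundancy, so the relations of \<open>X\<close>
  hold modulo \<open>I\<close>.  The distance from a *-ideal is again a C*-seminorm
  (\<open>quotient_seminorm_cstar\<close>), hence it is at most the norm of \<open>X\<close>, which is the largest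
  C*-seminorm respecting these relations.  So an element of norm zero in \<open>X\<close> is at distance zero
  from \<open>I\<close>.  The same estimate lets Cauchy sequences for \<open>X\<close> be corrected by elements of
  \<open>I\<close> to Cauchy sequences for \<open>T\<close>, which proves surjectivity.

  Uniqueness of \<open>\<phi>\<close>, and also the finiteness of the universal seminorms, rest on automatic
  contractivity (\<open>complete_contractive\<close>): on a complete C*-algebra every C*-seminorm is bounded by
  the norm.  Both general facts on C*-seminorms are proved without spectral theory: contractivity from
  unitaries obtained by a fixed-point iteration, the statement on quotients from partial sums of Neumann
  series.  They concern seminorms on algebras that need not be separated, so they can be applied directly
  to the free *-algebra and to its algebra of Cauchy sequences.\<close>

section \<open>C*-seminorms on *-algebras\<close>

locale involutive_algebra =
  fixes sm :: "complex \<Rightarrow> 'r \<Rightarrow> 'r::{ring, monoid_mult}"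
    and adj :: "'r \<Rightarrow> 'r"
  assumes sm_add_right: "sm c (x + y) = sm c x + sm c y"
    and sm_add_left: "sm (c + d) x = sm c x + sm d x"
    and sm_sm: "sm c (sm d x) = sm (c * d) x"
    and sm_one: "sm 1 x = x"
    and sm_mult_left: "sm c x * y = sm c (x * y)"
    and sm_mult_right: "x * sm c y = sm c (x * y)"
    and adj_add: "adj (x + y) = adj x + adj y"
    and adj_sm: "adj (sm c x) = sm (cnj c) (adj x)"
    and adj_mult: "adj (x * y) = adj y * adj x"
    and adj_adj: "adj (adj x) = x"
begin

lemma sm_zero_right: "sm c 0 = 0"
  using sm_add_right[of c 0 0] by simp

lemma sm_zero_left: "sm 0 x = 0"
  using sm_add_left[of 0 0 x] by simp

lemma sm_minus_left: "sm (- c) x = - sm c x"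
  using sm_add_left[of "- c" c x] by (simp add: sm_zero_left eq_neg_iff_add_eq_0)

lemma sm_minus_right: "sm c (- x) = - sm c x"
  using sm_add_right[of c "- x" x] by (simp add: sm_zero_right eq_neg_iff_add_eq_0)

lemma sm_diff_right: "sm c (x - y) = sm c x - sm c y"
  using sm_add_right[of c x "- y"] by (simp add: sm_minus_right)

lemma sm_diff_left: "sm (c - d) x = sm c x - sm d x"
  using sm_add_left[of c "- d" x] by (simp add: sm_minus_left)

lemma sm_minus_one: "sm (- 1) x = - x"
  by (simp add: sm_minus_left sm_one)

lemma adj_zero: "adj 0 = 0"
  using adj_add[of 0 0] by simp

lemma adj_minus: "adj (- x) = - adj x"
  using adj_add[of "- x" x] by (simp add: adj_zero eq_neg_iff_add_eq_0)

lemma adj_diff: "adj (x - y) = adj x - adj y"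
  using adj_add[of x "- y"] by (simp add: adj_minus)

lemma adj_one: "adj 1 = 1"
  by (metis adj_adj adj_mult mult_1 mult_1_right)

lemmas sm_simps = sm_add_right sm_diff_right sm_minus_right sm_zero_right sm_sm sm_one
  sm_mult_left sm_mult_right sm_zero_left
lemmas adj_simps = adj_add adj_diff adj_minus adj_zero adj_one adj_mult adj_adj adj_sm

lemma half_double: "sm (1/2) x + sm (1/2) x = x"
  by (simp add: sm_add_left[symmetric] sm_one)

lemma double: "x + x = sm 2 x"
  using sm_add_left[of 1 1 x] by (simp add: sm_one)

end

text \<open>The carrier \<open>C\<close> matters for the completions below, whose elements are the Cauchy sequences
  among all sequences; elsewhere it is the whole type.\<close>

locale cstar_seminormed = involutive_algebra sm adj
  for sm :: "complex \<Rightarrow> 'r \<Rightarrow> 'r::{ring, monoid_mult}" and adj +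
  fixes C :: "'r set" and p :: "'r \<Rightarrow> real"
  assumes C_one: "1 \<in> C"
    and C_add: "x \<in> C \<Longrightarrow> y \<in> C \<Longrightarrow> x + y \<in> C"
    and C_mult: "x \<in> C \<Longrightarrow> y \<in> C \<Longrightarrow> x * y \<in> C"
    and C_sm: "x \<in> C \<Longrightarrow> sm c x \<in> C"
    and C_adj: "x \<in> C \<Longrightarrow> adj x \<in> C"
    and p_nonneg: "x \<in> C \<Longrightarrow> 0 \<le> p x"
    and p_add: "x \<in> C \<Longrightarrow> y \<in> C \<Longrightarrow> p (x + y) \<le> p x + p y"
    and p_sm: "x \<in> C \<Longrightarrow> p (sm c x) = cmod c * p x"
    and p_mult: "x \<in> C \<Longrightarrow> y \<in> C \<Longrightarrow> p (x * y) \<le> p x * p y"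
    and p_cstar: "x \<in> C \<Longrightarrow> p (adj x * x) = (p x)\<^sup>2"
begin

lemma C_zero: "0 \<in> C"
  using C_sm[OF C_one, of 0] by (simp add: sm_zero_left)

lemma C_minus: "x \<in> C \<Longrightarrow> - x \<in> C"
  using C_sm[of x "- 1"] by (simp add: sm_minus_one)

lemma C_diff: "x \<in> C \<Longrightarrow> y \<in> C \<Longrightarrow> x - y \<in> C"
  using C_add[of x "- y"] by (simp add: C_minus)

lemma C_power: "x \<in> C \<Longrightarrow> x ^ n \<in> C"
  by (induction n) (auto intro: C_one C_mult)

lemma C_sum: "(\<And>i. i \<in> I \<Longrightarrow> f i \<in> C) \<Longrightarrow> sum f I \<in> C"
  by (induction I rule: infinite_finite_induct) (auto intro: C_zero C_add)

lemmas C_closed = C_zero C_one C_add C_minus C_diff C_mult C_sm C_adj C_power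

lemma p_zero: "p 0 = 0"
  using p_sm[OF C_one, of 0] by (simp add: sm_zero_left)

lemma p_minus: "x \<in> C \<Longrightarrow> p (- x) = p x"
  using p_sm[of x "- 1"] by (simp add: sm_minus_one)

lemma p_commute: "x \<in> C \<Longrightarrow> y \<in> C \<Longrightarrow> p (x - y) = p (y - x)"
  using p_minus[of "x - y"] by (simp add: C_diff)

lemma p_diff: "x \<in> C \<Longrightarrow> y \<in> C \<Longrightarrow> p (x - y) \<le> p x + p y"
  using p_add[of x "- y"] by (simp add: C_minus p_minus)

lemma p_triangle:
  "x \<in> C \<Longrightarrow> y \<in> C \<Longrightarrow> z \<in> C \<Longrightarrow> p (x - z) \<le> p (x - y) + p (y - z)"
  using p_add[of "x - y" "y - z"] by (simp add: C_diff)

lemma p_le_diff: "x \<in> C \<Longrightarrow> y \<in> C \<Longrightarrow> p x \<le> p y + p (x - y)"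
  using p_add[of y "x - y"] by (simp add: C_diff)

lemma p_abs_diff: "x \<in> C \<Longrightarrow> y \<in> C \<Longrightarrow> \<bar>p x - p y\<bar> \<le> p (x - y)"
  using p_le_diff[of x y] p_le_diff[of y x] p_commute[of x y] by linarith

lemma p_adj_le: assumes "x \<in> C" shows "p x \<le> p (adj x)"
proof (cases "p x = 0")
  case False
  have "p x * p x \<le> p (adj x) * p x"
    using p_mult[of "adj x" x] p_cstar[of x] assms by (simp add: C_adj power2_eq_square)
  then show ?thesis using False p_nonneg[OF assms] by simp
qed (simp add: p_nonneg C_adj assms)

lemma p_adj: "x \<in> C \<Longrightarrow> p (adj x) = p x"
  using p_adj_le[of x] p_adj_le[of "adj x"] by (simp add: C_adj adj_adj)

lemma p_cstar': "x \<in> C \<Longrightarrow> p (x * adj x) = (p x)\<^sup>2"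
  using p_cstar[of "adj x"] by (simp add: C_adj adj_adj p_adj)

lemma p_one: "p 1 \<le> 1"
  using p_cstar[OF C_one] by (auto simp: adj_one power2_eq_square)

lemma p_power: "x \<in> C \<Longrightarrow> p (x ^ n) \<le> p x ^ n"
proof (induction n)
  case (Suc n)
  have "p (x ^ Suc n) \<le> p x * p (x ^ n)"
    using Suc.prems by (auto intro: p_mult C_closed)
  also have "\<dots> \<le> p x * p x ^ n"
    using Suc by (auto intro: mult_left_mono p_nonneg)
  finally show ?case by simp
qed (simp add: p_one)

lemma p_diff_zero_eq: "x \<in> C \<Longrightarrow> y \<in> C \<Longrightarrow> p (x - y) = 0 \<Longrightarrow> p x = p y"
  using p_abs_diff[of x y] by simp

lemma p_mult_zero_left: "x \<in> C \<Longrightarrow> y \<in> C \<Longrightarrow> p x = 0 \<Longrightarrow> p (x * y) = 0"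
  using p_mult[of x y] p_nonneg[of "x * y"] by (simp add: C_mult)

lemma p_mult_zero_right: "x \<in> C \<Longrightarrow> y \<in> C \<Longrightarrow> p y = 0 \<Longrightarrow> p (x * y) = 0"
  using p_mult[of x y] p_nonneg[of "x * y"] by (simp add: C_mult)

lemma p_add_zero: "x \<in> C \<Longrightarrow> y \<in> C \<Longrightarrow> p x = 0 \<Longrightarrow> p y = 0 \<Longrightarrow> p (x + y) = 0"
  using p_add[of x y] p_nonneg[of "x + y"] by (simp add: C_add)

lemma p_diff_zero_trans:
  "p (x - y) = 0 \<Longrightarrow> p (y - z) = 0 \<Longrightarrow> x \<in> C \<Longrightarrow> y \<in> C \<Longrightarrow> z \<in> C \<Longrightarrow> p (x - z) = 0"
  using p_triangle[of x y z] p_nonneg[of "x - z"] by (simp add: C_diff)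

lemma p_mult_diff:
  assumes "x \<in> C" "y \<in> C" "x' \<in> C" "y' \<in> C"
  shows "p (x * y - x' * y') \<le> p (x - x') * p y + p x' * p (y - y')"
proof -
  have "x * y - x' * y' = (x - x') * y + x' * (y - y')" by (simp add: algebra_simps)
  then have "p (x * y - x' * y') \<le> p ((x - x') * y) + p (x' * (y - y'))"
    using assms by (auto intro: p_add C_closed)
  then show ?thesis
    using p_mult[of "x - x'" y] p_mult[of x' "y - y'"] assms by (auto simp: C_closed)
qed

lemma p_mult_diff_zero:
  assumes "x \<in> C" "y \<in> C" "x' \<in> C" "y' \<in> C" "p (x - x') = 0" "p (y - y') = 0"
  shows "p (x * y - x' * y') = 0"
  using p_mult_diff[OF assms(1-4)] assms p_nonneg[of "x * y - x' * y'"] by (simp add: C_closed)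

lemma p_adj_diff_zero: "x \<in> C \<Longrightarrow> y \<in> C \<Longrightarrow> p (x - y) = 0 \<Longrightarrow> p (adj x - adj y) = 0"
  using p_adj[of "x - y"] by (simp add: C_diff adj_diff)

lemma p_geometric:
  assumes X: "\<And>n. X n \<in> C" and step: "\<And>n. p (X (Suc n) - X n) \<le> r ^ n" and r: "0 \<le> r" "r < 1"
  shows "p (X (n + k) - X n) \<le> r ^ n / (1 - r)"
proof -
  have "p (X (n + k) - X n) \<le> (\<Sum>i<k. r ^ (n + i))"
  proof (induction k)
    case (Suc k)
    show ?case
      using p_triangle[of "X (n + Suc k)" "X (n + k)" "X n"] X step[of "n + k"] Suc by simp
  qed (simp add: p_zero)
  also have "\<dots> = r ^ n * (\<Sum>i<k. r ^ i)" by (simp add: power_add sum_distrib_left)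
  also have "\<dots> \<le> r ^ n * (1 / (1 - r))"
    using r by (intro mult_left_mono) (auto simp: sum_gp_strict divide_right_mono)
  finally show ?thesis by simp
qed

lemma geometric_Cauchy:
  assumes X: "\<And>n. X n \<in> C" and step: "\<And>n. p (X (Suc n) - X n) \<le> r ^ n" and r: "0 \<le> r" "r < 1"
    and e: "0 < e"
  shows "\<exists>N. \<forall>m\<ge>N. \<forall>n\<ge>N. p (X m - X n) < e"
proof -
  have "(\<lambda>n. r ^ n / (1 - r)) \<longlonglongrightarrow> 0 / (1 - r)"
    using r by (intro tendsto_intros LIMSEQ_realpow_zero) auto
  then have "\<forall>\<^sub>F n in sequentially. r ^ n / (1 - r) < e"
    using e by (auto elim!: order_tendstoD)
  then obtain N where N: "\<And>n. n \<ge> N \<Longrightarrow> r ^ n / (1 - r) < e"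
    by (auto simp: eventually_sequentially)
  have *: "p (X m - X n) < e" if "n \<ge> N" "n \<le> m" for m n
    using p_geometric[OF X step r, of n "m - n"] N[of n] that by simp
  have "p (X m - X n) < e" if "n \<ge> N" "m \<ge> N" for m n
    using *[of n m] *[of m n] that p_commute[OF X X, of m n] by (cases "n \<le> m") auto
  then show ?thesis by blast
qed

end

section \<open>Automatic contractivity on complete C*-algebras\<close>

context cstar_seminormed
begin

text \<open>A self-adjoint element of norm less than one is the real part of a unitary
  \<open>u = h + i sqrt (1 - h\<^sup>2)\<close>.  The square root is \<open>1 - c\<close> where \<open>c\<close> is the fixed
  point of the contraction \<open>c \<mapsto> (h\<^sup>2 + c\<^sup>2) / 2\<close> on the ball of radius \<open>\<parallel>h\<parallel>\<close>.
  The iterates started at \<open>0\<close> are self-adjoint and commute with \<open>h\<close>, and the sequence below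
  consists of the corresponding approximations of \<open>u\<close>.\<close>

lemma approx_unitary:
  fixes h :: 'r
  assumes h: "h \<in> C" "adj h = h" "p h < 1"
  obtains u where "\<And>n. u n \<in> C" "\<And>n. u n + adj (u n) = h + h"
    "\<And>n. p (u (Suc n) - u n) \<le> p h ^ n"
    "\<And>n. p (adj (u n) * u n - 1) \<le> 2 * p h ^ n"
proof -
  define r where "r = p h"
  have r: "0 \<le> r" "r < 1" using h p_nonneg by (auto simp: r_def)
  define c where "c = rec_nat 0 (\<lambda>_ c. sm (1/2) (h * h + c * c))"
  have c0: "c 0 = 0" and cS: "c (Suc n) = sm (1/2) (h * h + c n * c n)" for n
    by (simp_all add: c_def)
  have cC: "c n \<in> C" for n by (induction n) (auto simp: c0 cS h intro!: C_closed)
  have cadj: "adj (c n) = c n" for n by (induction n) (auto simp: c0 cS h adj_simps)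
  have ch: "c n * h = h * c n" for n
  proof (induction n)
    case (Suc n)
    have "c n * c n * h = h * (c n * c n)"
      by (metis Suc mult.assoc)
    then show ?case by (simp add: cS sm_mult_left sm_mult_right distrib_left distrib_right mult.assoc)
  qed (simp add: c0)
  have cr: "p (c n) \<le> r" for n
  proof (induction n)
    case (Suc n)
    have "p (c (Suc n)) \<le> (p (h * h) + p (c n * c n)) / 2"
      using p_add[of "h * h" "c n * c n"] by (simp add: cS p_sm C_closed h cC)
    also have "\<dots> \<le> (r * r + r * r) / 2"
      using p_mult[OF h(1) h(1)] p_mult[OF cC cC, of n n]
        mult_mono[OF Suc Suc] p_nonneg[OF cC, of n] r by (auto simp: r_def)
    also have "\<dots> \<le> r" using r mult_left_le[of r r] by simp
    finally show ?case .
  qed (simp add: c0 p_zero r)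
  have cd: "p (c (Suc n) - c n) \<le> r ^ n" for n
  proof (induction n)
    case 0
    show ?case using cr[of 1] r by (simp add: c0 p_zero)
  next
    case (Suc n)
    have eq: "c (Suc (Suc n)) - c (Suc n) =
        sm (1/2) (c (Suc n) * (c (Suc n) - c n) + (c (Suc n) - c n) * c n)"
      unfolding cS[of "Suc n"] cS[of n, symmetric]
      by (subst (3) cS) (simp add: sm_diff_right[symmetric] algebra_simps)
    define d where "d = c (Suc n) - c n"
    have d: "d \<in> C" "0 \<le> p d" "p d \<le> r ^ n"
      using cC Suc p_nonneg[of d] by (auto simp: d_def C_diff)
    have "p (c (Suc (Suc n)) - c (Suc n)) \<le> (p (c (Suc n) * d) + p (d * c n)) / 2"
      unfolding eq d_def[symmetric]
      using p_add[of "c (Suc n) * d" "d * c n"] by (simp add: p_sm C_closed cC d)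
    also have "\<dots> \<le> (r * p d + p d * r) / 2"
      using p_mult[OF cC d(1), of "Suc n"] p_mult[OF d(1) cC, of n]
        mult_right_mono[OF cr[of "Suc n"] d(2)] mult_left_mono[OF cr[of n] d(2)]
      by (simp add: ac_simps)
    also have "\<dots> \<le> r * r ^ n" using d r by (simp add: mult_left_mono)
    finally show ?case by simp
  qed
  define u where "u n = h + sm \<i> (1 - c n)" for n
  show ?thesis
  proof
    show "u n \<in> C" for n by (simp add: u_def C_closed h cC)
    show "u n + adj (u n) = h + h" for n
      by (simp add: u_def adj_simps cadj h sm_minus_left)
    show "p (u (Suc n) - u n) \<le> p h ^ n" for n
    proof -
      have "u (Suc n) - u n = - sm \<i> (c (Suc n) - c n)"
        by (simp add: u_def sm_simps)
      then show ?thesis using cd[of n] by (simp add: r_def p_minus p_sm C_closed cC)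
    qed
    show "p (adj (u n) * u n - 1) \<le> 2 * p h ^ n" for n
    proof -
      have "adj (u n) * u n = h * h + (1 - c n) * (1 - c n)"
        by (simp add: u_def adj_simps cadj h sm_simps distrib_left distrib_right sm_minus_left
            left_diff_distrib right_diff_distrib ch)
      also have "\<dots> = 1 + sm 2 (c (Suc n)) - sm 2 (c n)"
        by (simp add: cS sm_simps double[symmetric] algebra_simps)
      finally have "adj (u n) * u n - 1 = sm 2 (c (Suc n) - c n)"
        by (simp add: sm_simps)
      then show ?thesis using cd[of n] by (simp add: r_def p_sm C_closed cC)
    qed
  qed
qed

text \<open>A unitary has seminorm at most one for every C*-seminorm \<open>q\<close>, hence so has its real part;
  this bounds \<open>q\<close> on self-adjoint elements, and the C*-identity extends the bound to all.\<close>

theorem complete_contractive: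
  assumes complete: "\<And>X. (\<And>n. X n \<in> C) \<Longrightarrow>
        (\<And>e. 0 < e \<Longrightarrow> \<exists>N. \<forall>m\<ge>N. \<forall>n\<ge>N. p (X m - X n) < e) \<Longrightarrow>
        \<exists>x\<in>C. (\<lambda>n. p (X n - x)) \<longlonglongrightarrow> 0"
    and q: "cstar_seminormed sm adj C q"
    and null: "\<And>x. x \<in> C \<Longrightarrow> p x = 0 \<Longrightarrow> q x = 0"
    and x: "x \<in> C"
  shows "q x \<le> p x"
proof -
  interpret q: cstar_seminormed sm adj C q by fact
  have unit: "q h \<le> 1" if h: "h \<in> C" "adj h = h" "p h < 1" for h
  proof -
    obtain u where u: "\<And>n. u n \<in> C" "\<And>n. u n + adj (u n) = h + h"
      "\<And>n. p (u (Suc n) - u n) \<le> p h ^ n"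
      "\<And>n. p (adj (u n) * u n - 1) \<le> 2 * p h ^ n"
      using approx_unitary[OF h] by metis
    have r: "0 \<le> p h" "p h < 1" using h p_nonneg by auto
    obtain v where v: "v \<in> C" "(\<lambda>n. p (u n - v)) \<longlonglongrightarrow> 0"
      using complete[OF u(1) geometric_Cauchy[OF u(1) u(3) r]] by blast
    have pw: "(\<lambda>n. p h ^ n) \<longlonglongrightarrow> 0" using r by (intro LIMSEQ_realpow_zero) auto
    have "p (adj v * v - 1) \<le> 0"
    proof (rule tendsto_lowerbound)
      show "(\<lambda>n. (p (u n - v) * p v + (p v + p (u n - v)) * p (u n - v)) + 2 * p h ^ n) \<longlonglongrightarrow> 0"
        by (rule tendsto_eq_intros v pw refl | simp)+
      have "p (adj v * v - 1) \<le> (p (u n - v) * p v + (p v + p (u n - v)) * p (u n - v)) + 2 * p h ^ n" for n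
      proof -
        have "p (adj v * v - 1) \<le> p (adj v * v - adj (u n) * u n) + p (adj (u n) * u n - 1)"
          by (intro p_triangle C_closed u v)
        moreover have "p (adj v - adj (u n)) = p (u n - v)"
          using p_adj[of "v - u n"] u v by (simp add: C_closed adj_simps p_commute)
        then have "p (adj v * v - adj (u n) * u n) \<le> p (u n - v) * p v + p (adj (u n)) * p (v - u n)"
          using p_mult_diff[of "adj v" v "adj (u n)" "u n"] u v by (simp add: C_closed)
        moreover have "p (adj (u n)) * p (v - u n) \<le> (p v + p (u n - v)) * p (u n - v)"
          using u v p_le_diff[of "u n" v] by (simp add: p_adj p_commute[of v] mult_right_mono p_nonneg C_closed)
        ultimately show ?thesis using u(4)[of n] by linarith
      qed
      then show "\<forall>\<^sub>F n in sequentially. p (adj v * v - 1) \<le>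
          (p (u n - v) * p v + (p v + p (u n - v)) * p (u n - v)) + 2 * p h ^ n" by simp
    qed simp
    then have "q (adj v * v - 1) = 0"
      using null[of "adj v * v - 1"] p_nonneg[of "adj v * v - 1"] v by (simp add: C_closed)
    then have "q (adj v * v) = q 1"
      using q.p_diff_zero_eq[of "adj v * v" 1] v by (simp add: C_closed)
    then have "(q v)\<^sup>2 \<le> 1" using q.p_cstar[of v] q.p_one v by simp
    then have qv: "q v \<le> 1" using abs_square_le_1[of "q v"] by simp
    have "p (v + adj v - (h + h)) \<le> 0"
    proof (rule tendsto_lowerbound)
      show "(\<lambda>n. 2 * p (u n - v)) \<longlonglongrightarrow> 0" by (rule tendsto_eq_intros v refl | simp)+
      have "p (v + adj v - (h + h)) \<le> 2 * p (u n - v)" for n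
      proof -
        have "v + adj v - (h + h) = (v - u n) + adj (v - u n)"
          unfolding u(2)[of n, symmetric] by (simp add: adj_simps algebra_simps)
        then have "p (v + adj v - (h + h)) = p ((v - u n) + adj (v - u n))" by (rule arg_cong)
        then show ?thesis
          using p_add[of "v - u n" "adj (v - u n)"] u v by (simp add: p_adj C_closed p_commute[of v])
      qed
      then show "\<forall>\<^sub>F n in sequentially. p (v + adj v - (h + h)) \<le> 2 * p (u n - v)" by simp
    qed simp
    then have "q (v + adj v - (h + h)) = 0"
      using null[of "v + adj v - (h + h)"] p_nonneg[of "v + adj v - (h + h)"] v h by (simp add: C_closed)
    then have "q (v + adj v) = q (h + h)"
      using q.p_diff_zero_eq[of "v + adj v" "h + h"] v h by (simp add: C_closed)
    then have "2 * q h \<le> q v + q (adj v)"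
      using q.p_add[of v "adj v"] v h by (simp add: double q.p_sm C_closed)
    then show ?thesis using qv v by (simp add: q.p_adj)
  qed
  have sa: "q h \<le> p h" if h: "h \<in> C" "adj h = h" for h
  proof (rule field_le_epsilon)
    fix e :: real assume e: "0 < e"
    define t where "t = p h + e"
    have t: "t > 0" "p h < t" using e p_nonneg[OF h(1)] by (auto simp: t_def)
    have "q (sm (complex_of_real (1 / t)) h) \<le> 1"
      using t h by (intro unit) (auto simp: C_closed adj_simps p_sm norm_divide)
    then have "q h \<le> t" using t h by (simp add: q.p_sm norm_divide field_simps)
    then show "q h \<le> p h + e" by (simp add: t_def)
  qed
  have "(q x)\<^sup>2 \<le> (p x)\<^sup>2"
    using sa[of "adj x * x"] x by (simp add: C_closed adj_simps p_cstar q.p_cstar)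
  then show ?thesis using p_nonneg[OF x] by (rule power2_le_imp_le)
qed

end

section \<open>Quotients by *-ideals\<close>

context cstar_seminormed
begin

definition quotient_seminorm :: "'r set \<Rightarrow> 'r \<Rightarrow> real" where
  "quotient_seminorm J x = (INF j\<in>J. p (x - j))"

text \<open>The elements \<open>y + w\<close> and \<open>y - w\<close> with \<open>w = i t h y\<close> have the same absolute square, hence
  the same seminorm, and \<open>y\<close> is their mean.\<close>

lemma le_p_one_plus_imaginary:
  assumes "y \<in> C" "h \<in> C" "adj h = h"
  shows "p y \<le> p (y + sm (\<i> * complex_of_real t) (h * y))"
proof -
  define w where "w = sm (\<i> * complex_of_real t) (h * y)"
  have w: "w \<in> C" using assms by (simp add: w_def C_closed)
  have wy: "adj w * y = - (adj y * w)"
    using assms by (simp add: w_def adj_simps sm_simps sm_minus_left mult.assoc)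
  have "adj (y + w) * (y + w) = adj (y - w) * (y - w)"
    using wy by (simp add: adj_simps algebra_simps)
  then have "p (y + w) = p (y - w)"
    using p_cstar[of "y + w"] p_cstar[of "y - w"] p_nonneg[of "y + w"] p_nonneg[of "y - w"] assms w
    by (simp add: C_closed)
  moreover have "2 * p y \<le> p (y + w) + p (y - w)"
    using p_add[of "y + w" "y - w"] assms w by (simp add: C_closed double p_sm)
  ultimately show ?thesis by (simp add: w_def)
qed

lemma geometric_sum_left: "(1 - z) * (\<Sum>k<n. z ^ k) = 1 - z ^ n" for z :: 'r
proof (induction n)
  case (Suc n)
  have "(1 - z) * (\<Sum>k<Suc n. z ^ k) = (1 - z) * (\<Sum>k<n. z ^ k) + (1 - z) * z ^ n"
    by (simp add: distrib_left)
  then show ?case unfolding Suc.IH by (simp add: left_diff_distrib)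
qed simp

text \<open>In a complete algebra \<open>1 + i t h\<close> is invertible and its inverse \<open>s\<close> is a contraction
  with \<open>\<parallel>h s\<parallel> \<le> 2 / t\<close>, congruent to \<open>1\<close> modulo the ideal of \<open>h\<close>.  Without
  completeness the inverse is replaced by a partial sum of the Neumann series
  \<open>\<omega> (1 + z + z\<^sup>2 + \<dots>)\<close> with \<open>z = 1 - \<omega> (1 + i t h)\<close>.  Since
  \<open>p(z)\<^sup>2 \<le> (1 - \<omega>)\<^sup>2 + \<omega>\<^sup>2 t\<^sup>2 p(h)\<^sup>2\<close>, the choice
  \<open>\<omega> = 1 / (1 + t\<^sup>2 p(h)\<^sup>2)\<close> makes \<open>z\<close> a strict contraction.\<close>

lemma approximate_resolvent:
  assumes h: "h \<in> C" "adj h = h" and e: "0 < e"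
  obtains r where "r \<in> C" "p (r + sm (\<i> * complex_of_real t) (h * r) - 1) < e"
proof -
  define M where "M = t\<^sup>2 * (p h)\<^sup>2"
  define \<omega> where "\<omega> = 1 / (1 + M)"
  have M: "M \<ge> 0" by (simp add: M_def)
  then have \<omega>: "0 < \<omega>" "\<omega> \<le> 1" and \<omega>M: "\<omega> + \<omega> * M = 1" 
    by (auto simp: \<omega>_def field_simps)
  define g where "g = 1 + sm (\<i> * complex_of_real t) h"
  define z where "z = 1 - sm (complex_of_real \<omega>) g"
  have z: "z \<in> C" using h by (simp add: z_def g_def C_closed)
  have zeq: "z = sm (complex_of_real (1 - \<omega>)) 1 - sm (\<i> * complex_of_real (\<omega> * t)) h"
    by (simp add: z_def g_def sm_simps sm_diff_left mult.left_commute)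
  have adjz: "adj z = sm (complex_of_real (1 - \<omega>)) 1 + sm (\<i> * complex_of_real (\<omega> * t)) h"
    unfolding zeq by (simp only: adj_simps h complex_cnj_mult complex_cnj_i complex_cnj_complex_of_real mult_minus_left sm_minus_left diff_minus_eq_add)
  have "adj z * z = sm (complex_of_real ((1 - \<omega>)\<^sup>2)) 1 + sm (complex_of_real ((\<omega> * t)\<^sup>2)) (h * h)"
  proof -
    have "(sm a 1 + sm b h) * (sm a 1 - sm b h) = sm (a * a) 1 - sm (b * b) (h * h)" for a b
      by (simp add: distrib_right right_diff_distrib sm_simps mult.commute)
    from this[of "complex_of_real (1 - \<omega>)" "\<i> * complex_of_real (\<omega> * t)"]
    have "adj z * z = sm (complex_of_real (1 - \<omega>) * complex_of_real (1 - \<omega>)) 1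
        - sm (\<i> * complex_of_real (\<omega> * t) * (\<i> * complex_of_real (\<omega> * t))) (h * h)"
      unfolding adjz[symmetric] zeq[symmetric] .
    then show ?thesis by (simp add: sm_sm power2_eq_square algebra_simps sm_minus_left)
  qed
  then have "(p z)\<^sup>2 = p (sm (complex_of_real ((1 - \<omega>)\<^sup>2)) 1 + sm (complex_of_real ((\<omega> * t)\<^sup>2)) (h * h))"
    using p_cstar[OF z] by simp
  also have "\<dots> \<le> (1 - \<omega>)\<^sup>2 * p 1 + (\<omega> * t)\<^sup>2 * p (h * h)"
  proof -
    have "cmod (complex_of_real (a\<^sup>2)) = a\<^sup>2" for a by (simp only: norm_of_real) simp
    then show ?thesis
      using p_add[of "sm (complex_of_real ((1 - \<omega>)\<^sup>2)) 1" "sm (complex_of_real ((\<omega> * t)\<^sup>2)) (h * h)"]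
      by (simp only: p_sm C_closed h)
  qed
  also have "\<dots> \<le> (1 - \<omega>)\<^sup>2 * 1 + (\<omega> * t)\<^sup>2 * (p h)\<^sup>2"
    using p_one p_mult[OF h(1) h(1)] by (intro add_mono mult_left_mono) (auto simp: power2_eq_square)
  also have "\<dots> = (1 - \<omega>)\<^sup>2 + \<omega> * (\<omega> * M)"
    by (simp add: M_def power_mult_distrib) (simp add: power2_eq_square)
  also have "\<omega> * M = 1 - \<omega>" using \<omega>M by simp
  also have "(1 - \<omega>)\<^sup>2 + \<omega> * (1 - \<omega>) = 1 - \<omega>" by (simp add: power2_eq_square algebra_simps)
  finally have "(p z)\<^sup>2 < 1" using \<omega> by simp
  then have pz: "0 \<le> p z" "p z < 1" using p_nonneg[OF z] by (auto simp: abs_square_less_1)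
  then have "(\<lambda>n. p z ^ n) \<longlonglongrightarrow> 0" by (intro LIMSEQ_realpow_zero) auto
  then have "\<forall>\<^sub>F n in sequentially. p z ^ n < e" using e by (rule order_tendstoD)
  then obtain n where n: "p z ^ n < e" by (auto simp: eventually_sequentially)
  define r where "r = sm (complex_of_real \<omega>) (\<Sum>k<n. z ^ k)"
  have r: "r \<in> C" using z by (auto simp: r_def intro!: C_closed C_sum)
  have "r + sm (\<i> * complex_of_real t) (h * r) = g * r"
    by (simp add: g_def distrib_right sm_mult_left)
  also have "\<dots> = (1 - z) * (\<Sum>k<n. z ^ k)"
    by (simp add: r_def z_def sm_mult_left sm_mult_right)
  finally have "r + sm (\<i> * complex_of_real t) (h * r) - 1 = - (z ^ n)"
    by (simp add: geometric_sum_left)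
  then have "p (r + sm (\<i> * complex_of_real t) (h * r) - 1) < e"
    using p_power[OF z, of n] n z by (simp add: p_minus C_closed)
  then show ?thesis using r that by blast
qed

text \<open>The element \<open>c h r\<close>, which lies in every ideal containing \<open>h\<close>, acts as an approximate
  unit for \<open>h\<close>: it is \<open>1 - s\<close> for an approximation \<open>s\<close> of the resolvent above.\<close>

lemma approximate_unit:
  assumes h: "h \<in> C" "adj h = h" and e: "0 < e"
  obtains c r where "r \<in> C" "p (1 - sm c (h * r)) \<le> 1 + e" "p (h * (1 - sm c (h * r))) \<le> e"
proof -
  \<comment> \<open>With an error \<open>\<eta>\<close> in the resolvent, \<open>p(h s) \<le> 3 / t + p(h) \<eta>\<close>; the first term is
      \<open>3 e / 8\<close> for \<open>t = 8 / e\<close>, and the second is at most \<open>e / 2\<close>.\<close>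
  define \<eta> where "\<eta> = min (1/2) (min (e/2) (e / (2 * (p h + 1))))"
  have ph: "0 \<le> p h" using h p_nonneg by simp
  have "0 < \<eta>" using e ph by (simp add: \<eta>_def)
  moreover have "\<eta> \<le> 1/2" "\<eta> \<le> e/2" "\<eta> \<le> e / (2 * (p h + 1))"
    unfolding \<eta>_def by linarith+
  ultimately have \<eta>: "0 < \<eta>" "\<eta> \<le> 1/2" "\<eta> \<le> e/2" "\<eta> \<le> e / (2 * (p h + 1))" by blast+
  define t where "t = 8 / e"
  have t: "t > 0" using e by (simp add: t_def)
  obtain r where r: "r \<in> C" "p (r + sm (\<i> * complex_of_real t) (h * r) - 1) < \<eta>"
    using approximate_resolvent[OF h \<eta>(1)] by metis
  define w where "w = sm (\<i> * complex_of_real t) (h * r)"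
  have w: "w \<in> C" using h r by (simp add: w_def C_closed)
  have rw: "p (r + w - 1) < \<eta>" using r by (simp add: w_def)
  have "p r \<le> p (r + w)" unfolding w_def by (rule le_p_one_plus_imaginary) (use h r in auto)
  also have "\<dots> \<le> p 1 + p (r + w - 1)" by (rule p_le_diff) (auto simp: r w C_closed)
  finally have pr: "p r \<le> 1 + \<eta>" using rw p_one by simp
  have d: "p (1 - w - r) < \<eta>"
    using rw p_commute[of "r + w" 1] r w by (simp add: C_closed diff_diff_add add.commute)
  have ps: "p (1 - w) \<le> 1 + 2 * \<eta>"
    using p_le_diff[of "1 - w" r] d pr r w by (simp add: C_closed)
  have "p w \<le> 3" using p_le_diff[of w 1] p_commute[of w 1] ps \<eta> p_one w by (simp add: C_closed)
  moreover have "p w = t * p (h * r)" using h r t by (simp add: w_def p_sm C_closed norm_mult)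
  ultimately have "8 * p (h * r) \<le> 3 * e" using e by (simp add: t_def field_simps)
  moreover have "p (h * (1 - w)) \<le> p (h * r) + p h * p (1 - w - r)"
    using p_le_diff[of "h * (1 - w)" "h * r"] p_mult[of h "1 - w - r"] h r w
    by (simp add: C_closed right_diff_distrib[symmetric])
  moreover have "p h * p (1 - w - r) \<le> e / 2"
  proof -
    have "p h * p (1 - w - r) \<le> (p h + 1) * (e / (2 * (p h + 1)))"
      using ph d \<eta> p_nonneg[of "1 - w - r"] r w by (intro mult_mono) (auto simp: C_closed)
    also have "\<dots> = e / 2"
      using ph mult_divide_mult_cancel_left[of "p h + 1" e 2] by (simp add: mult.commute)
    finally show ?thesis .
  qed
  ultimately have "p (h * (1 - w)) \<le> e" using e by simp
  then show ?thesis using that[of r "\<i> * complex_of_real t"] ps \<eta> r by (simp add: w_def)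
qed

text \<open>Only the inequality \<open>q(x)\<^sup>2 \<le> q(x\<^sup>* x)\<close> is not formal.  If a self-adjoint
  \<open>h\<close> in the ideal nearly attains the distance of \<open>x\<^sup>* x\<close>, and \<open>1 - s\<close> is an
  approximate unit for \<open>h\<close> in the ideal, then \<open>x - x (1 - s) = x s\<close> and
  \<open>p(x s)\<^sup>2 \<le> p(s\<^sup>* (x\<^sup>* x - h) s) + p(s\<^sup>* h s)\<close>, where the first term is
  about \<open>p(x\<^sup>* x - h)\<close> and the second is small.\<close>

theorem quotient_seminorm_cstar:
  assumes JC: "J \<subseteq> C" and J0: "0 \<in> J" and Jadd: "\<And>x y. x \<in> J \<Longrightarrow> y \<in> J \<Longrightarrow> x + y \<in> J"
    and Jr: "\<And>x y. x \<in> J \<Longrightarrow> y \<in> C \<Longrightarrow> x * y \<in> J"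
    and Jl: "\<And>x y. x \<in> J \<Longrightarrow> y \<in> C \<Longrightarrow> y * x \<in> J"
    and Jadj: "\<And>x. x \<in> J \<Longrightarrow> adj x \<in> J"
  shows "cstar_seminormed sm adj C (quotient_seminorm J)"
proof -
  let ?q = "quotient_seminorm J"
  have JC': "x \<in> C" if "x \<in> J" for x using that JC by blast
  have Jsm: "sm c x \<in> J" if "x \<in> J" for c x
    using Jl[OF that C_sm[OF C_one], of c] by (simp add: sm_mult_left)
  have bdd: "bdd_below ((\<lambda>j. p (x - j)) ` J)" if "x \<in> C" for x
    by (rule bdd_belowI[of _ 0]) (auto intro!: p_nonneg C_closed that dest: JC')
  have q_le: "?q x \<le> p (x - j)" if "x \<in> C" "j \<in> J" for x j
    unfolding quotient_seminorm_def using bdd that by (intro cINF_lower)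
  have q_ge: "m \<le> ?q x" if "\<And>j. j \<in> J \<Longrightarrow> m \<le> p (x - j)" for m x
    unfolding quotient_seminorm_def using J0 that by (intro cINF_greatest) auto
  have q_near: "\<exists>j\<in>J. p (x - j) < ?q x + e" if "x \<in> C" "0 < e" for x e
  proof (rule ccontr)
    assume "\<not> ?thesis"
    then have "?q x + e \<le> ?q x" by (intro q_ge) (auto simp: not_less)
    then show False using that by simp
  qed
  have q0: "0 \<le> ?q x" if "x \<in> C" for x by (rule q_ge) (auto intro!: p_nonneg C_closed that dest: JC')
  have q_adj_le: "?q (adj x) \<le> ?q x" if "x \<in> C" for x
  proof (rule q_ge)
    fix j assume j: "j \<in> J"
    have "?q (adj x) \<le> p (adj x - adj j)" using that j by (intro q_le Jadj C_closed)
    also have "\<dots> = p (x - j)" using that j JC' p_adj[of "x - j"] by (simp add: adj_simps C_closed)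
    finally show "?q (adj x) \<le> p (x - j)" .
  qed
  have q_mult: "?q (x * y) \<le> ?q x * ?q y" if xy: "x \<in> C" "y \<in> C" for x y
  proof (rule tendsto_lowerbound)
    show "((\<lambda>e. (?q x + e) * (?q y + e)) \<longlongrightarrow> ?q x * ?q y) (at_right 0)"
      by (rule tendsto_eq_intros refl | simp)+
    have "?q (x * y) \<le> (?q x + e) * (?q y + e)" if e: "0 < e" for e
    proof -
      obtain j k where j: "j \<in> J" "p (x - j) < ?q x + e" and k: "k \<in> J" "p (y - k) < ?q y + e"
        using q_near[OF xy(1) e] q_near[OF xy(2) e] by blast
      have "x * y - (x - j) * (y - k) = j * y + (x - j) * k" by (simp add: algebra_simps)
      moreover have "j * y + (x - j) * k \<in> J"
        by (intro Jadd Jl Jr C_closed j k xy JC')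
      ultimately have "x * y - (x - j) * (y - k) \<in> J" by simp
      from q_le[OF C_mult[OF xy] this] have "?q (x * y) \<le> p ((x - j) * (y - k))" by simp
      also have "\<dots> \<le> p (x - j) * p (y - k)" using j k JC' xy by (intro p_mult C_closed)
      also have "\<dots> \<le> (?q x + e) * (?q y + e)"
        using j k JC' xy q0 e by (intro mult_mono) (auto intro!: p_nonneg C_closed add_nonneg_nonneg)
      finally show ?thesis .
    qed
    then show "\<forall>\<^sub>F e in at_right 0. ?q (x * y) \<le> (?q x + e) * (?q y + e)"
      by (auto simp: eventually_at_right_less eventually_at_filter)
  qed simp
  show ?thesis
  proof
    show "0 \<le> ?q x" if "x \<in> C" for x using q0[OF that] .
    show "?q (x + y) \<le> ?q x + ?q y" if xy: "x \<in> C" "y \<in> C" for x y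
    proof (rule field_le_epsilon)
      fix e :: real assume "0 < e"
      then have e: "0 < e / 2" by simp
      obtain j k where j: "j \<in> J" "p (x - j) < ?q x + e / 2" and k: "k \<in> J" "p (y - k) < ?q y + e / 2"
        using q_near[OF xy(1) e] q_near[OF xy(2) e] by blast
      have "?q (x + y) \<le> p ((x + y) - (j + k))" by (intro q_le Jadd C_closed xy j k)
      also have "\<dots> = p ((x - j) + (y - k))" by (simp add: algebra_simps)
      also have "\<dots> \<le> p (x - j) + p (y - k)" using j k JC' xy by (intro p_add C_closed)
      finally show "?q (x + y) \<le> ?q x + ?q y + e" using j k by simp
    qed
    have sm_le: "?q (sm c x) \<le> cmod c * ?q x" if x: "x \<in> C" and c: "c \<noteq> 0" for c x
    proof -
      have "?q (sm c x) / cmod c \<le> ?q x"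
      proof (rule q_ge)
        fix j assume j: "j \<in> J"
        have "?q (sm c x) \<le> p (sm c x - sm c j)" by (intro q_le Jsm C_closed j x)
        also have "\<dots> = cmod c * p (x - j)" using j JC' x by (simp add: sm_diff_right[symmetric] p_sm C_closed)
        finally show "?q (sm c x) / cmod c \<le> p (x - j)" using c by (simp add: field_simps)
      qed
      then show ?thesis using c by (simp add: field_simps)
    qed
    show "?q (sm c x) = cmod c * ?q x" if x: "x \<in> C" for c x
    proof (cases "c = 0")
      case True
      have "?q 0 \<le> 0" using q_le[OF C_zero J0] by (simp add: p_zero)
      then show ?thesis using True q0[OF C_zero] by (simp add: sm_zero_left)
    next
      case False
      have "?q (sm (inverse c) (sm c x)) \<le> cmod (inverse c) * ?q (sm c x)"
        using False x by (intro sm_le C_closed) auto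
      then have "cmod c * ?q x \<le> ?q (sm c x)" using False by (simp add: sm_sm sm_one norm_inverse norm_divide field_simps)
      then show ?thesis using sm_le[OF x False] by simp
    qed
    show "?q (x * y) \<le> ?q x * ?q y" if "x \<in> C" "y \<in> C" for x y using q_mult[OF that] .
    show "?q (adj x * x) = (?q x)\<^sup>2" if x: "x \<in> C" for x
    proof (rule antisym)
      have "?q (adj x * x) \<le> ?q (adj x) * ?q x" using x by (intro q_mult C_closed)
      also have "\<dots> \<le> ?q x * ?q x" using q_adj_le[OF x] q0[OF x] by (intro mult_right_mono)
      finally show "?q (adj x * x) \<le> (?q x)\<^sup>2" by (simp add: power2_eq_square)
      show "(?q x)\<^sup>2 \<le> ?q (adj x * x)"
      proof (rule tendsto_lowerbound)
        show "((\<lambda>e. (1 + e)\<^sup>2 * (?q (adj x * x) + e) + (1 + e) * e) \<longlongrightarrow> ?q (adj x * x)) (at_right 0)"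
          by (rule tendsto_eq_intros refl | simp)+
        have "(?q x)\<^sup>2 \<le> (1 + e)\<^sup>2 * (?q (adj x * x) + e) + (1 + e) * e" if e: "0 < e" for e
        proof -
          obtain j where j: "j \<in> J" "p (adj x * x - j) < ?q (adj x * x) + e"
            using q_near[OF C_mult[OF C_adj[OF x] x] e] by blast
          define h where "h = sm (1/2) (j + adj j)"
          have hJ: "h \<in> J" unfolding h_def by (intro Jsm Jadd Jadj j)
          then have h: "h \<in> C" "adj h = h" by (auto simp: h_def adj_simps add.commute JC')
          have "adj x * x - h = sm (1/2) ((adj x * x - j) + adj (adj x * x - j))"
          proof -
            have "adj x * x - h = (sm (1/2) (adj x * x) + sm (1/2) (adj x * x)) - h"
              by (simp only: half_double)
            then show ?thesis by (simp add: h_def adj_simps sm_simps algebra_simps)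
          qed
          then have "p (adj x * x - h) \<le> (p (adj x * x - j) + p (adj (adj x * x - j))) / 2"
            using p_add[of "adj x * x - j" "adj (adj x * x - j)"] j JC' x by (simp add: p_sm C_closed)
          then have xh: "p (adj x * x - h) < ?q (adj x * x) + e" 
            using j JC' x by (simp add: p_adj C_closed)
          obtain c r where r: "r \<in> C" and s1: "p (1 - sm c (h * r)) \<le> 1 + e"
            and s2: "p (h * (1 - sm c (h * r))) \<le> e"
            using approximate_unit[OF h e] by metis
          define s where "s = 1 - sm c (h * r)"
          have s: "s \<in> C" "p s \<le> 1 + e" "p (h * s) \<le> e" "0 \<le> p s" "1 - s \<in> J"
            using r h s1 s2 hJ by (auto simp: s_def C_closed intro!: p_nonneg Jsm Jr)
          have "?q x \<le> p (x - x * (1 - s))" using s x by (intro q_le Jl)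
          then have "?q x \<le> p (x * s)" by (simp add: algebra_simps)
          then have "(?q x)\<^sup>2 \<le> (p (x * s))\<^sup>2" using q0[OF x] by (intro power_mono)
          also have "\<dots> = p (adj s * (adj x * x - h) * s + adj s * (h * s))"
            using p_cstar[of "x * s"] x s by (simp add: C_closed adj_simps algebra_simps)
          also have "\<dots> \<le> p (adj s * (adj x * x - h) * s) + p (adj s * (h * s))"
            using x s h by (intro p_add C_closed)
          also have "p (adj s * (adj x * x - h) * s) \<le> p (adj s * (adj x * x - h)) * p s"
            using x s h by (intro p_mult C_closed)
          also have "p (adj s * (adj x * x - h)) \<le> p (adj s) * p (adj x * x - h)"
            using x s h by (intro p_mult C_closed)
          also have "p (adj s * (h * s)) \<le> p (adj s) * p (h * s)"
            using x s h by (intro p_mult C_closed)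
          finally have "(?q x)\<^sup>2 \<le> p s * p (adj x * x - h) * p s + p s * p (h * s)"
            using s by (simp add: p_adj mult_right_mono)
          also have "\<dots> \<le> (1 + e) * (?q (adj x * x) + e) * (1 + e) + (1 + e) * e"
            using s e xh x h q0[OF C_mult[OF C_adj[OF x] x]]
            by (intro add_mono mult_mono) (auto intro!: p_nonneg C_closed mult_nonneg_nonneg)
          finally show ?thesis by (simp add: power2_eq_square ac_simps)
        qed
        then show "\<forall>\<^sub>F e in at_right 0. (?q x)\<^sup>2 \<le> (1 + e)\<^sup>2 * (?q (adj x * x) + e) + (1 + e) * e"
          by (auto simp: eventually_at_right_less eventually_at_filter)
      qed simp
    qed
  qed (fact C_one C_add C_mult C_sm C_adj)+
qed

end

section \<open>The free *-algebra and universal C*-seminorms\<close>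

lemma star_word_star_word: "star_word (star_word w) = w"
  by (cases w) (simp add: star_word_def rev_map comp_def case_prod_unfold)

lemma inj_star_word: "inj star_word"
  by (metis injI star_word_star_word)

lemma star_word_plus: "star_word (v + w) = star_word w + star_word v"
  by (simp add: star_word_def plus_word_def)

lemma star_word_zero: "star_word 0 = 0"
  by (simp add: star_word_def zero_word_def)

lemma lookup_free_star:
  "Poly_Mapping.lookup (free_star x) w = cnj (Poly_Mapping.lookup x (star_word w))"
  by (simp add: free_star_def map.rep_eq map_key.rep_eq[OF inj_star_word] when_def)

lemma free_star_add: "free_star (x + y) = free_star x + free_star y"
  by (rule poly_mapping_eqI) (simp add: lookup_free_star lookup_add)

lemma free_star_zero: "free_star 0 = 0"
  by (rule poly_mapping_eqI) (simp add: lookup_free_star)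

lemma free_star_single:
  "free_star (Poly_Mapping.single w c) = Poly_Mapping.single (star_word w) (cnj c)"
  by (rule poly_mapping_eqI)
    (auto simp: lookup_free_star lookup_single when_def star_word_star_word)

lemma free_star_free_star: "free_star (free_star x) = x"
  by (rule poly_mapping_eqI) (simp add: lookup_free_star star_word_star_word)

lemma poly_mapping_single_induct [case_names zero single add]:
  fixes x :: "'k \<Rightarrow>\<^sub>0 'b::comm_monoid_add"
  assumes "P 0" "\<And>k c. P (Poly_Mapping.single k c)" "\<And>x y. P x \<Longrightarrow> P y \<Longrightarrow> P (x + y)"
  shows "P x"
proof (induction x rule: update_induct)
  case (update f a b)
  have "Poly_Mapping.update a b f = f + Poly_Mapping.single a b"
    using update by (intro poly_mapping_eqI)
      (auto simp: lookup_add lookup_update lookup_single when_def in_keys_iff)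
  then show ?case using assms update by simp
qed (use assms in simp)

lemma free_star_mult: "free_star (x * y) = free_star y * free_star x"
proof (induction x rule: poly_mapping_single_induct)
  case (single v c)
  show ?case
  proof (induction y rule: poly_mapping_single_induct)
    case (single w d)
    show ?case by (simp add: mult_single free_star_single star_word_plus mult.commute)
  qed (simp_all add: distrib_left distrib_right free_star_add free_star_zero)
qed (simp_all add: distrib_left distrib_right free_star_add free_star_zero)

lemma single_zero_central: "x * Poly_Mapping.single 0 c = Poly_Mapping.single 0 c * x"
  for x :: "'g free_star_alg"
  by (induction x rule: poly_mapping_single_induct)
    (simp_all add: mult_single distrib_left distrib_right mult.commute)

interpretation free: involutive_algebra free_scal free_star
proof
  fix c d :: complex and x y :: "'g free_star_alg"
  show "free_scal (c + d) x = free_scal c x + free_scal d x"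
    by (simp add: free_scal_def single_add distrib_right)
  show "free_scal c (free_scal d x) = free_scal (c * d) x"
    by (simp add: free_scal_def mult.assoc[symmetric] mult_single)
  show "free_scal 1 x = x" by (simp add: free_scal_def single_one)
  show "x * free_scal c y = free_scal c (x * y)"
    unfolding free_scal_def by (metis mult.assoc single_zero_central)
  show "free_star (free_scal c x) = free_scal (cnj c) (free_star x)"
    by (simp add: free_scal_def free_star_mult free_star_single star_word_zero single_zero_central)
qed (simp_all add: free_scal_def distrib_left free_star_add free_star_mult free_star_free_star mult.assoc)

lemma cstar_seminormed_free:
  "cstar_seminorm p \<longleftrightarrow> cstar_seminormed free_scal free_star UNIV p"
  unfolding cstar_seminorm_def cstar_seminormed_def cstar_seminormed_axioms_def
  by (auto simp: free.involutive_algebra_axioms)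

lemma free_star_alg_induct [case_names one gen add mult scal star]:
  fixes x :: "'g free_star_alg"
  assumes one: "P 1" and gen: "\<And>g. P (free_gen g)" and add: "\<And>x y. P x \<Longrightarrow> P y \<Longrightarrow> P (x + y)"
    and mult: "\<And>x y. P x \<Longrightarrow> P y \<Longrightarrow> P (x * y)" and scal: "\<And>c x. P x \<Longrightarrow> P (free_scal c x)"
    and star: "\<And>x. P x \<Longrightarrow> P (free_star x)"
  shows "P x"
proof (induction x rule: poly_mapping_single_induct)
  case zero
  show ?case using scal[OF one, of 0] by (simp add: free.sm_zero_left)
next
  case (single w c)
  have "P (Poly_Mapping.single (Word l) 1)" for l
  proof (induction l)
    case Nil
    show ?case using one by (simp flip: zero_word_def)
  next
    case (Cons gb l)
    obtain g b where gb: "gb = (g, b)" by (cases gb)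
    have "Poly_Mapping.single (Word [gb]) 1 = (if b then free_star (free_gen g) else free_gen g)"
      by (simp add: gb free_gen_def free_star_single star_word_def)
    then have "P (Poly_Mapping.single (Word [gb]) 1)" using gen star by simp
    moreover have "Poly_Mapping.single (Word (gb # l)) (1::complex)
        = Poly_Mapping.single (Word [gb]) 1 * Poly_Mapping.single (Word l) 1"
      by (simp add: mult_single plus_word_def)
    ultimately show ?case using Cons mult by simp
  qed
  then have "P (Poly_Mapping.single w 1)" by (cases w) blast
  then have "P (free_scal c (Poly_Mapping.single w 1))" by (rule scal)
  then show ?case by (simp add: free_scal_def mult_single)
qed (rule add)

lemma seminorm_bounded:
  assumes P: "\<And>p. p \<in> P \<Longrightarrow> cstar_seminorm p"
    and gen: "\<And>g. \<exists>B. \<forall>p\<in>P. p (free_gen g) \<le> B"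
  shows "\<exists>B. \<forall>p\<in>P. p x \<le> B"
proof (induction x rule: free_star_alg_induct)
  case one
  have "p 1 \<le> 1" if "p \<in> P" for p
    using P[OF that] cstar_seminormed.p_one unfolding cstar_seminormed_free by blast
  then show ?case by blast
next
  case (gen g)
  show ?case by (rule assms(2))
next
  case (add x y)
  then obtain B D where "\<And>p. p \<in> P \<Longrightarrow> p x \<le> B" "\<And>p. p \<in> P \<Longrightarrow> p y \<le> D" by blast
  moreover have "p (x + y) \<le> p x + p y" if "p \<in> P" for p using P[OF that] by (simp add: cstar_seminorm_def)
  ultimately show ?case by (intro exI[of _ "B + D"]) (meson add_mono order_trans)
next
  case (mult x y)
  then obtain B D where B: "\<And>p. p \<in> P \<Longrightarrow> p x \<le> B" and D: "\<And>p. p \<in> P \<Longrightarrow> p y \<le> D" by blast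
  have "p (x * y) \<le> B * D" if p: "p \<in> P" for p
  proof -
    have "p (x * y) \<le> p x * p y" "0 \<le> p x" "0 \<le> p y" using P[OF p] by (simp_all add: cstar_seminorm_def)
    moreover have "p x * p y \<le> B * D"
      using B[OF p] D[OF p] calculation by (intro mult_mono) auto
    ultimately show ?thesis by simp
  qed
  then show ?case by blast
next
  case (scal c x)
  then obtain B where B: "\<And>p. p \<in> P \<Longrightarrow> p x \<le> B" by blast
  have "p (free_scal c x) \<le> cmod c * B" if "p \<in> P" for p
    using P[OF that] B[OF that] by (simp add: cstar_seminorm_def mult_left_mono)
  then show ?case by blast
next
  case (star x)
  have "p (free_star x) = p x" if "p \<in> P" for p
    using cstar_seminormed.p_adj[of free_scal free_star UNIV p x] P[OF that] by (simp add: cstar_seminormed_free)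
  then show ?case using star by metis
qed

text \<open>This is the condition under which the suprema in \<^const>\<open>universal_seminorm\<close> are finite.\<close>

definition bounded_relations :: "'g free_star_alg set \<Rightarrow> bool" where
  "bounded_relations Rel \<longleftrightarrow>
     (\<forall>g. \<exists>B. \<forall>p. cstar_seminorm p \<and> (\<forall>r\<in>Rel. p r = 0) \<longrightarrow> p (free_gen g) \<le> B)"

context
  fixes Rel :: "'g free_star_alg set"
  assumes bounded: "bounded_relations Rel"
begin

lemma universal_upper:
  assumes "cstar_seminorm p" "\<And>r. r \<in> Rel \<Longrightarrow> p r = 0"
  shows "p x \<le> universal_seminorm Rel x"
proof -
  obtain B where "\<forall>p\<in>{p. cstar_seminorm p \<and> (\<forall>r\<in>Rel. p r = 0)}. p x \<le> B"
    using seminorm_bounded[of "{p. cstar_seminorm p \<and> (\<forall>r\<in>Rel. p r = 0)}" x] bounded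
    unfolding bounded_relations_def by auto
  then show ?thesis unfolding universal_seminorm_def
    using assms by (intro cSup_upper) (auto intro!: bdd_aboveI)
qed

lemma cstar_seminorm_zero: "cstar_seminorm (\<lambda>_::'g free_star_alg. 0)"
  by (simp add: cstar_seminorm_def)

lemma universal_least:
  assumes "\<And>p. cstar_seminorm p \<Longrightarrow> (\<And>r. r \<in> Rel \<Longrightarrow> p r = 0) \<Longrightarrow> p x \<le> B"
  shows "universal_seminorm Rel x \<le> B"
  unfolding universal_seminorm_def
  using cstar_seminorm_zero assms by (intro cSup_least) fastforce+

lemma universal_vanishes: "r \<in> Rel \<Longrightarrow> universal_seminorm Rel r = 0"
  by (rule antisym) (auto intro: universal_least order_trans[OF _ universal_upper[OF cstar_seminorm_zero]])

lemma universal_cstar_seminorm: "cstar_seminorm (universal_seminorm Rel)"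
proof -
  let ?u = "universal_seminorm Rel"
  have nonneg: "0 \<le> ?u x" for x using universal_upper[OF cstar_seminorm_zero] by simp
  have scal_le: "?u (free_scal c x) \<le> cmod c * ?u x" for c x
    by (rule universal_least) (auto simp: cstar_seminorm_def intro!: mult_left_mono universal_upper)
  have scal: "?u (free_scal c x) = cmod c * ?u x" for c x
  proof (cases "c = 0")
    case True
    then show ?thesis using scal_le[of c x] nonneg[of "free_scal c x"] by simp
  next
    case False
    have "?u (free_scal (inverse c) (free_scal c x)) \<le> cmod (inverse c) * ?u (free_scal c x)"
      by (rule scal_le)
    then have "cmod c * ?u x \<le> ?u (free_scal c x)"
      using False by (simp add: free.sm_sm free.sm_one norm_inverse norm_divide field_simps)
    then show ?thesis using scal_le[of c x] by simp
  qed
  have star_le: "?u (free_star x * x) \<le> (?u x)\<^sup>2" for x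
    by (rule universal_least) (auto simp: cstar_seminorm_def intro!: power_mono universal_upper)
  have star_ge: "(?u x)\<^sup>2 \<le> ?u (free_star x * x)" for x
  proof -
    have "?u x \<le> sqrt (?u (free_star x * x))"
    proof (rule universal_least)
      fix p assume p: "cstar_seminorm p" "\<And>r. r \<in> Rel \<Longrightarrow> p r = 0"
      have "(p x)\<^sup>2 \<le> ?u (free_star x * x)"
        using universal_upper[OF p, of "free_star x * x"] p(1) by (simp add: cstar_seminorm_def)
      then show "p x \<le> sqrt (?u (free_star x * x))" by (rule real_le_rsqrt)
    qed
    then have "(?u x)\<^sup>2 \<le> (sqrt (?u (free_star x * x)))\<^sup>2" using nonneg by (intro power_mono)
    then show ?thesis using nonneg by simp
  qed
  show ?thesis unfolding cstar_seminorm_def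
  proof (intro conjI allI)
    show "?u (x + y) \<le> ?u x + ?u y" for x y
    proof (rule universal_least)
      fix p assume p: "cstar_seminorm p" "\<And>r. r \<in> Rel \<Longrightarrow> p r = 0"
      have "p (x + y) \<le> p x + p y" using p(1) by (simp add: cstar_seminorm_def)
      then show "p (x + y) \<le> ?u x + ?u y" using universal_upper[OF p, of x] universal_upper[OF p, of y] by simp
    qed
    show "?u (x * y) \<le> ?u x * ?u y" for x y
    proof (rule universal_least)
      fix p assume p: "cstar_seminorm p" "\<And>r. r \<in> Rel \<Longrightarrow> p r = 0"
      have "p (x * y) \<le> p x * p y" using p(1) by (simp add: cstar_seminorm_def)
      also have "\<dots> \<le> ?u x * ?u y"
        using p(1) by (intro mult_mono universal_upper p nonneg) (auto simp: cstar_seminorm_def)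
      finally show "p (x * y) \<le> ?u x * ?u y" .
    qed
    show "?u (free_star x * x) = (?u x)\<^sup>2" for x
      using star_le star_ge by (rule antisym)
  qed (fact nonneg scal)+
qed

end

section \<open>The algebra of Cauchy sequences\<close>

definition seq_scal :: "complex \<Rightarrow> (nat \<Rightarrow> 'g free_star_alg) \<Rightarrow> nat \<Rightarrow> 'g free_star_alg" where
  "seq_scal c X = (\<lambda>n. free_scal c (X n))"

definition seq_star :: "(nat \<Rightarrow> 'g free_star_alg) \<Rightarrow> nat \<Rightarrow> 'g free_star_alg" where
  "seq_star X = (\<lambda>n. free_star (X n))"

definition seq_norm :: "('g free_star_alg \<Rightarrow> real) \<Rightarrow> (nat \<Rightarrow> 'g free_star_alg) \<Rightarrow> real" where
  "seq_norm p X = lim (\<lambda>n. p (X n))"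

abbreviation cauchy_seqs :: "('g free_star_alg \<Rightarrow> real) \<Rightarrow> (nat \<Rightarrow> 'g free_star_alg) set" where
  "cauchy_seqs p \<equiv> carrier (cauchy_alg p)"

lemma cauchy_alg_simps [simp]:
  "mult (cauchy_alg p) X Y = X * Y" "one (cauchy_alg p) = 1"
  "zero (cauchy_alg p) = 0" "add (cauchy_alg p) X Y = X + Y"
  "scal (cauchy_alg p) = seq_scal" "invol (cauchy_alg p) = seq_star"
  "nrm (cauchy_alg p) = seq_norm p"
  by (simp_all add: cauchy_alg_def fun_eq_iff seq_scal_def seq_star_def seq_norm_def)

lemma cauchy_seqs_iff: "X \<in> cauchy_seqs p \<longleftrightarrow> (\<forall>e>0. \<exists>N. \<forall>m\<ge>N. \<forall>n\<ge>N. p (X m - X n) < e)"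
  by (simp add: cauchy_alg_def)

interpretation seqs: involutive_algebra seq_scal seq_star
  by standard (simp_all add: fun_eq_iff seq_scal_def seq_star_def free.sm_simps free.sm_add_left free.adj_simps)

context
  fixes p :: "'g free_star_alg \<Rightarrow> real"
  assumes p: "cstar_seminorm p"
begin

interpretation p: cstar_seminormed free_scal free_star UNIV p
  using p by (simp add: cstar_seminormed_free)

lemma const_Cauchy: "(\<lambda>_. x) \<in> cauchy_seqs p"
  by (simp add: cauchy_seqs_iff p.p_zero)

lemma seq_norm_tendsto:
  assumes X: "X \<in> cauchy_seqs p"
  shows "(\<lambda>n. p (X n)) \<longlonglongrightarrow> seq_norm p X"
proof -
  have "Cauchy (\<lambda>n. p (X n))"
  proof (rule metric_CauchyI)
    fix e :: real assume "0 < e"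
    then obtain N where "\<forall>m\<ge>N. \<forall>n\<ge>N. p (X m - X n) < e" using X by (auto simp: cauchy_seqs_iff)
    moreover have "dist (p x) (p y) \<le> p (x - y)" for x y using p.p_abs_diff[of x y] by (simp add: dist_real_def)
    ultimately show "\<exists>M. \<forall>m\<ge>M. \<forall>n\<ge>M. dist (p (X m)) (p (X n)) < e" by (meson order_le_less_trans)
  qed
  then show ?thesis by (simp add: Cauchy_convergent_iff convergent_LIMSEQ_iff seq_norm_def)
qed

lemma seq_norm_const [simp]: "seq_norm p (\<lambda>_. x) = p x"
  unfolding seq_norm_def by (intro limI tendsto_const)

lemma seq_norm_eqI: "(\<lambda>n. p (X n)) \<longlonglongrightarrow> l \<Longrightarrow> seq_norm p X = l"
  unfolding seq_norm_def by (rule limI)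

lemma Cauchy_bounded:
  assumes X: "X \<in> cauchy_seqs p"
  obtains B where "\<And>n. p (X n) \<le> B" "0 < B"
proof -
  have "Bseq (\<lambda>n. p (X n))" using seq_norm_tendsto[OF X] by (intro convergent_imp_Bseq convergentI)
  then show ?thesis using that by (auto simp: Bseq_def abs_le_iff)
qed

lemma Cauchy_mult:
  assumes X: "X \<in> cauchy_seqs p" and Y: "Y \<in> cauchy_seqs p"
  shows "X * Y \<in> cauchy_seqs p"
  unfolding cauchy_seqs_iff
proof (intro allI impI)
  fix e :: real assume e: "0 < e"
  obtain A where A: "\<And>n. p (X n) \<le> A" "0 < A" using Cauchy_bounded[OF X] by metis
  obtain B where B: "\<And>n. p (Y n) \<le> B" "0 < B" using Cauchy_bounded[OF Y] by metis
  obtain M where M: "\<And>m n. m \<ge> M \<Longrightarrow> n \<ge> M \<Longrightarrow> p (X m - X n) < e / (2 * B)"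
    using X e B unfolding cauchy_seqs_iff by (metis divide_pos_pos mult_pos_pos zero_less_numeral)
  obtain N where N: "\<And>m n. m \<ge> N \<Longrightarrow> n \<ge> N \<Longrightarrow> p (Y m - Y n) < e / (2 * A)"
    using Y e A unfolding cauchy_seqs_iff by (metis divide_pos_pos mult_pos_pos zero_less_numeral)
  have "p ((X * Y) m - (X * Y) n) < e" if "m \<ge> max M N" "n \<ge> max M N" for m n
  proof -
    have "p ((X * Y) m - (X * Y) n) \<le> p (X m - X n) * p (Y m) + p (X n) * p (Y m - Y n)"
      using p.p_mult_diff[of "X m" "Y m" "X n" "Y n"] by simp
    also have "\<dots> \<le> p (X m - X n) * B + A * p (Y m - Y n)"
      using A B by (intro add_mono mult_mono) (auto intro: p.p_nonneg order_trans[OF p.p_nonneg])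
    also have "\<dots> < e / (2 * B) * B + A * (e / (2 * A))"
      using M[of m n] N[of m n] A(2) B(2) that
      by (intro add_strict_mono mult_strict_right_mono mult_strict_left_mono) auto
    also have "\<dots> = e" using A(2) B(2) by simp
    finally show ?thesis .
  qed
  then show "\<exists>N. \<forall>m\<ge>N. \<forall>n\<ge>N. p ((X * Y) m - (X * Y) n) < e" by blast
qed

lemma Cauchy_add:
  assumes X: "X \<in> cauchy_seqs p" and Y: "Y \<in> cauchy_seqs p"
  shows "X + Y \<in> cauchy_seqs p"
  unfolding cauchy_seqs_iff
proof (intro allI impI)
  fix e :: real assume "0 < e"
  then have e: "0 < e / 2" by simp
  obtain M where M: "\<And>m n. m \<ge> M \<Longrightarrow> n \<ge> M \<Longrightarrow> p (X m - X n) < e / 2"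
    using X e unfolding cauchy_seqs_iff by metis
  obtain N where N: "\<And>m n. m \<ge> N \<Longrightarrow> n \<ge> N \<Longrightarrow> p (Y m - Y n) < e / 2"
    using Y e unfolding cauchy_seqs_iff by metis
  have "p ((X + Y) m - (X + Y) n) < e" if "m \<ge> max M N" "n \<ge> max M N" for m n
  proof -
    have "p ((X + Y) m - (X + Y) n) \<le> p (X m - X n) + p (Y m - Y n)"
      using p.p_add[of "X m - X n" "Y m - Y n"] by (simp add: algebra_simps)
    then show ?thesis using M[of m n] N[of m n] that by simp
  qed
  then show "\<exists>N. \<forall>m\<ge>N. \<forall>n\<ge>N. p ((X + Y) m - (X + Y) n) < e" by blast
qed

lemma Cauchy_scal: "X \<in> cauchy_seqs p \<Longrightarrow> seq_scal c X \<in> cauchy_seqs p"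
  using Cauchy_mult[OF const_Cauchy, of X "Poly_Mapping.single 0 c"]
  by (simp add: free_scal_def seq_scal_def times_fun_def)

lemma Cauchy_star: "X \<in> cauchy_seqs p \<Longrightarrow> seq_star X \<in> cauchy_seqs p"
  by (simp add: cauchy_seqs_iff seq_star_def p.p_adj flip: free.adj_diff)

lemma cstar_seminormed_seqs:
  "cstar_seminormed seq_scal seq_star (cauchy_seqs p) (seq_norm p)"
proof
  show "1 \<in> cauchy_seqs p" using const_Cauchy[of 1] by (simp add: one_fun_def)
  show "0 \<le> seq_norm p X" if "X \<in> cauchy_seqs p" for X
    using seq_norm_tendsto[OF that] by (rule LIMSEQ_le_const) (simp add: p.p_nonneg)
  show "seq_norm p (X + Y) \<le> seq_norm p X + seq_norm p Y"
    if "X \<in> cauchy_seqs p" "Y \<in> cauchy_seqs p" for X Y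
    using seq_norm_tendsto[OF Cauchy_add[OF that]] tendsto_add[OF that[THEN seq_norm_tendsto]]
    by (rule LIMSEQ_le) (simp add: p.p_add)
  show "seq_norm p (X * Y) \<le> seq_norm p X * seq_norm p Y"
    if "X \<in> cauchy_seqs p" "Y \<in> cauchy_seqs p" for X Y
    using seq_norm_tendsto[OF Cauchy_mult[OF that]] tendsto_mult[OF that[THEN seq_norm_tendsto]]
    by (rule LIMSEQ_le) (simp add: p.p_mult)
  show "seq_norm p (seq_scal c X) = cmod c * seq_norm p X" if "X \<in> cauchy_seqs p" for c X
    using tendsto_mult_left[OF seq_norm_tendsto[OF that], of "cmod c"]
    by (intro seq_norm_eqI) (simp add: p.p_sm seq_scal_def)
  show "seq_norm p (seq_star X * X) = (seq_norm p X)\<^sup>2" if "X \<in> cauchy_seqs p" for X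
    using tendsto_power[OF seq_norm_tendsto[OF that], of 2]
    by (intro seq_norm_eqI) (simp add: p.p_cstar seq_star_def)
qed (fact Cauchy_add Cauchy_mult Cauchy_scal Cauchy_star)+

interpretation s: cstar_seminormed seq_scal seq_star "cauchy_seqs p" "seq_norm p"
  by (rule cstar_seminormed_seqs)

lemma const_dense:
  assumes X: "X \<in> cauchy_seqs p" and e: "0 < e"
  obtains N where "\<And>n. n \<ge> N \<Longrightarrow> seq_norm p (X - (\<lambda>_. X n)) \<le> e"
proof -
  obtain N where N: "\<And>m n. m \<ge> N \<Longrightarrow> n \<ge> N \<Longrightarrow> p (X m - X n) < e"
    using X e unfolding cauchy_seqs_iff by blast
  have "seq_norm p (X - (\<lambda>_. X n)) \<le> e" if "n \<ge> N" for n
    using seq_norm_tendsto[OF s.C_diff[OF X const_Cauchy]]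
    by (rule LIMSEQ_le_const2) (use N that in \<open>auto intro!: exI[of _ N] less_imp_le\<close>)
  then show ?thesis using that by blast
qed

text \<open>A limit is found on the diagonal, after replacing the \<open>k\<close>-th sequence by one of its terms
  that is within \<open>1 / (k + 1)\<close> of it.\<close>

lemma seqs_complete:
  assumes X: "\<And>k. X k \<in> cauchy_seqs p"
    and Cau: "\<And>e. 0 < e \<Longrightarrow> \<exists>N. \<forall>m\<ge>N. \<forall>n\<ge>N. seq_norm p (X m - X n) < e"
  shows "\<exists>Y\<in>cauchy_seqs p. (\<lambda>k. seq_norm p (X k - Y)) \<longlonglongrightarrow> 0"
proof -
  have "\<exists>y. seq_norm p (X k - (\<lambda>_. y)) \<le> 1 / Suc k" for k
    using const_dense[OF X, of "1 / Suc k" k] by (metis order_refl zero_less_divide_1_iff of_nat_0_less_iff zero_less_Suc)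
  then obtain Y where Y: "\<And>k. seq_norm p (X k - (\<lambda>_. Y k)) \<le> 1 / Suc k" by metis
  have inv: "(\<lambda>k. 1 / real (Suc k)) \<longlonglongrightarrow> 0" by (rule LIMSEQ_Suc[OF lim_1_over_n])
  have YC: "Y \<in> cauchy_seqs p" unfolding cauchy_seqs_iff
  proof (intro allI impI)
    fix e :: real assume "0 < e"
    then have e: "0 < e / 3" by simp
    obtain M where M: "\<And>k l. k \<ge> M \<Longrightarrow> l \<ge> M \<Longrightarrow> seq_norm p (X k - X l) < e / 3" using Cau[OF e] by blast
    obtain N where N: "\<And>k. k \<ge> N \<Longrightarrow> 1 / real (Suc k) < e / 3"
      using order_tendstoD(2)[OF inv e] unfolding eventually_sequentially by blast
    have "p (Y k - Y l) < e" if "k \<ge> max M N" "l \<ge> max M N" for k l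
    proof -
      have "seq_norm p ((\<lambda>_. Y k) - (\<lambda>_. Y l)) = p (Y k - Y l)"
        by (simp add: fun_diff_def)
      moreover have "seq_norm p ((\<lambda>_. Y k) - (\<lambda>_. Y l))
          \<le> seq_norm p ((\<lambda>_. Y k) - X k) + seq_norm p (X k - (\<lambda>_. Y l))"
        by (intro s.p_triangle const_Cauchy X)
      moreover have "seq_norm p (X k - (\<lambda>_. Y l)) \<le> seq_norm p (X k - X l) + seq_norm p (X l - (\<lambda>_. Y l))"
        by (intro s.p_triangle const_Cauchy X)
      moreover have "seq_norm p ((\<lambda>_. Y k) - X k) = seq_norm p (X k - (\<lambda>_. Y k))"
        by (intro s.p_commute const_Cauchy X)
      moreover have "seq_norm p (X k - X l) < e / 3" "1 / real (Suc k) < e / 3" "1 / real (Suc l) < e / 3"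
        using M N that by auto
      ultimately show ?thesis using Y[of k] Y[of l] by linarith
    qed
    then show "\<exists>N. \<forall>m\<ge>N. \<forall>n\<ge>N. p (Y m - Y n) < e" by blast
  qed
  have "(\<lambda>k. seq_norm p (X k - Y)) \<longlonglongrightarrow> 0"
  proof (rule LIMSEQ_I)
    fix e :: real assume "0 < e"
    then have e: "0 < e / 3" by simp
    obtain M where M: "\<And>k. k \<ge> M \<Longrightarrow> seq_norm p (Y - (\<lambda>_. Y k)) \<le> e / 3"
      using const_dense[OF YC e] by blast
    obtain N where N: "\<And>k. k \<ge> N \<Longrightarrow> 1 / real (Suc k) < e / 3"
      using order_tendstoD(2)[OF inv e] unfolding eventually_sequentially by blast
    have "norm (seq_norm p (X k - Y) - 0) < e" if "k \<ge> max M N" for k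
    proof -
      have "seq_norm p (X k - Y) \<le> seq_norm p (X k - (\<lambda>_. Y k)) + seq_norm p ((\<lambda>_. Y k) - Y)"
        by (intro s.p_triangle const_Cauchy X YC)
      moreover have "seq_norm p ((\<lambda>_. Y k) - Y) = seq_norm p (Y - (\<lambda>_. Y k))"
        by (intro s.p_commute const_Cauchy YC)
      moreover have "seq_norm p (Y - (\<lambda>_. Y k)) \<le> e / 3" "1 / real (Suc k) < e / 3"
        using M N that by auto
      moreover have "0 \<le> seq_norm p (X k - Y)" by (intro s.p_nonneg s.C_diff X YC)
      ultimately show ?thesis using Y[of k] unfolding real_norm_def by linarith
    qed
    then show "\<exists>no. \<forall>n\<ge>no. norm (seq_norm p (X n - Y) - 0) < e" by blast
  qed
  then show ?thesis using YC by blast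
qed

lemma null_sequences_iff: "X \<in> null_sequences p \<longleftrightarrow> X \<in> cauchy_seqs p \<and> seq_norm p X = 0"
proof
  assume X: "X \<in> null_sequences p"
  then have X0: "(\<lambda>n. p (X n)) \<longlonglongrightarrow> 0" by (simp add: null_sequences_def)
  have "X \<in> cauchy_seqs p" unfolding cauchy_seqs_iff
  proof (intro allI impI)
    fix e :: real assume "0 < e"
    then have e: "0 < e / 2" by simp
    obtain N where N: "\<And>n. n \<ge> N \<Longrightarrow> p (X n) < e / 2"
      using order_tendstoD(2)[OF X0 e] unfolding eventually_sequentially by blast
    have "p (X m - X n) < e" if "m \<ge> N" "n \<ge> N" for m n
    proof -
      have "p (X m) < e / 2" "p (X n) < e / 2" using N that by blast+
      then show ?thesis using p.p_diff[of "X m" "X n"] by simp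
    qed
    then show "\<exists>N. \<forall>m\<ge>N. \<forall>n\<ge>N. p (X m - X n) < e" by blast
  qed
  then show "X \<in> cauchy_seqs p \<and> seq_norm p X = 0" using seq_norm_eqI[OF X0] by simp
next
  assume "X \<in> cauchy_seqs p \<and> seq_norm p X = 0"
  then show "X \<in> null_sequences p" using seq_norm_tendsto[of X] by (simp add: null_sequences_def)
qed

end

section \<open>Homomorphisms and quotients of *-algebras with explicit carrier\<close>

locale star_ring = ring R for R :: "'c star_alg" (structure) +
  assumes scal_closed: "x \<in> carrier R \<Longrightarrow> scal R c x \<in> carrier R"
    and invol_closed: "x \<in> carrier R \<Longrightarrow> invol R x \<in> carrier R"
    and scal_add: "x \<in> carrier R \<Longrightarrow> y \<in> carrier R \<Longrightarrow>
          scal R c (x \<oplus> y) = scal R c x \<oplus> scal R c y"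
    and invol_add: "x \<in> carrier R \<Longrightarrow> y \<in> carrier R \<Longrightarrow>
          invol R (x \<oplus> y) = invol R x \<oplus> invol R y"
begin

lemma scal_zero: "scal R c \<zero> = \<zero>"
  using scal_add[of \<zero> \<zero> c] by (simp add: scal_closed)

lemma invol_zero: "invol R \<zero> = \<zero>"
  using invol_add[of \<zero> \<zero>] by (simp add: invol_closed)

lemma scal_minus: assumes x: "x \<in> carrier R" shows "scal R c (\<ominus> x) = \<ominus> scal R c x"
proof -
  have "scal R c (\<ominus> x) \<oplus> scal R c x = \<zero>"
    using scal_add[of "\<ominus> x" x c] x by (simp add: scal_zero l_neg)
  then show ?thesis using x by (simp add: minus_equality scal_closed)
qed

lemma invol_minus: assumes x: "x \<in> carrier R" shows "invol R (\<ominus> x) = \<ominus> invol R x"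
proof -
  have "invol R (\<ominus> x) \<oplus> invol R x = \<zero>"
    using invol_add[of "\<ominus> x" x] x by (simp add: invol_zero l_neg)
  then show ?thesis using x by (simp add: minus_equality invol_closed)
qed

lemma scal_diff: "x \<in> carrier R \<Longrightarrow> y \<in> carrier R \<Longrightarrow>
    scal R c (x \<ominus> y) = scal R c x \<ominus> scal R c y"
  by (simp add: a_minus_def scal_add scal_minus)

lemma invol_diff: "x \<in> carrier R \<Longrightarrow> y \<in> carrier R \<Longrightarrow>
    invol R (x \<ominus> y) = invol R x \<ominus> invol R y"
  by (simp add: a_minus_def invol_add invol_minus)

end

lemma star_homD:
  assumes "f \<in> star_hom R S"
  shows "x \<in> carrier R \<Longrightarrow> f x \<in> carrier S"
    and "x \<in> carrier R \<Longrightarrow> y \<in> carrier R \<Longrightarrow> f (x \<otimes>\<^bsub>R\<^esub> y) = f x \<otimes>\<^bsub>S\<^esub> f y"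
    and "x \<in> carrier R \<Longrightarrow> y \<in> carrier R \<Longrightarrow> f (x \<oplus>\<^bsub>R\<^esub> y) = f x \<oplus>\<^bsub>S\<^esub> f y"
    and "f \<one>\<^bsub>R\<^esub> = \<one>\<^bsub>S\<^esub>"
    and "x \<in> carrier R \<Longrightarrow> f (scal R c x) = scal S c (f x)"
    and "x \<in> carrier R \<Longrightarrow> f (invol R x) = invol S (f x)"
  using assms by (auto simp: star_hom_def ring_hom_def)

lemma star_homI:
  assumes "\<And>x. x \<in> carrier R \<Longrightarrow> f x \<in> carrier S"
    and "\<And>x y. x \<in> carrier R \<Longrightarrow> y \<in> carrier R \<Longrightarrow> f (x \<otimes>\<^bsub>R\<^esub> y) = f x \<otimes>\<^bsub>S\<^esub> f y"
    and "\<And>x y. x \<in> carrier R \<Longrightarrow> y \<in> carrier R \<Longrightarrow> f (x \<oplus>\<^bsub>R\<^esub> y) = f x \<oplus>\<^bsub>S\<^esub> f y"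
    and "f \<one>\<^bsub>R\<^esub> = \<one>\<^bsub>S\<^esub>"
    and "\<And>c x. x \<in> carrier R \<Longrightarrow> f (scal R c x) = scal S c (f x)"
    and "\<And>x. x \<in> carrier R \<Longrightarrow> f (invol R x) = invol S (f x)"
  shows "f \<in> star_hom R S"
  using assms by (auto simp: star_hom_def ring_hom_def)

lemma star_hom_ring: 
  assumes "f \<in> star_hom R S" "ring R" "ring S" shows "ring_hom_ring R S f"
  using assms by (intro ring_hom_ringI2) (auto simp: star_hom_def)

lemma star_hom_zero: 
  assumes "f \<in> star_hom R S" "ring R" "ring S" shows "f \<zero>\<^bsub>R\<^esub> = \<zero>\<^bsub>S\<^esub>"
proof -
  interpret ring_hom_ring R S f using assms by (rule star_hom_ring)
  show ?thesis by simp
qed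

lemma star_hom_diff:
  assumes "f \<in> star_hom R S" "ring R" "ring S" "x \<in> carrier R" "y \<in> carrier R"
  shows "f (x \<ominus>\<^bsub>R\<^esub> y) = f x \<ominus>\<^bsub>S\<^esub> f y"
proof -
  interpret ring_hom_ring R S f using assms by (intro star_hom_ring)
  show ?thesis using assms by (simp add: a_minus_def)
qed

lemma star_hom_comp:
  "f \<in> star_hom R S \<Longrightarrow> g \<in> star_hom S T \<Longrightarrow> g \<circ> f \<in> star_hom R T"
  by (intro star_homI) (auto simp: star_homD)

lemma inv_into_star_hom:
  assumes f: "f \<in> star_hom R S" and bij: "bij_betw f (carrier R) (carrier S)" and R: "star_ring R"
  shows "inv_into (carrier R) f \<in> star_hom S R"
proof -
  interpret star_ring R by fact
  let ?g = "inv_into (carrier R) f"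
  have g: "?g y \<in> carrier R" "f (?g y) = y" if "y \<in> carrier S" for y
    using bij that by (auto simp: bij_betw_def f_inv_into_f inv_into_into)
  have eqI: "?g y = x" if "x \<in> carrier R" "f x = y" for x y
    using bij that by (auto simp: bij_betw_def)
  show ?thesis
    by (intro star_homI eqI) (auto simp: g star_homD[OF f] scal_closed invol_closed)
qed

lemma absorbing_idealI:
  assumes "ring R" "I \<subseteq> carrier R" "\<zero>\<^bsub>R\<^esub> \<in> I"
    and add: "\<And>x y. x \<in> I \<Longrightarrow> y \<in> I \<Longrightarrow> x \<oplus>\<^bsub>R\<^esub> y \<in> I"
    and l: "\<And>a x. a \<in> I \<Longrightarrow> x \<in> carrier R \<Longrightarrow> x \<otimes>\<^bsub>R\<^esub> a \<in> I"
    and r: "\<And>a x. a \<in> I \<Longrightarrow> x \<in> carrier R \<Longrightarrow> a \<otimes>\<^bsub>R\<^esub> x \<in> I"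
  shows "ideal I R"
proof -
  interpret ring R by fact
  have "\<ominus>\<^bsub>R\<^esub> x \<in> I" if "x \<in> I" for x
  proof -
    have "\<ominus>\<^bsub>R\<^esub> x = (\<ominus>\<^bsub>R\<^esub> \<one>\<^bsub>R\<^esub>) \<otimes>\<^bsub>R\<^esub> x" using that assms(2) by (auto simp: l_minus)
    then show ?thesis using l[OF that] by simp
  qed
  then have "subgroup I (add_monoid R)"
    using assms by (intro add.subgroupI) (auto simp: a_inv_def)
  then show ?thesis using l r by (intro idealI ring_axioms)
qed

locale star_ideal = star_ring R + ideal I R for R :: "'c star_alg" (structure) and I +
  assumes scal_I: "x \<in> I \<Longrightarrow> scal R c x \<in> I" and invol_I: "x \<in> I \<Longrightarrow> invol R x \<in> I"
begin

lemma mem_coset: "x \<in> carrier R \<Longrightarrow> y \<in> I +> x \<longleftrightarrow> y \<in> carrier R \<and> y \<ominus> x \<in> I"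
  using a_rcos_module_minus[OF ring_axioms, of x y] a_r_coset_subset_G[OF a_subset, of x] by blast

lemma coset_eq:
  assumes "x \<in> carrier R" "y \<in> carrier R"
  shows "I +> x = I +> y \<longleftrightarrow> x \<ominus> y \<in> I"
proof
  assume "I +> x = I +> y"
  then have "x \<in> I +> y" using a_rcos_self[OF assms(1)] by simp
  then show "x \<ominus> y \<in> I" using assms by (simp add: mem_coset)
next
  assume "x \<ominus> y \<in> I"
  then have "x \<in> I +> y" using assms by (simp add: mem_coset)
  then show "I +> x = I +> y" using a_repr_independence[OF _ assms(2) a_subgroup] by simp
qed

lemma quotient_carrier: "carrier (star_quotient R I) = (\<lambda>x. I +> x) ` carrier R"
  by (auto simp: star_quotient_def FactRing_simps)

lemma quotient_mult: "x \<in> carrier R \<Longrightarrow> y \<in> carrier R \<Longrightarrow>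
    (I +> x) \<otimes>\<^bsub>star_quotient R I\<^esub> (I +> y) = I +> x \<otimes> y"
  by (simp add: star_quotient_def FactRing_def rcoset_mult_add)

lemma quotient_add: "x \<in> carrier R \<Longrightarrow> y \<in> carrier R \<Longrightarrow>
    (I +> x) \<oplus>\<^bsub>star_quotient R I\<^esub> (I +> y) = I +> x \<oplus> y"
  by (simp add: star_quotient_def FactRing_def a_rcos_sum)

lemma quotient_one: "\<one>\<^bsub>star_quotient R I\<^esub> = I +> \<one>"
  by (simp add: star_quotient_def FactRing_def)

lemma quotient_scal:
  assumes x: "x \<in> carrier R"
  shows "scal (star_quotient R I) c (I +> x) = I +> scal R c x"
proof -
  have "I +> scal R c y = I +> scal R c x" if "y \<in> I +> x" for y
    using that x by (auto simp: mem_coset coset_eq scal_closed scal_I simp flip: scal_diff)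
  then have "(\<Union>y\<in>I +> x. I +> scal R c y) = (\<Union>y\<in>I +> x. I +> scal R c x)" by (intro SUP_cong refl)
  then show ?thesis using a_rcos_self[OF x] by (auto simp: star_quotient_def)
qed

lemma quotient_invol:
  assumes x: "x \<in> carrier R"
  shows "invol (star_quotient R I) (I +> x) = I +> invol R x"
proof -
  have "I +> invol R y = I +> invol R x" if "y \<in> I +> x" for y
    using that x by (auto simp: mem_coset coset_eq invol_closed invol_I simp flip: invol_diff)
  then have "(\<Union>y\<in>I +> x. I +> invol R y) = (\<Union>y\<in>I +> x. I +> invol R x)" by (intro SUP_cong refl)
  then show ?thesis using a_rcos_self[OF x] by (auto simp: star_quotient_def)
qed

lemma quotient_ring: "ring (star_quotient R I)"
proof -
  interpret Q: ring "R Quot I" by (rule quotient_is_ring)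
  have [simp]: "carrier (star_quotient R I) = carrier (R Quot I)"
    "mult (star_quotient R I) = mult (R Quot I)" "one (star_quotient R I) = one (R Quot I)"
    "zero (star_quotient R I) = zero (R Quot I)" "add (star_quotient R I) = add (R Quot I)"
    by (simp_all add: star_quotient_def)
  show ?thesis
  proof (rule ringI)
    show "abelian_group (star_quotient R I)"
    proof (rule abelian_groupI)
      fix x y z assume xyz: "x \<in> carrier (star_quotient R I)" "y \<in> carrier (star_quotient R I)"
        "z \<in> carrier (star_quotient R I)"
      then show "x \<oplus>\<^bsub>star_quotient R I\<^esub> y \<oplus>\<^bsub>star_quotient R I\<^esub> z =
          x \<oplus>\<^bsub>star_quotient R I\<^esub> (y \<oplus>\<^bsub>star_quotient R I\<^esub> z)" by (simp add: Q.a_assoc)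
      show "x \<oplus>\<^bsub>star_quotient R I\<^esub> y = y \<oplus>\<^bsub>star_quotient R I\<^esub> x"
        using xyz by (simp add: Q.a_comm)
      show "\<exists>y\<in>carrier (star_quotient R I). y \<oplus>\<^bsub>star_quotient R I\<^esub> x = \<zero>\<^bsub>star_quotient R I\<^esub>"
        using xyz by (intro bexI[of _ "\<ominus>\<^bsub>R Quot I\<^esub> x"]) (simp_all add: Q.l_neg)
    qed simp_all
    show "Group.monoid (star_quotient R I)" by (rule monoidI) (auto simp: Q.m_assoc)
  qed (auto simp: Q.l_distr Q.r_distr)
qed

lemma quotient_star_ring: "star_ring (star_quotient R I)"
proof -
  interpret Q: ring "star_quotient R I" by (rule quotient_ring)
  show ?thesis
    by standard
      (auto simp: quotient_carrier quotient_scal quotient_invol quotient_add scal_closed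
        invol_closed scal_add invol_add)
qed

lemma coset_hom: "(\<lambda>x. I +> x) \<in> star_hom R (star_quotient R I)"
  by (intro star_homI)
    (auto simp: quotient_carrier quotient_mult quotient_add quotient_one quotient_scal quotient_invol)

lemma factor_star_hom:
  assumes f: "f \<in> star_hom R S" and S: "ring S" and f0: "\<And>x. x \<in> I \<Longrightarrow> f x = \<zero>\<^bsub>S\<^esub>"
  obtains g where "g \<in> star_hom (star_quotient R I) S" "\<And>x. x \<in> carrier R \<Longrightarrow> g (I +> x) = f x"
proof -
  interpret S: ring S by fact
  define g where "g Q = f (SOME x. x \<in> carrier R \<and> Q = I +> x)" for Q
  have g: "g (I +> x) = f x" if x: "x \<in> carrier R" for x
  proof -
    define y where "y = (SOME y. y \<in> carrier R \<and> I +> x = I +> y)"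
    have y: "y \<in> carrier R" "I +> x = I +> y"
      using someI[of "\<lambda>y. y \<in> carrier R \<and> I +> x = I +> y" x] x by (auto simp: y_def)
    then have "f (x \<ominus> y) = \<zero>\<^bsub>S\<^esub>" using x by (intro f0) (simp add: coset_eq)
    then have "f x \<ominus>\<^bsub>S\<^esub> f y = \<zero>\<^bsub>S\<^esub>" using star_hom_diff[OF f ring_axioms S x y(1)] by simp
    then have "f x = f y"
      using star_homD(1)[OF f x] star_homD(1)[OF f y(1)]
      by (metis S.add.inv_closed S.add.inv_solve_right' S.l_zero S.zero_closed a_minus_def)
    then show ?thesis by (simp add: g_def y_def)
  qed
  have "g \<in> star_hom (star_quotient R I) S"
    by (intro star_homI)
      (auto simp: quotient_carrier quotient_mult quotient_add quotient_one quotient_scal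
        quotient_invol g star_homD[OF f] scal_closed invol_closed)
  then show ?thesis using g that by blast
qed

end

lemma star_hom_kernel:
  assumes f: "f \<in> star_hom R S" and R: "star_ring R" and S: "star_ring S"
  shows "star_ideal R {x \<in> carrier R. f x = \<zero>\<^bsub>S\<^esub>}"
proof -
  interpret R: star_ring R by fact
  interpret S: star_ring S by fact
  interpret f: ring_hom_ring R S f using f R.ring_axioms S.ring_axioms by (rule star_hom_ring)
  have "ideal {x \<in> carrier R. f x = \<zero>\<^bsub>S\<^esub>} R"
    using f.kernel_is_ideal unfolding a_kernel_def' .
  then show ?thesis
    by (intro star_ideal.intro R star_ideal_axioms.intro)
      (auto simp: R.scal_closed R.invol_closed star_homD(5,6)[OF f] S.scal_zero S.invol_zero)
qed

section \<open>Completions as *-algebras\<close>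

definition seq_class ::
    "('g free_star_alg \<Rightarrow> real) \<Rightarrow> (nat \<Rightarrow> 'g free_star_alg) \<Rightarrow> (nat \<Rightarrow> 'g free_star_alg) set" where
  "seq_class p X = null_sequences p +>\<^bsub>cauchy_alg p\<^esub> X"

context
  fixes p :: "'g free_star_alg \<Rightarrow> real"
  assumes p: "cstar_seminorm p"
begin

interpretation s: cstar_seminormed seq_scal seq_star "cauchy_seqs p" "seq_norm p"
  using p by (rule cstar_seminormed_seqs)

lemma cauchy_alg_ring: "ring (cauchy_alg p)"
proof (rule ringI)
  show "abelian_group (cauchy_alg p)"
  proof (rule abelian_groupI)
    show "\<exists>y\<in>cauchy_seqs p. y \<oplus>\<^bsub>cauchy_alg p\<^esub> x = \<zero>\<^bsub>cauchy_alg p\<^esub>" if "x \<in> cauchy_seqs p" for x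
      using that by (intro bexI[of _ "- x"]) (auto simp: s.C_closed)
  qed (auto simp: s.C_closed algebra_simps)
  show "Group.monoid (cauchy_alg p)" by (rule monoidI) (auto simp: s.C_closed algebra_simps)
qed (auto simp: algebra_simps)

lemma cauchy_alg_minus:
  assumes "X \<in> cauchy_seqs p" "Y \<in> cauchy_seqs p"
  shows "X \<ominus>\<^bsub>cauchy_alg p\<^esub> Y = X - Y"
proof -
  interpret ring "cauchy_alg p" by (rule cauchy_alg_ring)
  have "\<ominus>\<^bsub>cauchy_alg p\<^esub> Y = - Y"
    using assms by (intro minus_equality) (auto simp: s.C_closed)
  then show ?thesis by (simp add: a_minus_def)
qed

lemma cauchy_alg_star_ring: "star_ring (cauchy_alg p)"
proof -
  interpret ring "cauchy_alg p" by (rule cauchy_alg_ring)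
  show ?thesis by standard (auto simp: s.C_closed seqs.sm_add_right seqs.adj_add)
qed

lemma null_star_ideal: "star_ideal (cauchy_alg p) (null_sequences p)"
proof -
  interpret star_ring "cauchy_alg p" by (rule cauchy_alg_star_ring)
  have "ideal (null_sequences p) (cauchy_alg p)"
    by (rule absorbing_idealI)
      (auto simp: ring_axioms null_sequences_iff[OF p] s.C_closed s.p_zero s.p_add_zero
        s.p_mult_zero_left s.p_mult_zero_right)
  then show ?thesis
    by (intro star_ideal.intro star_ring_axioms star_ideal_axioms.intro)
      (auto simp: null_sequences_iff[OF p] s.C_closed s.p_sm s.p_adj)
qed

interpretation N: star_ideal "cauchy_alg p" "null_sequences p" by (rule null_star_ideal)

lemma seq_class_eq:
  "X \<in> cauchy_seqs p \<Longrightarrow> Y \<in> cauchy_seqs p \<Longrightarrow> seq_class p X = seq_class p Y \<longleftrightarrow> seq_norm p (X - Y) = 0"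
  by (simp add: seq_class_def N.coset_eq cauchy_alg_minus null_sequences_iff[OF p] s.C_closed)

lemma completion_carrier: "carrier (hausdorff_completion p) = seq_class p ` cauchy_seqs p"
  by (simp add: hausdorff_completion_def N.quotient_carrier seq_class_def[abs_def])

lemma completion_star_ring: "star_ring (hausdorff_completion p)"
  unfolding hausdorff_completion_def by (rule N.quotient_star_ring)

lemma seq_class_hom: "seq_class p \<in> star_hom (cauchy_alg p) (hausdorff_completion p)"
  unfolding hausdorff_completion_def seq_class_def[abs_def] by (rule N.coset_hom)

lemma completion_ops:
  "X \<in> cauchy_seqs p \<Longrightarrow> Y \<in> cauchy_seqs p \<Longrightarrow>
    seq_class p X \<otimes>\<^bsub>hausdorff_completion p\<^esub> seq_class p Y = seq_class p (X * Y)"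
  "X \<in> cauchy_seqs p \<Longrightarrow> Y \<in> cauchy_seqs p \<Longrightarrow>
    seq_class p X \<oplus>\<^bsub>hausdorff_completion p\<^esub> seq_class p Y = seq_class p (X + Y)"
  "X \<in> cauchy_seqs p \<Longrightarrow> Y \<in> cauchy_seqs p \<Longrightarrow>
    seq_class p X \<ominus>\<^bsub>hausdorff_completion p\<^esub> seq_class p Y = seq_class p (X - Y)"
  "X \<in> cauchy_seqs p \<Longrightarrow> scal (hausdorff_completion p) c (seq_class p X) = seq_class p (seq_scal c X)"
  "X \<in> cauchy_seqs p \<Longrightarrow> invol (hausdorff_completion p) (seq_class p X) = seq_class p (seq_star X)"
  "\<one>\<^bsub>hausdorff_completion p\<^esub> = seq_class p 1"
  "\<zero>\<^bsub>hausdorff_completion p\<^esub> = seq_class p 0"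
proof -
  interpret H: star_ring "hausdorff_completion p" by (rule completion_star_ring)
  note hom = star_homD[OF seq_class_hom, simplified]
  show "seq_class p X \<ominus>\<^bsub>hausdorff_completion p\<^esub> seq_class p Y = seq_class p (X - Y)"
    if "X \<in> cauchy_seqs p" "Y \<in> cauchy_seqs p"
    using star_hom_diff[OF seq_class_hom N.ring_axioms H.ring_axioms that] 
    by (simp add: cauchy_alg_minus that)
  show "\<zero>\<^bsub>hausdorff_completion p\<^esub> = seq_class p 0"
    using star_hom_zero[OF seq_class_hom N.ring_axioms H.ring_axioms] by simp
qed (simp_all add: star_homD[OF seq_class_hom, simplified])

lemma completion_nrm:
  assumes X: "X \<in> cauchy_seqs p"
  shows "nrm (hausdorff_completion p) (seq_class p X) = seq_norm p X"
proof -
  have "seq_norm p Y = seq_norm p X" if "Y \<in> seq_class p X" for Y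
  proof (rule s.p_diff_zero_eq)
    have "Y \<in> cauchy_seqs p \<and> Y \<ominus>\<^bsub>cauchy_alg p\<^esub> X \<in> null_sequences p"
      using that unfolding seq_class_def N.mem_coset[OF X] .
    then show "Y \<in> cauchy_seqs p" "seq_norm p (Y - X) = 0"
      by (auto simp: cauchy_alg_minus X null_sequences_iff[OF p])
  qed (rule X)
  moreover have "X \<in> seq_class p X" using N.a_rcos_self[OF X] by (simp add: seq_class_def)
  ultimately have "seq_norm p ` seq_class p X = {seq_norm p X}"
    using image_cong[OF refl, of "seq_class p X" "seq_norm p" "\<lambda>_. seq_norm p X"] image_constant by metis
  then show ?thesis
    by (simp add: hausdorff_completion_def star_quotient_def seq_class_def[symmetric])
qed

end

section \<open>Consequences of the defining relations\<close>

interpretation cstar: involutive_algebra scaleC "cstar :: 'a::unital_cstar_algebra \<Rightarrow> 'a"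
proof
  show "1 *\<^sub>C x = x" for x :: 'a using scaleR_scaleC[of 1 x] by simp
qed (simp_all add: scaleC_add_right scaleC_add_left scaleC_scaleC mult_scaleC_left mult_scaleC_right
    cstar_add cstar_scaleC cstar_mult cstar_cstar)

interpretation cstar: cstar_seminormed scaleC "cstar :: 'a::unital_cstar_algebra \<Rightarrow> 'a" UNIV norm
  by standard (simp_all add: norm_triangle_ineq norm_scaleC norm_mult_ineq cstar_identity)

locale algebra_seminorm = cstar_seminormed free_scal free_star UNIV p
  for p :: "'a::unital_cstar_algebra generator free_star_alg \<Rightarrow> real" +
  assumes algebra: "r \<in> algebra_relations \<Longrightarrow> p r = 0"
begin

definition eqv (infix "\<doteq>" 50) where "x \<doteq> y \<longleftrightarrow> p (x - y) = 0"

lemma eqv_refl: "x \<doteq> x" by (simp add: eqv_def p_zero)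

lemma eqv_sym: "x \<doteq> y \<Longrightarrow> y \<doteq> x" using p_commute[of x y] by (simp add: eqv_def)

lemma eqv_p: "x \<doteq> y \<Longrightarrow> p x = p y" unfolding eqv_def by (rule p_diff_zero_eq) simp_all

lemma eqv_trans [trans]: "x \<doteq> y \<Longrightarrow> y \<doteq> z \<Longrightarrow> x \<doteq> z"
  unfolding eqv_def by (rule p_diff_zero_trans) simp_all

lemma eqv_mult: "x \<doteq> x' \<Longrightarrow> y \<doteq> y' \<Longrightarrow> x * y \<doteq> x' * y'"
  unfolding eqv_def by (rule p_mult_diff_zero) simp_all

lemma eqv_left: "y \<doteq> y' \<Longrightarrow> x * y \<doteq> x * y'"
  by (intro eqv_mult eqv_refl)

lemma eqv_right: "x \<doteq> x' \<Longrightarrow> x * y \<doteq> x' * y"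
  by (intro eqv_mult eqv_refl)

lemma eqv_star: "x \<doteq> y \<Longrightarrow> free_star x \<doteq> free_star y"
  unfolding eqv_def by (rule p_adj_diff_zero) simp_all

lemma el_add: "el (a + b) \<doteq> el a + el b"
  and el_scal: "el (c *\<^sub>C a) \<doteq> free_scal c (el a)"
  and el_mult: "el (a * b) \<doteq> el a * el b"
  and el_star: "el (a\<^sup>\<star>) \<doteq> free_star (el a)"
  and el_one: "el 1 \<doteq> 1"
  unfolding eqv_def by (rule algebra; auto simp: algebra_relations_def)+

lemma el_diff: "el (a - b) \<doteq> el a - el b"
proof -
  have "el (a - b + b) \<doteq> el (a - b) + el b" by (rule el_add)
  then have "el a - el b \<doteq> el (a - b)" by (simp add: eqv_def algebra_simps)
  then show ?thesis by (rule eqv_sym)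
qed

text \<open>The pullback of \<open>p\<close> along \<open>a \<mapsto> el a\<close> is a C*-seminorm on a complete
  C*-algebra; this bounds it uniformly in \<open>p\<close>.\<close>

lemma el_norm: "p (el a) \<le> norm a"
proof (rule cstar.complete_contractive)
  show "cstar_seminormed scaleC cstar UNIV (\<lambda>a. p (el a))"
  proof
    fix x y :: 'a and c
    show "p (el (x + y)) \<le> p (el x) + p (el y)"
      using eqv_p[OF el_add] p_add[of "el x" "el y"] by simp
    show "p (el (c *\<^sub>C x)) = cmod c * p (el x)"
      using eqv_p[OF el_scal] by (simp add: p_sm)
    show "p (el (x * y)) \<le> p (el x) * p (el y)"
      using eqv_p[OF el_mult] p_mult[of "el x" "el y"] by simp
    have "el (x\<^sup>\<star> * x) \<doteq> free_star (el x) * el x"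
      by (rule eqv_trans[OF el_mult eqv_right[OF el_star]])
    then show "p (el (x\<^sup>\<star> * x)) = (p (el x))\<^sup>2"
      using eqv_p[of "el (x\<^sup>\<star> * x)" "free_star (el x) * el x"] by (simp add: p_cstar)
  qed (simp_all add: p_nonneg)
  show "p (el x) = 0" if "norm x = 0" for x
    using that eqv_p[OF el_scal, of 0 0] by (simp add: p_sm cstar.sm_zero_left)
  show "\<exists>x\<in>UNIV. (\<lambda>n. norm (X n - x)) \<longlonglongrightarrow> 0"
    if "\<And>e. 0 < e \<Longrightarrow> \<exists>N. \<forall>m\<ge>N. \<forall>n\<ge>N. norm (X m - X n) < e" for X :: "nat \<Rightarrow> 'a"
  proof -
    have "Cauchy X" using that by (intro CauchyI) auto
    then obtain x where "X \<longlonglongrightarrow> x" by (auto simp: Cauchy_convergent_iff convergent_def)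
    then show ?thesis by (auto simp: tendsto_norm_zero_iff LIM_zero_iff)
  qed
qed simp

lemma el_lipschitz: "p (el a - el b) \<le> norm (a - b)"
  using el_norm[of "a - b"] eqv_p[OF el_diff, of a b] by simp

end

locale transfer_pair =
  fixes \<delta> L :: "'a::unital_cstar_algebra \<Rightarrow> 'a"
  assumes endo: "star_endomorphism \<delta>" and complete_transfer: "complete_transfer_operator \<delta> L"
begin

lemma \<delta>_mult: "\<delta> (a * b) = \<delta> a * \<delta> b" and \<delta>_star: "\<delta> (a\<^sup>\<star>) = (\<delta> a)\<^sup>\<star>"
  using endo by (auto simp: star_endomorphism_def)

lemma L_transfer: "L (\<delta> a * b) = a * L b" and \<delta>_L: "\<delta> (L a) = \<delta> 1 * a * \<delta> 1"
  using complete_transfer by (auto simp: complete_transfer_operator_def transfer_operator_def)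

lemma \<delta>_one_left: "\<delta> 1 * \<delta> a = \<delta> a" and \<delta>_one_right: "\<delta> a * \<delta> 1 = \<delta> a"
  by (simp_all flip: \<delta>_mult)

end

locale crossed_seminorm = algebra_seminorm p + transfer_pair \<delta> L
  for p :: "'a::unital_cstar_algebra generator free_star_alg \<Rightarrow> real" and \<delta> L :: "'a \<Rightarrow> 'a" +
  assumes crossed: "r \<in> crossed_relations \<delta> L \<Longrightarrow> p r = 0"
begin

abbreviation U where "U \<equiv> (ext :: 'a generator free_star_alg)"
abbreviation V where "V \<equiv> free_star U"

lemma partial_isometry: "U * V * U \<doteq> U"
  and el_\<delta>: "el (\<delta> a) \<doteq> U * el a * V"
  and el_L: "el (L a) \<doteq> V * el a * U"
  unfolding eqv_def by (rule crossed; auto simp: crossed_relations_def)+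

lemma el_L_one: "el (L 1) \<doteq> V * U"
proof -
  have "V * el 1 * U \<doteq> V * 1 * U" by (intro eqv_left eqv_right el_one)
  then show ?thesis using eqv_trans[OF el_L] by simp
qed

text \<open>\<open>U\<^sup>* U\<close> commutes with the algebra, since \<open>a \<delta>\<^sub>*(1) = \<delta>\<^sub>*(\<delta>(a)) = U\<^sup>* U a U\<^sup>* U\<close>.\<close>

lemma initial_projection_right: "el a * (V * U) \<doteq> V * U * el a * (V * U)"
proof -
  have "el a * (V * U) \<doteq> el a * el (L 1)" by (intro eqv_left eqv_sym[OF el_L_one])
  also have "\<dots> \<doteq> el (a * L 1)" by (rule eqv_sym[OF el_mult])
  also have "a * L 1 = L (\<delta> a)" using L_transfer[of a 1] by simp
  also have "el (L (\<delta> a)) \<doteq> V * el (\<delta> a) * U" by (rule el_L)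
  also have "V * el (\<delta> a) * U \<doteq> V * (U * el a * V) * U" by (intro eqv_left eqv_right el_\<delta>)
  also have "V * (U * el a * V) * U = V * U * el a * (V * U)" by (simp add: mult.assoc)
  finally show ?thesis .
qed

lemma initial_projection_central: "V * U * el a \<doteq> el a * (V * U)"
proof -
  have s: "free_star (el (a\<^sup>\<star>)) \<doteq> el a"
    using eqv_star[OF el_star, of a] by (simp add: free.adj_adj)
  have "V * U * el a \<doteq> V * U * free_star (el (a\<^sup>\<star>))" by (intro eqv_left eqv_sym[OF s])
  also have "\<dots> = free_star (el (a\<^sup>\<star>) * (V * U))" by (simp add: free.adj_mult free.adj_adj)
  also have "\<dots> \<doteq> free_star (V * U * el (a\<^sup>\<star>) * (V * U))"
    by (intro eqv_star initial_projection_right)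
  also have "\<dots> = V * U * free_star (el (a\<^sup>\<star>)) * (V * U)"
    by (simp add: free.adj_simps mult.assoc)
  also have "\<dots> \<doteq> V * U * el a * (V * U)" by (intro eqv_left eqv_right s)
  also have "\<dots> \<doteq> el a * (V * U)" by (rule eqv_sym[OF initial_projection_right])
  finally show ?thesis .
qed

lemma covariance: "U * el a \<doteq> el (\<delta> a) * U"
proof -
  have "U * el a \<doteq> U * V * U * el a" by (intro eqv_right eqv_sym[OF partial_isometry])
  also have "\<dots> = U * (V * U * el a)" by (simp add: mult.assoc)
  also have "\<dots> \<doteq> U * (el a * (V * U))" by (intro eqv_left initial_projection_central)
  also have "\<dots> = U * el a * V * U" by (simp add: mult.assoc)
  also have "\<dots> \<doteq> el (\<delta> a) * U" by (intro eqv_right eqv_sym[OF el_\<delta>])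
  finally show ?thesis .
qed

lemma toeplitz_vanishes: "r \<in> toeplitz_relations \<delta> L \<Longrightarrow> p r = 0"
  unfolding toeplitz_relations_def using algebra covariance eqv_sym[OF el_L] by (auto simp: eqv_def)

text \<open>Since \<open>\<delta>(1) = U U\<^sup>*\<close>, the ideal generated by \<open>\<delta>(A)\<close> lies in
  the span of \<open>A U U\<^sup>* A\<close>.\<close>

lemma el_\<delta>_factor: "el (x * \<delta> y * z) \<doteq> el x * U * (V * el (\<delta> y * z))"
proof -
  have "el (\<delta> y * z) = el (\<delta> 1 * (\<delta> y * z))" by (simp add: \<delta>_one_left flip: mult.assoc)
  also have "\<dots> \<doteq> el (\<delta> 1) * el (\<delta> y * z)" by (rule el_mult)
  also have "\<dots> \<doteq> U * el 1 * V * el (\<delta> y * z)" by (intro eqv_right el_\<delta>)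
  also have "\<dots> \<doteq> U * 1 * V * el (\<delta> y * z)" by (intro eqv_right eqv_left el_one)
  finally have *: "el (\<delta> y * z) \<doteq> U * V * el (\<delta> y * z)" by simp
  have "el (x * \<delta> y * z) \<doteq> el x * el (\<delta> y * z)" using el_mult[of x "\<delta> y * z"] by (simp add: mult.assoc)
  also have "\<dots> \<doteq> el x * (U * V * el (\<delta> y * z))" by (intro eqv_left *)
  finally show ?thesis by (simp add: mult.assoc)
qed

end

locale toeplitz_seminorm = algebra_seminorm p + transfer_pair \<delta> L
  for p :: "'a::unital_cstar_algebra generator free_star_alg \<Rightarrow> real" and \<delta> L :: "'a \<Rightarrow> 'a" +
  assumes toeplitz: "r \<in> toeplitz_relations \<delta> L \<Longrightarrow> p r = 0"
begin

abbreviation S where "S \<equiv> (ext :: 'a generator free_star_alg)"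
abbreviation S' where "S' \<equiv> free_star S"

lemma covariance: "S * el a \<doteq> el (\<delta> a) * S"
  and compression: "S' * el a * S \<doteq> el (L a)"
  unfolding eqv_def by (rule toeplitz; auto simp: toeplitz_relations_def)+

lemma el_one_left: "el 1 * x \<doteq> x" and el_one_right: "x * el 1 \<doteq> x"
  using eqv_right[OF el_one, of x] eqv_left[OF el_one, of x] by simp_all

lemma initial_projection: "S' * S \<doteq> el (L 1)"
  using eqv_trans[OF eqv_sym[OF eqv_left[OF el_one_left[of S], of S']] ] compression[of 1]
  by (simp add: mult.assoc)

lemma el_\<delta>_one_left: "el (\<delta> 1) * S \<doteq> S"
  by (rule eqv_trans[OF eqv_sym[OF covariance] el_one_right])

lemma S_el_L: "S * el (L b) \<doteq> el (\<delta> 1) * (el b * S)"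
proof -
  have "S * el (L b) \<doteq> el (\<delta> (L b)) * S" by (rule covariance)
  also have "\<dots> = el (\<delta> 1 * (b * \<delta> 1)) * S" by (simp add: \<delta>_L mult.assoc)
  also have "\<dots> \<doteq> el (\<delta> 1) * el (b * \<delta> 1) * S" by (intro eqv_right el_mult)
  also have "\<dots> \<doteq> el (\<delta> 1) * (el b * el (\<delta> 1)) * S" by (intro eqv_right eqv_left el_mult)
  also have "\<dots> = el (\<delta> 1) * (el b * (el (\<delta> 1) * S))" by (simp add: mult.assoc)
  also have "\<dots> \<doteq> el (\<delta> 1) * (el b * S)" by (intro eqv_left el_\<delta>_one_left)
  finally show ?thesis .
qed

lemma partial_isometry: "S * S' * S \<doteq> S"
proof -
  have "S * S' * S = S * (S' * S)" by (simp add: mult.assoc)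
  also have "\<dots> \<doteq> S * el (L 1)" by (intro eqv_left initial_projection)
  also have "\<dots> \<doteq> el (\<delta> 1) * (el 1 * S)" by (rule S_el_L)
  also have "\<dots> \<doteq> el (\<delta> 1) * S" by (intro eqv_left el_one_left)
  also have "\<dots> \<doteq> S" by (rule el_\<delta>_one_left)
  finally show ?thesis .
qed

text \<open>The pair \<open>(\<delta>(a), S a S\<^sup>*)\<close> is a redundancy: completeness of the transfer operator turns
  \<open>S a S\<^sup>* b S = S a \<delta>\<^sub>*(b)\<close> into \<open>\<delta>(a) b S\<close>.\<close>

lemma redundancy_equation: "el (\<delta> a) * (el b * S) \<doteq> S * el a * S' * (el b * S)"
proof -
  have "S * el a * S' * (el b * S) = S * el a * (S' * el b * S)" by (simp add: mult.assoc)
  also have "\<dots> \<doteq> S * el a * el (L b)" by (intro eqv_left compression)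
  also have "\<dots> \<doteq> el (\<delta> a) * S * el (L b)" by (intro eqv_right covariance)
  also have "\<dots> = el (\<delta> a) * (S * el (L b))" by (simp add: mult.assoc)
  also have "\<dots> \<doteq> el (\<delta> a) * (el (\<delta> 1) * (el b * S))" by (intro eqv_left S_el_L)
  also have "\<dots> = el (\<delta> a) * el (\<delta> 1) * (el b * S)" by (simp add: mult.assoc)
  also have "\<dots> \<doteq> el (\<delta> a * \<delta> 1) * (el b * S)" by (intro eqv_right eqv_sym[OF el_mult])
  finally show ?thesis by (simp add: \<delta>_one_right eqv_sym)
qed

end

context transfer_pair
begin

lemma algebra_subset_crossed: "algebra_relations \<subseteq> crossed_relations \<delta> L"
  and algebra_subset_toeplitz: "algebra_relations \<subseteq> toeplitz_relations \<delta> L"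
  by (auto simp: crossed_relations_def toeplitz_relations_def)

lemma crossed_seminormI:
  "cstar_seminorm p \<Longrightarrow> (\<And>r. r \<in> crossed_relations \<delta> L \<Longrightarrow> p r = 0) \<Longrightarrow> crossed_seminorm p \<delta> L"
  using algebra_subset_crossed transfer_pair_axioms
  by (auto simp: cstar_seminormed_free crossed_seminorm_def algebra_seminorm_def
      algebra_seminorm_axioms_def crossed_seminorm_axioms_def)

lemma toeplitz_seminormI:
  "cstar_seminorm p \<Longrightarrow> (\<And>r. r \<in> toeplitz_relations \<delta> L \<Longrightarrow> p r = 0) \<Longrightarrow> toeplitz_seminorm p \<delta> L"
  using algebra_subset_toeplitz transfer_pair_axioms
  by (auto simp: cstar_seminormed_free toeplitz_seminorm_def algebra_seminorm_def
      algebra_seminorm_axioms_def toeplitz_seminorm_axioms_def)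

lemma bounded_toeplitz: "bounded_relations (toeplitz_relations \<delta> L)"
  unfolding bounded_relations_def
proof
  fix g :: "'a generator"
  show "\<exists>B. \<forall>p. cstar_seminorm p \<and> (\<forall>r\<in>toeplitz_relations \<delta> L. p r = 0) \<longrightarrow> p (free_gen g) \<le> B"
  proof (cases g)
    case (Elem a)
    have "p (el a) \<le> norm a" if "cstar_seminorm p \<and> (\<forall>r\<in>toeplitz_relations \<delta> L. p r = 0)" for p
    proof -
      interpret toeplitz_seminorm p \<delta> L using that by (intro toeplitz_seminormI) auto
      show ?thesis by (rule el_norm)
    qed
    then show ?thesis using Elem by blast
  next
    case Extra
    have "p ext \<le> sqrt (norm (L 1))" if "cstar_seminorm p \<and> (\<forall>r\<in>toeplitz_relations \<delta> L. p r = 0)" for p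
    proof -
      interpret toeplitz_seminorm p \<delta> L using that by (intro toeplitz_seminormI) auto
      have "(p S)\<^sup>2 = p (el (L 1))"
        using eqv_p[OF initial_projection] p_cstar[of S] by simp
      then have "(p S)\<^sup>2 \<le> norm (L 1)" using el_norm[of "L 1"] by simp
      then show ?thesis by (rule real_le_rsqrt)
    qed
    then show ?thesis using Extra by blast
  qed
qed

lemma toeplitz_vanishes_of_crossed:
  "cstar_seminorm p \<Longrightarrow> (\<And>r. r \<in> crossed_relations \<delta> L \<Longrightarrow> p r = 0) \<Longrightarrow>
    r \<in> toeplitz_relations \<delta> L \<Longrightarrow> p r = 0"
  by (rule crossed_seminorm.toeplitz_vanishes[OF crossed_seminormI])

lemma bounded_crossed: "bounded_relations (crossed_relations \<delta> L)"
  using bounded_toeplitz toeplitz_vanishes_of_crossed unfolding bounded_relations_def by meson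

end

section \<open>Constant sequences and endomorphisms of a completion\<close>

definition const_class :: "('g free_star_alg \<Rightarrow> real) \<Rightarrow> 'g free_star_alg \<Rightarrow> (nat \<Rightarrow> 'g free_star_alg) set" where
  "const_class p x = seq_class p (\<lambda>_. x)"

lemma universal_elem_eq: "universal_elem Rel x = const_class (universal_seminorm Rel) x"
  by (simp add: universal_elem_def const_class_def seq_class_def)

context
  fixes p :: "'g free_star_alg \<Rightarrow> real"
  assumes p: "cstar_seminorm p"
begin

interpretation s: cstar_seminormed seq_scal seq_star "cauchy_seqs p" "seq_norm p"
  using p by (rule cstar_seminormed_seqs)

lemma const_class_ops:
  "const_class p x \<otimes>\<^bsub>hausdorff_completion p\<^esub> const_class p y = const_class p (x * y)"
  "const_class p x \<oplus>\<^bsub>hausdorff_completion p\<^esub> const_class p y = const_class p (x + y)"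
  "const_class p x \<ominus>\<^bsub>hausdorff_completion p\<^esub> const_class p y = const_class p (x - y)"
  "scal (hausdorff_completion p) c (const_class p x) = const_class p (free_scal c x)"
  "invol (hausdorff_completion p) (const_class p x) = const_class p (free_star x)"
  "\<one>\<^bsub>hausdorff_completion p\<^esub> = const_class p 1"
  "\<zero>\<^bsub>hausdorff_completion p\<^esub> = const_class p 0"
  by (simp_all add: const_class_def completion_ops[OF p] const_Cauchy[OF p] times_fun_def
      plus_fun_def fun_diff_def seq_scal_def seq_star_def one_fun_def zero_fun_def)

lemma const_class_closed: "const_class p x \<in> carrier (hausdorff_completion p)"
  by (auto simp: const_class_def completion_carrier[OF p] const_Cauchy[OF p])

lemma const_class_eq: "const_class p x = const_class p y \<longleftrightarrow> p (x - y) = 0"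
  by (simp add: const_class_def seq_class_eq[OF p] const_Cauchy[OF p] fun_diff_def seq_norm_const[OF p])

lemma const_class_nrm: "nrm (hausdorff_completion p) (const_class p x) = p x"
  by (simp add: const_class_def completion_nrm[OF p] const_Cauchy[OF p] seq_norm_const[OF p])

text \<open>This turns a *-homomorphism between completions into a C*-seminorm to which automatic
  contractivity applies.\<close>

lemma pullback_seminorm:
  assumes q: "cstar_seminorm q" and f: "f \<in> star_hom (cauchy_alg q) (hausdorff_completion p)"
  shows "cstar_seminormed seq_scal seq_star (cauchy_seqs q) (\<lambda>Y. nrm (hausdorff_completion p) (f Y))"
proof -
  interpret q: cstar_seminormed seq_scal seq_star "cauchy_seqs q" "seq_norm q"
    using q by (rule cstar_seminormed_seqs)
  have "\<exists>g. \<forall>Y\<in>cauchy_seqs q. g Y \<in> cauchy_seqs p \<and> f Y = seq_class p (g Y)"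
    using star_homD(1)[OF f] unfolding completion_carrier[OF p] by (intro bchoice) auto
  then obtain g where g: "\<And>Y. Y \<in> cauchy_seqs q \<Longrightarrow> g Y \<in> cauchy_seqs p"
    "\<And>Y. Y \<in> cauchy_seqs q \<Longrightarrow> f Y = seq_class p (g Y)" by metis
  note hom = star_homD(2-6)[OF f, simplified]
  show ?thesis
    by standard
      (simp_all add: hom q.C_closed, simp_all add: g completion_ops[OF p] completion_nrm[OF p] s.C_closed q.C_closed
        s.p_nonneg s.p_add s.p_sm s.p_mult s.p_cstar)
qed

text \<open>A *-endomorphism of a complete algebra is contractive, hence determined by its values on the
  dense image of the free *-algebra.\<close>

lemma star_hom_fixing_constants:
  assumes f: "f \<in> star_hom (hausdorff_completion p) (hausdorff_completion p)"
    and fix_const: "\<And>x. f (const_class p x) = const_class p x"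
    and x: "x \<in> carrier (hausdorff_completion p)"
  shows "f x = x"
proof -
  let ?H = "hausdorff_completion p"
  interpret H: star_ring ?H by (rule completion_star_ring[OF p])
  define q where "q Y = nrm ?H (f (seq_class p Y))" for Y
  have contractive: "q Y \<le> seq_norm p Y" if "Y \<in> cauchy_seqs p" for Y
  proof (rule s.complete_contractive)
    show "\<exists>Y\<in>cauchy_seqs p. (\<lambda>n. seq_norm p (X n - Y)) \<longlonglongrightarrow> 0"
      if "\<And>n. X n \<in> cauchy_seqs p"
        "\<And>e. 0 < e \<Longrightarrow> \<exists>N. \<forall>m\<ge>N. \<forall>n\<ge>N. seq_norm p (X m - X n) < e" for X
      using that by (rule seqs_complete[OF p])
    show "cstar_seminormed seq_scal seq_star (cauchy_seqs p) q"
      using pullback_seminorm[OF p star_hom_comp[OF seq_class_hom[OF p] f]]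
      by (simp add: q_def[abs_def] comp_def)
    show "q Y = 0" if Y: "Y \<in> cauchy_seqs p" "seq_norm p Y = 0" for Y
    proof -
      have "seq_class p Y = seq_class p 0"
        using Y by (simp add: seq_class_eq[OF p] s.C_zero)
      then have "f (seq_class p Y) = \<zero>\<^bsub>?H\<^esub>"
        using star_hom_zero[OF f H.ring_axioms H.ring_axioms] by (simp add: completion_ops[OF p])
      then show ?thesis by (simp add: q_def completion_ops(7)[OF p] completion_nrm[OF p] s.C_zero s.p_zero)
    qed
  qed fact
  obtain Y where Y: "Y \<in> cauchy_seqs p" "x = seq_class p Y"
    using x by (auto simp: completion_carrier[OF p])
  obtain Z where Z: "Z \<in> cauchy_seqs p" "f x = seq_class p Z"
    using star_homD(1)[OF f x] by (auto simp: completion_carrier[OF p])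
  have "seq_norm p (Z - Y) \<le> 0"
  proof (rule field_le_epsilon)
    fix e :: real assume "0 < e"
    then obtain N where N: "\<And>n. n \<ge> N \<Longrightarrow> seq_norm p (Y - (\<lambda>_. Y n)) \<le> e / 2"
      using const_dense[OF p Y(1), of "e / 2"] by (metis half_gt_zero)
    let ?c = "\<lambda>_::nat. Y N"
    have c: "?c \<in> cauchy_seqs p" by (rule const_Cauchy[OF p])
    have "f (seq_class p (Y - ?c)) = f x \<ominus>\<^bsub>?H\<^esub> f (seq_class p ?c)"
      using star_hom_diff[OF f H.ring_axioms H.ring_axioms x, of "seq_class p ?c"] c Y
      by (simp add: completion_ops[OF p] completion_carrier[OF p])
    moreover have "f (seq_class p ?c) = seq_class p ?c" using fix_const by (simp add: const_class_def)
    moreover have "f x \<ominus>\<^bsub>?H\<^esub> seq_class p ?c = seq_class p (Z - ?c)"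
      by (simp add: Z c completion_ops[OF p])
    ultimately have "q (Y - ?c) = nrm ?H (seq_class p (Z - ?c))" unfolding q_def by simp
    then have "q (Y - ?c) = seq_norm p (Z - ?c)"
      using completion_nrm[OF p s.C_diff[OF Z(1) c]] by simp
    then have "seq_norm p (Z - ?c) \<le> e / 2"
      using contractive[of "Y - ?c"] N[of N] s.C_diff[OF Y(1) c] by linarith
    moreover have "seq_norm p (?c - Y) \<le> e / 2"
      using N[of N] s.p_commute[OF Y(1) c] by simp
    moreover have "seq_norm p (Z - Y) \<le> seq_norm p (Z - ?c) + seq_norm p (?c - Y)"
      by (intro s.p_triangle Z Y c)
    ultimately show "seq_norm p (Z - Y) \<le> 0 + e" by linarith
  qed
  then have "seq_norm p (Z - Y) = 0" using s.p_nonneg[OF s.C_diff[OF Z(1) Y(1)]] by simp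
  then show ?thesis using Y Z by (simp add: seq_class_eq[OF p])
qed

end

section \<open>The canonical map from the Toeplitz algebra to the crossed product\<close>

interpretation cmodule: module "scaleC :: complex \<Rightarrow> 'a::unital_cstar_algebra \<Rightarrow> 'a"
  by standard (simp_all add: scaleC_add_right scaleC_add_left scaleC_scaleC cstar.sm_one)

context transfer_pair
begin

abbreviation "pX \<equiv> universal_seminorm (crossed_relations \<delta> L)"
abbreviation "pT \<equiv> universal_seminorm (toeplitz_relations \<delta> L)"
abbreviation "crossed_alg \<equiv> hausdorff_completion pX"
abbreviation "toeplitz_alg \<equiv> hausdorff_completion pT"

lemma pX: "cstar_seminorm pX" and pT: "cstar_seminorm pT"
  by (rule universal_cstar_seminorm bounded_crossed bounded_toeplitz)+

sublocale X: crossed_seminorm pX \<delta> L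
  by (intro crossed_seminormI pX universal_vanishes[OF bounded_crossed])

sublocale T: toeplitz_seminorm pT \<delta> L
  by (intro toeplitz_seminormI pT universal_vanishes[OF bounded_toeplitz])

sublocale sX: cstar_seminormed seq_scal seq_star "cauchy_seqs pX" "seq_norm pX"
  by (rule cstar_seminormed_seqs[OF pX])

sublocale sT: cstar_seminormed seq_scal seq_star "cauchy_seqs pT" "seq_norm pT"
  by (rule cstar_seminormed_seqs[OF pT])

sublocale crossed_alg: star_ring crossed_alg by (rule completion_star_ring[OF pX])

sublocale toeplitz_alg: star_ring toeplitz_alg by (rule completion_star_ring[OF pT])

lemma algebra_names:
  "crossed_product \<delta> L = crossed_alg" "toeplitz_algebra \<delta> L = toeplitz_alg"
  "crossed_elem \<delta> L a = const_class pX (el a)" "crossed_U \<delta> L = const_class pX ext"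
  "toeplitz_elem \<delta> L a = const_class pT (el a)" "toeplitz_S \<delta> L = const_class pT ext"
  by (simp_all add: crossed_product_def toeplitz_algebra_def universal_cstar_algebra_def
      crossed_elem_def crossed_U_def toeplitz_elem_def toeplitz_S_def universal_elem_eq)

lemma pX_le_pT: "pX x \<le> pT x"
  by (intro universal_upper[OF bounded_toeplitz] pX X.toeplitz_vanishes)

lemma cauchy_pT_pX: "Z \<in> cauchy_seqs pT \<Longrightarrow> Z \<in> cauchy_seqs pX"
  unfolding cauchy_seqs_iff by (meson order_le_less_trans pX_le_pT)

lemma seq_norm_pX_le_pT: "Z \<in> cauchy_seqs pT \<Longrightarrow> seq_norm pX Z \<le> seq_norm pT Z"
  by (rule LIMSEQ_le[OF seq_norm_tendsto[OF pX cauchy_pT_pX] seq_norm_tendsto[OF pT]])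
    (auto simp: pX_le_pT)

lemma toeplitz_to_crossed_exists:
  "\<exists>f. f \<in> star_hom toeplitz_alg crossed_alg \<and> (\<forall>Z\<in>cauchy_seqs pT. f (seq_class pT Z) = seq_class pX Z)"
proof -
  interpret N: star_ideal "cauchy_alg pT" "null_sequences pT" by (rule null_star_ideal[OF pT])
  have "seq_class pX \<in> star_hom (cauchy_alg pT) crossed_alg"
    using star_homD[OF seq_class_hom[OF pX]] cauchy_pT_pX by (intro star_homI) auto
  moreover have "seq_class pX Z = \<zero>\<^bsub>crossed_alg\<^esub>" if "Z \<in> null_sequences pT" for Z
  proof -
    have Z: "Z \<in> cauchy_seqs pT" "seq_norm pT Z = 0" using that by (simp_all add: null_sequences_iff[OF pT])
    then have "seq_norm pX Z = 0"
      using seq_norm_pX_le_pT[of Z] sX.p_nonneg[of Z] cauchy_pT_pX[of Z] by simp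
    then show ?thesis
      using Z cauchy_pT_pX by (simp add: completion_ops[OF pX] seq_class_eq[OF pX] sX.C_zero)
  qed
  ultimately obtain g where "g \<in> star_hom (star_quotient (cauchy_alg pT) (null_sequences pT)) crossed_alg"
    "\<And>x. x \<in> cauchy_seqs pT \<Longrightarrow> g (null_sequences pT +>\<^bsub>cauchy_alg pT\<^esub> x) = seq_class pX x"
    using N.factor_star_hom[OF _ crossed_alg.ring_axioms] by metis
  then show ?thesis by (auto simp: seq_class_def hausdorff_completion_def)
qed

text \<open>This is the map \<open>\<pi> : T \<rightarrow> X\<close>.\<close>

definition toeplitz_to_crossed where
  "toeplitz_to_crossed = (SOME f. f \<in> star_hom toeplitz_alg crossed_alg \<and>
     (\<forall>Z\<in>cauchy_seqs pT. f (seq_class pT Z) = seq_class pX Z))"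

lemma toeplitz_to_crossed_hom: "toeplitz_to_crossed \<in> star_hom toeplitz_alg crossed_alg"
  and toeplitz_to_crossed_class:
    "Z \<in> cauchy_seqs pT \<Longrightarrow> toeplitz_to_crossed (seq_class pT Z) = seq_class pX Z"
  using someI_ex[OF toeplitz_to_crossed_exists] by (auto simp: toeplitz_to_crossed_def)

lemma toeplitz_to_crossed_const: "toeplitz_to_crossed (const_class pT x) = const_class pX x"
  by (simp add: const_class_def toeplitz_to_crossed_class const_Cauchy[OF pT])

definition canonical_kernel where
  "canonical_kernel = {t \<in> carrier toeplitz_alg. toeplitz_to_crossed t = \<zero>\<^bsub>crossed_alg\<^esub>}"

lemma canonical_kernel_star_ideal: "star_ideal toeplitz_alg canonical_kernel"
  unfolding canonical_kernel_def
  using toeplitz_to_crossed_hom toeplitz_alg.star_ring_axioms crossed_alg.star_ring_axioms by (rule star_hom_kernel)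

lemma canonical_kernel_iff:
  "Z \<in> cauchy_seqs pT \<Longrightarrow> seq_class pT Z \<in> canonical_kernel \<longleftrightarrow> seq_norm pX Z = 0"
  by (auto simp: canonical_kernel_def toeplitz_to_crossed_class completion_carrier[OF pT]
      completion_ops(7)[OF pX] seq_class_eq[OF pX] cauchy_pT_pX sX.C_zero)

lemma canonical_kernel_closed: "nrm_closure toeplitz_alg canonical_kernel \<subseteq> canonical_kernel"
proof
  fix t assume t: "t \<in> nrm_closure toeplitz_alg canonical_kernel"
  then obtain Z where Z: "Z \<in> cauchy_seqs pT" "t = seq_class pT Z"
    by (auto simp: nrm_closure_def completion_carrier[OF pT])
  have "seq_norm pX Z \<le> 0"
  proof (rule field_le_epsilon)
    fix e :: real assume "0 < e"
    then obtain y where y: "y \<in> canonical_kernel" "nrm toeplitz_alg (t \<ominus>\<^bsub>toeplitz_alg\<^esub> y) < e"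
      using t by (auto simp: nrm_closure_def)
    then obtain Y where Y: "Y \<in> cauchy_seqs pT" "y = seq_class pT Y"
      by (auto simp: canonical_kernel_def completion_carrier[OF pT])
    have "seq_norm pT (Z - Y) < e"
      using y Y Z by (simp add: completion_ops[OF pT] completion_nrm[OF pT] sT.C_diff)
    moreover have "seq_norm pX Y = 0" using y Y canonical_kernel_iff by simp
    moreover have "seq_norm pX Z \<le> seq_norm pX Y + seq_norm pX (Z - Y)"
      using Y Z by (intro sX.p_le_diff cauchy_pT_pX)
    moreover have "seq_norm pX (Z - Y) \<le> seq_norm pT (Z - Y)"
      using Y Z by (intro seq_norm_pX_le_pT sT.C_diff)
    ultimately show "seq_norm pX Z \<le> 0 + e" by linarith
  qed
  then show "t \<in> canonical_kernel"
    using Z canonical_kernel_iff sX.p_nonneg[OF cauchy_pT_pX[OF Z(1)]] by simp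
qed

text \<open>A redundancy \<open>(a, k)\<close> dies in the crossed product: there \<open>d = a - k\<close> annihilates
  \<open>A U\<close> on the right, while \<open>d\<close> itself lies in the closed span of \<open>A U U\<^sup>* A\<close>, since
  \<open>\<delta>(A) \<subseteq> U U\<^sup>* A\<close>; hence \<open>d d\<^sup>* = 0\<close>.\<close>

lemma redundancy_in_kernel:
  assumes red: "redundancy \<delta> L a k"
  shows "toeplitz_elem \<delta> L a \<ominus>\<^bsub>toeplitz_alg\<^esub> k \<in> canonical_kernel"
proof -
  let ?G = "{const_class pT (el x) \<otimes>\<^bsub>toeplitz_alg\<^esub> const_class pT ext \<otimes>\<^bsub>toeplitz_alg\<^esub>
      invol toeplitz_alg (const_class pT ext) \<otimes>\<^bsub>toeplitz_alg\<^esub> const_class pT (el y) | x y. True}"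
  have a: "a \<in> closure (cspan {x * \<delta> y * z | x y z. True})"
    and k: "k \<in> nrm_closure toeplitz_alg (lin_span toeplitz_alg ?G)"
    and eq: "\<And>b. const_class pT (el a) \<otimes>\<^bsub>toeplitz_alg\<^esub> const_class pT (el b) \<otimes>\<^bsub>toeplitz_alg\<^esub> const_class pT ext
        = k \<otimes>\<^bsub>toeplitz_alg\<^esub> const_class pT (el b) \<otimes>\<^bsub>toeplitz_alg\<^esub> const_class pT ext"
    using red by (auto simp: redundancy_def Let_def algebra_names)
  obtain K where K: "K \<in> cauchy_seqs pT" "k = seq_class pT K"
    using k by (auto simp: nrm_closure_def completion_carrier[OF pT])
  note constT = const_Cauchy[OF pT] and constX = const_Cauchy[OF pX]
  \<comment> \<open>\<open>D\<close> represents \<open>d\<close>, and \<open>W\<close> is the closed subspace of all \<open>w\<close> with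
      \<open>d w\<^sup>* = 0\<close> in \<open>X\<close>; both \<open>a\<close> and \<open>k\<close> belong to it.\<close>
  define D where "D = (\<lambda>_. el a) - K"
  have DT: "D \<in> cauchy_seqs pT" unfolding D_def by (intro sT.C_diff constT K)
  then have D: "D \<in> cauchy_seqs pX" by (rule cauchy_pT_pX)
  have D_el: "seq_norm pX (D * (\<lambda>_. el b * ext)) = 0" for b
  proof -
    have "seq_class pT ((\<lambda>_. el a) * (\<lambda>_. el b) * (\<lambda>_. ext)) = seq_class pT (K * (\<lambda>_. el b) * (\<lambda>_. ext))"
      using eq[of b] by (simp add: const_class_def K completion_ops[OF pT] constT sT.C_mult)
    then have "seq_norm pT ((\<lambda>_. el a) * (\<lambda>_. el b) * (\<lambda>_. ext) - K * (\<lambda>_. el b) * (\<lambda>_. ext)) = 0"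
      by (simp add: seq_class_eq[OF pT] K constT sT.C_mult)
    also have "(\<lambda>_. el a) * (\<lambda>_. el b) * (\<lambda>_. ext) - K * (\<lambda>_. el b) * (\<lambda>_. ext) = D * (\<lambda>_. el b * ext)"
      by (auto simp: D_def fun_eq_iff algebra_simps)
    finally have "seq_norm pT (D * (\<lambda>_. el b * ext)) = 0" .
    moreover have "D * (\<lambda>_. el b * ext) \<in> cauchy_seqs pT" by (intro sT.C_mult DT constT)
    ultimately show ?thesis
      using seq_norm_pX_le_pT[of "D * (\<lambda>_. el b * ext)"] cauchy_pT_pX[of "D * (\<lambda>_. el b * ext)"]
        sX.p_nonneg[of "D * (\<lambda>_. el b * ext)"] by simp
  qed
  have D_eqv: "seq_norm pX (D * (\<lambda>_. v)) = 0"
    if u: "seq_norm pX (D * (\<lambda>_. u)) = 0" and uv: "pX (u - v) = 0" for u v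
  proof -
    have "seq_norm pX ((\<lambda>_. u) - (\<lambda>_. v)) = 0" using uv by (simp add: fun_diff_def seq_norm_const[OF pX])
    then have "seq_norm pX (D * (\<lambda>_. u) - D * (\<lambda>_. v)) = 0"
      by (intro sX.p_mult_diff_zero D constX) (simp_all add: sX.p_zero)
    then show ?thesis using sX.p_diff_zero_eq[of "D * (\<lambda>_. u)" "D * (\<lambda>_. v)"] u D constX
      by (simp add: sX.C_mult)
  qed
  define W where "W = {w \<in> cauchy_seqs pX. seq_norm pX (D * seq_star w) = 0}"
  have W_approx: "z \<in> W" if z: "z \<in> cauchy_seqs pX" and
      approx: "\<And>e. 0 < e \<Longrightarrow> \<exists>w\<in>W. seq_norm pX (z - w) < e" for z
  proof -
    have "seq_norm pX (D * seq_star z) \<le> 0"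
    proof (rule field_le_epsilon)
      fix e :: real assume e: "0 < e"
      have D0: "0 \<le> seq_norm pX D" using D by (rule sX.p_nonneg)
      then have "0 < e / (seq_norm pX D + 1)" using e by simp
      then obtain w where w: "w \<in> W" "seq_norm pX (z - w) < e / (seq_norm pX D + 1)"
        using approx by blast
      then have wC: "w \<in> cauchy_seqs pX" and w0: "seq_norm pX (D * seq_star w) = 0" by (auto simp: W_def)
      have "seq_norm pX (D * seq_star z)
          \<le> seq_norm pX (D * seq_star w) + seq_norm pX (D * seq_star z - D * seq_star w)"
        by (intro sX.p_le_diff sX.C_mult sX.C_adj D z wC)
      moreover have "D * seq_star z - D * seq_star w = D * seq_star (z - w)"
        by (simp add: seqs.adj_diff right_diff_distrib)
      moreover have "seq_norm pX (D * seq_star (z - w)) \<le> seq_norm pX D * seq_norm pX (seq_star (z - w))"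
        by (intro sX.p_mult sX.C_adj sX.C_diff D z wC)
      moreover have "seq_norm pX (seq_star (z - w)) = seq_norm pX (z - w)"
        by (intro sX.p_adj sX.C_diff z wC)
      moreover have "seq_norm pX D * seq_norm pX (z - w) \<le> (seq_norm pX D + 1) * (e / (seq_norm pX D + 1))"
        using D0 w(2) sX.p_nonneg[OF sX.C_diff[OF z wC]] by (intro mult_mono) auto
      moreover have "(seq_norm pX D + 1) * (e / (seq_norm pX D + 1)) = e" using D0 by simp
      ultimately show "seq_norm pX (D * seq_star z) \<le> 0 + e" using w0 by simp
    qed
    then show ?thesis
      using z sX.p_nonneg[OF sX.C_mult[OF D sX.C_adj[OF z]]] by (simp add: W_def)
  qed
  have W_eqv: "z \<in> W" if "w \<in> W" "z \<in> cauchy_seqs pX" "seq_norm pX (z - w) = 0" for z w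
    using W_approx[OF that(2)] that(1,3) by force
  have W_zero: "0 \<in> W" by (simp add: W_def sX.C_zero seqs.adj_zero sX.p_zero)
  have W_add: "v + w \<in> W" if "v \<in> W" "w \<in> W" for v w
    using that D by (simp add: W_def sX.C_closed seqs.adj_add distrib_left sX.p_add_zero)
  have W_scal: "seq_scal c w \<in> W" if "w \<in> W" for c w
    using that D by (simp add: W_def sX.C_closed seqs.adj_sm seqs.sm_mult_right sX.p_sm)
  have W_gen: "(\<lambda>_. m * (free_star ext * el z)) \<in> W" for m z
  proof -
    have "pX (el (z\<^sup>\<star>) * ext - free_star (el z) * ext) = 0"
      using X.eqv_right[OF X.el_star] by (simp add: X.eqv_def)
    then have "seq_norm pX (D * (\<lambda>_. free_star (el z) * ext)) = 0" by (rule D_eqv[OF D_el])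
    then have "seq_norm pX (D * (\<lambda>_. free_star (el z) * ext) * (\<lambda>_. free_star m)) = 0"
      by (rule sX.p_mult_zero_left[OF sX.C_mult[OF D constX] constX])
    moreover have "D * (\<lambda>_. free_star (el z) * ext) * (\<lambda>_. free_star m)
        = D * seq_star (\<lambda>_. m * (free_star ext * el z))"
      by (simp add: fun_eq_iff seq_star_def free.adj_simps mult.assoc)
    ultimately show ?thesis by (simp add: W_def constX)
  qed
  have "(\<lambda>_. el a) \<in> W"
  proof (rule W_approx)
    define A where "A = {a. (\<lambda>_. el a) \<in> W}"
    have constW: "(\<lambda>_. v) \<in> W" if "(\<lambda>_. u) \<in> W" "pX (v - u) = 0" for u v
      using W_eqv[OF that(1) constX] that(2) by (simp add: fun_diff_def seq_norm_const[OF pX])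
    have "cmodule.subspace A"
    proof (rule cmodule.subspaceI)
      have "X.eqv (el 0) (free_scal 0 (el 0))" using X.el_scal[of 0 0] by (simp add: cstar.sm_zero_left)
      then show "0 \<in> A"
        using W_zero constW[of 0 "el 0"] by (simp add: A_def X.eqv_def free.sm_zero_left zero_fun_def)
      show "x + y \<in> A" if "x \<in> A" "y \<in> A" for x y
      proof -
        have "(\<lambda>_. el x) + (\<lambda>_. el y) \<in> W" using that by (auto simp: A_def intro: W_add)
        then have "(\<lambda>_. el x + el y) \<in> W" by (simp add: plus_fun_def)
        from constW[OF this] X.el_add show ?thesis by (simp add: A_def X.eqv_def)
      qed
      show "c *\<^sub>C x \<in> A" if "x \<in> A" for c x
      proof -
        have "seq_scal c (\<lambda>_. el x) \<in> W" using that by (auto simp: A_def intro: W_scal)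
        then have "(\<lambda>_. free_scal c (el x)) \<in> W" by (simp add: seq_scal_def)
        from constW[OF this] X.el_scal show ?thesis by (simp add: A_def X.eqv_def)
      qed
    qed
    moreover have "{x * \<delta> y * z | x y z. True} \<subseteq> A"
      using constW[OF W_gen X.el_\<delta>_factor[unfolded X.eqv_def]] by (auto simp: A_def)
    ultimately have span: "cspan {x * \<delta> y * z | x y z. True} \<subseteq> A"
      unfolding cspan_def by (intro cmodule.span_minimal)
    fix e :: real assume "0 < e"
    then obtain b where b: "b \<in> cspan {x * \<delta> y * z | x y z. True}" "dist b a < e"
      using a by (auto simp: closure_approachable)
    have "pX (el a - el b) < e"
      using X.el_lipschitz[of a b] b(2) by (simp add: dist_norm norm_minus_commute)
    then show "\<exists>w\<in>W. seq_norm pX ((\<lambda>_. el a) - w) < e"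
      using b(1) span by (intro bexI[of _ "\<lambda>_. el b"])
        (auto simp: A_def fun_diff_def seq_norm_const[OF pX])
  qed (rule constX)
  moreover have "K \<in> W"
  proof (rule W_approx)
    have lin: "\<exists>z\<in>W. z \<in> cauchy_seqs pT \<and> t = seq_class pT z" if "t \<in> lin_span toeplitz_alg ?G" for t
      using that
    proof induction
      case zero
      then show ?case using W_zero sT.C_zero by (auto simp: completion_ops(7)[OF pT])
    next
      case (add x y c)
      then obtain x1 x2 where x: "x = const_class pT (el x1 * ext * free_star ext * el x2)"
        by (auto simp: const_class_ops[OF pT])
      obtain z where z: "z \<in> W" "z \<in> cauchy_seqs pT" "y = seq_class pT z" using add.IH by blast
      let ?w = "seq_scal c (\<lambda>_. el x1 * ext * free_star ext * el x2) + z"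
      have "(\<lambda>_::nat. el x1 * ext * free_star ext * el x2) \<in> W"
        using W_gen[of "el x1 * ext" x2] by (simp add: mult.assoc)
      then have "?w \<in> W" by (intro W_add W_scal z)
      moreover have "?w \<in> cauchy_seqs pT" by (intro sT.C_add sT.C_sm constT z)
      moreover have "scal toeplitz_alg c x \<oplus>\<^bsub>toeplitz_alg\<^esub> y = seq_class pT ?w"
        by (simp add: x z const_class_def completion_ops[OF pT] constT sT.C_sm)
      ultimately show ?case by blast
    qed
    fix e :: real assume "0 < e"
    then obtain y where y: "y \<in> lin_span toeplitz_alg ?G" "nrm toeplitz_alg (k \<ominus>\<^bsub>toeplitz_alg\<^esub> y) < e"
      using k by (auto simp: nrm_closure_def)
    obtain z where z: "z \<in> W" "z \<in> cauchy_seqs pT" "y = seq_class pT z" using lin[OF y(1)] by blast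
    have "seq_norm pT (K - z) < e"
      using y(2) z K by (simp add: completion_ops[OF pT] completion_nrm[OF pT] sT.C_diff)
    then have "seq_norm pX (K - z) < e"
      using seq_norm_pX_le_pT[OF sT.C_diff[OF K(1) z(2)]] by simp
    then show "\<exists>w\<in>W. seq_norm pX (K - w) < e" using z by blast
  qed (rule cauchy_pT_pX[OF K(1)])
  ultimately have "(\<lambda>_. el a) + seq_scal (- 1) K \<in> W" by (intro W_add W_scal)
  then have "D \<in> W" by (simp add: D_def seqs.sm_minus_one)
  then have "seq_norm pX D = 0" using sX.p_cstar'[OF D] by (simp add: W_def)
  moreover have "toeplitz_elem \<delta> L a \<ominus>\<^bsub>toeplitz_alg\<^esub> k = seq_class pT D"
    by (simp add: algebra_names const_class_def K D_def completion_ops[OF pT] constT)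
  ultimately show ?thesis using canonical_kernel_iff[OF DT] by simp
qed

end

section \<open>The kernel of the canonical map is the redundancy ideal\<close>

context transfer_pair
begin

abbreviation "exel_ideal \<equiv> redundancy_ideal \<delta> L"

lemma redundancy_ideal_least:
  assumes "ideal J toeplitz_alg" "nrm_closure toeplitz_alg J \<subseteq> J"
    "\<And>a k. redundancy \<delta> L a k \<Longrightarrow> toeplitz_elem \<delta> L a \<ominus>\<^bsub>toeplitz_alg\<^esub> k \<in> J"
  shows "exel_ideal \<subseteq> J"
  using assms unfolding redundancy_ideal_def closed_ideal_generated_def algebra_names(2) by blast

lemma redundancy_ideal_contains:
  "redundancy \<delta> L a k \<Longrightarrow> toeplitz_elem \<delta> L a \<ominus>\<^bsub>toeplitz_alg\<^esub> k \<in> exel_ideal"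
  unfolding redundancy_ideal_def closed_ideal_generated_def algebra_names(2) by blast

lemma redundancy_ideal_subset_kernel: "exel_ideal \<subseteq> canonical_kernel"
  using canonical_kernel_star_ideal canonical_kernel_closed redundancy_in_kernel
  by (intro redundancy_ideal_least) (auto simp: star_ideal_def)

lemma redundancy_ideal_ideal: "ideal exel_ideal toeplitz_alg"
  unfolding redundancy_ideal_def closed_ideal_generated_def algebra_names(2)
proof (rule toeplitz_alg.i_Intersect)
  show "{I. ideal I toeplitz_alg \<and> nrm_closure toeplitz_alg I \<subseteq> I \<and>
      {toeplitz_elem \<delta> L a \<ominus>\<^bsub>toeplitz_alg\<^esub> k |a k. redundancy \<delta> L a k} \<subseteq> I} \<noteq> {}"
    using canonical_kernel_star_ideal canonical_kernel_closed redundancy_in_kernel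
    by (auto simp: star_ideal_def)
qed auto

lemma redundancy_ideal_closed: "nrm_closure toeplitz_alg exel_ideal \<subseteq> exel_ideal"
proof -
  have "nrm_closure toeplitz_alg (\<Inter>\<A>) \<subseteq> I" if "I \<in> \<A>" "nrm_closure toeplitz_alg I \<subseteq> I" for \<A> I
  proof -
    have "nrm_closure toeplitz_alg (\<Inter>\<A>) \<subseteq> nrm_closure toeplitz_alg I"
      using that(1) unfolding nrm_closure_def by fast
    then show ?thesis using that(2) by simp
  qed
  then show ?thesis
    unfolding redundancy_ideal_def closed_ideal_generated_def algebra_names(2)
    by (intro Inter_greatest) simp
qed

sublocale exel_ideal: ideal exel_ideal toeplitz_alg by (rule redundancy_ideal_ideal)

lemma covariance_redundancy:
  "redundancy \<delta> L (\<delta> b) (const_class pT (ext * el b * free_star ext))"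
proof -
  let ?k = "const_class pT (ext * el b * free_star ext)"
  let ?G = "{const_class pT (el x) \<otimes>\<^bsub>toeplitz_alg\<^esub> const_class pT ext \<otimes>\<^bsub>toeplitz_alg\<^esub>
      invol toeplitz_alg (const_class pT ext) \<otimes>\<^bsub>toeplitz_alg\<^esub> const_class pT (el y) | x y. True}"
  have "\<delta> b = 1 * \<delta> b * 1" by simp
  then have "\<delta> b \<in> {x * \<delta> y * z | x y z. True}" by blast
  then have "\<delta> b \<in> cspan {x * \<delta> y * z | x y z. True}"
    unfolding cspan_def by (rule cmodule.span_base)
  then have a: "\<delta> b \<in> closure (cspan {x * \<delta> y * z | x y z. True})"
    using closure_subset by blast
  let ?g = "const_class pT (el (\<delta> b)) \<otimes>\<^bsub>toeplitz_alg\<^esub> const_class pT ext \<otimes>\<^bsub>toeplitz_alg\<^esub>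
      invol toeplitz_alg (const_class pT ext) \<otimes>\<^bsub>toeplitz_alg\<^esub> const_class pT (el 1)"
  have g: "?g = const_class pT (el (\<delta> b) * ext * free_star ext * el 1)"
    by (simp add: const_class_ops[OF pT])
  have "scal toeplitz_alg 1 ?g \<oplus>\<^bsub>toeplitz_alg\<^esub> \<zero>\<^bsub>toeplitz_alg\<^esub> \<in> lin_span toeplitz_alg ?G"
    by (intro lin_span.intros) blast
  moreover have "scal toeplitz_alg 1 ?g \<oplus>\<^bsub>toeplitz_alg\<^esub> \<zero>\<^bsub>toeplitz_alg\<^esub> = ?k"
  proof -
    have "T.eqv (el (\<delta> b) * ext * free_star ext * el 1) (el (\<delta> b) * ext * free_star ext)"
      by (rule T.el_one_right)
    also have "T.eqv (el (\<delta> b) * ext * free_star ext) (ext * el b * free_star ext)"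
      by (intro T.eqv_right T.eqv_sym[OF T.covariance])
    finally show ?thesis
      unfolding g by (simp add: const_class_ops[OF pT] free.sm_one const_class_eq[OF pT] T.eqv_def)
  qed
  ultimately have k_span: "?k \<in> lin_span toeplitz_alg ?G" by simp
  have "?k \<ominus>\<^bsub>toeplitz_alg\<^esub> ?k = const_class pT 0" by (simp add: const_class_ops[OF pT])
  then have "nrm toeplitz_alg (?k \<ominus>\<^bsub>toeplitz_alg\<^esub> ?k) = 0" by (simp add: const_class_nrm[OF pT] T.p_zero)
  then have "\<exists>y\<in>lin_span toeplitz_alg ?G. nrm toeplitz_alg (?k \<ominus>\<^bsub>toeplitz_alg\<^esub> y) < e" if "0 < e" for e
    using that k_span by (intro bexI[of _ ?k]) simp_all
  then have k: "?k \<in> nrm_closure toeplitz_alg (lin_span toeplitz_alg ?G)"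
    unfolding nrm_closure_def using const_class_closed[OF pT] by blast
  have eq: "const_class pT (el (\<delta> b)) \<otimes>\<^bsub>toeplitz_alg\<^esub> const_class pT (el c) \<otimes>\<^bsub>toeplitz_alg\<^esub> const_class pT ext
      = ?k \<otimes>\<^bsub>toeplitz_alg\<^esub> const_class pT (el c) \<otimes>\<^bsub>toeplitz_alg\<^esub> const_class pT ext" for c
    using T.redundancy_equation[of b c]
    by (simp add: const_class_ops[OF pT] const_class_eq[OF pT] T.eqv_def mult.assoc)
  show ?thesis
    unfolding redundancy_def Let_def algebra_names using a k eq by blast
qed

lemma pT_zero_in_ideal: "pT x = 0 \<Longrightarrow> const_class pT x \<in> exel_ideal"
  using const_class_eq[OF pT, of x 0] exel_ideal.zero_closed by (simp add: const_class_ops[OF pT])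

lemma covariance_in_ideal: "const_class pT (el (\<delta> b) - ext * el b * free_star ext) \<in> exel_ideal"
  using redundancy_ideal_contains[OF covariance_redundancy]
  by (simp add: algebra_names const_class_ops[OF pT])

text \<open>The condition on \<open>x\<^sup>*\<close> makes this a *-ideal before the redundancy ideal itself is known to
  be self-adjoint, which follows only from its description as a kernel.\<close>

definition free_ideal where
  "free_ideal = {x. const_class pT x \<in> exel_ideal \<and> const_class pT (free_star x) \<in> exel_ideal}"

lemma crossed_relations_in_free_ideal:
  assumes r: "r \<in> crossed_relations \<delta> L"
  shows "r \<in> free_ideal"
proof -
  have zero: "x \<in> free_ideal" if "pT x = 0" for x
    using that pT_zero_in_ideal by (auto simp: free_ideal_def T.p_adj)
  consider "r \<in> algebra_relations" | "r = ext * free_star ext * ext - ext"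
    | a where "r = el (\<delta> a) - ext * el a * free_star ext"
    | a where "r = el (L a) - free_star ext * el a * ext"
    using r by (auto simp: crossed_relations_def)
  then show ?thesis
  proof cases
    case 1
    then show ?thesis by (intro zero T.algebra)
  next
    case 2
    then show ?thesis using T.partial_isometry by (intro zero) (simp add: T.eqv_def)
  next
    case (3 a)
    have star: "free_star r = free_star (el (\<delta> a)) - ext * free_star (el a) * free_star ext"
      by (simp add: 3 free.adj_simps mult.assoc)
    have "T.eqv (free_star (el (\<delta> a))) (el (\<delta> (a\<^sup>\<star>)))"
      unfolding \<delta>_star by (rule T.eqv_sym[OF T.el_star])
    moreover have "T.eqv (ext * free_star (el a) * free_star ext) (ext * el (a\<^sup>\<star>) * free_star ext)"
      by (intro T.eqv_left T.eqv_right T.eqv_sym[OF T.el_star])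
    ultimately have "T.eqv (free_star r) (el (\<delta> (a\<^sup>\<star>)) - ext * el (a\<^sup>\<star>) * free_star ext)"
      unfolding star T.eqv_def
      using T.p_diff[of "free_star (el (\<delta> a)) - el (\<delta> (a\<^sup>\<star>))"
          "ext * free_star (el a) * free_star ext - ext * el (a\<^sup>\<star>) * free_star ext"]
        T.p_nonneg
      by (simp add: algebra_simps antisym)
    then have "const_class pT (free_star r) = const_class pT (el (\<delta> (a\<^sup>\<star>)) - ext * el (a\<^sup>\<star>) * free_star ext)"
      by (simp add: const_class_eq[OF pT] T.eqv_def)
    then show ?thesis using covariance_in_ideal[of a] covariance_in_ideal[of "a\<^sup>\<star>"]
      by (simp add: free_ideal_def 3)
  next
    case (4 a)
    then show ?thesis using T.eqv_sym[OF T.compression] by (intro zero) (simp add: T.eqv_def)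
  qed
qed

text \<open>The distance in \<open>pT\<close> from \<open>free_ideal\<close> is a C*-seminorm that vanishes on the
  crossed-product relations, so it is dominated by \<open>pX\<close>.\<close>

lemma approximation_modulo_ideal:
  assumes e: "0 < e"
  obtains j where "j \<in> free_ideal" "pT (x - j) < pX x + e"
proof -
  have J0: "0 \<in> free_ideal"
    using exel_ideal.zero_closed by (simp add: free_ideal_def free.adj_simps const_class_ops[OF pT])
  have q: "cstar_seminormed free_scal free_star UNIV (T.quotient_seminorm free_ideal)"
  proof (rule T.quotient_seminorm_cstar)
    fix x y assume x: "x \<in> free_ideal"
    show "x + y \<in> free_ideal" if "y \<in> free_ideal"
      using exel_ideal.a_closed[of "const_class pT x" "const_class pT y"]
        exel_ideal.a_closed[of "const_class pT (free_star x)" "const_class pT (free_star y)"] x that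
      by (simp add: free_ideal_def free.adj_simps const_class_ops[OF pT])
    show "x * y \<in> free_ideal"
      using exel_ideal.I_r_closed[of "const_class pT x" "const_class pT y"]
        exel_ideal.I_l_closed[of "const_class pT (free_star x)" "const_class pT (free_star y)"] x
      by (simp add: free_ideal_def free.adj_simps const_class_ops[OF pT] const_class_closed[OF pT])
    show "y * x \<in> free_ideal"
      using exel_ideal.I_l_closed[of "const_class pT x" "const_class pT y"]
        exel_ideal.I_r_closed[of "const_class pT (free_star x)" "const_class pT (free_star y)"] x
      by (simp add: free_ideal_def free.adj_simps const_class_ops[OF pT] const_class_closed[OF pT])
    show "free_star x \<in> free_ideal" using x by (simp add: free_ideal_def free.adj_simps)
  qed (use J0 in auto)
  have bdd: "bdd_below ((\<lambda>j. pT (x - j)) ` free_ideal)" for x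
    by (rule bdd_belowI[of _ 0]) (auto simp: T.p_nonneg)
  have "T.quotient_seminorm free_ideal x \<le> pX x"
  proof (rule universal_upper[OF bounded_crossed])
    show "cstar_seminorm (T.quotient_seminorm free_ideal)" using q by (simp add: cstar_seminormed_free)
    show "T.quotient_seminorm free_ideal r = 0" if "r \<in> crossed_relations \<delta> L" for r
    proof (rule antisym)
      show "T.quotient_seminorm free_ideal r \<le> 0"
        unfolding T.quotient_seminorm_def
        using cINF_lower[OF bdd crossed_relations_in_free_ideal[OF that], of r] by (simp add: T.p_zero)
      show "0 \<le> T.quotient_seminorm free_ideal r"
        using cstar_seminormed.p_nonneg[OF q] by simp
    qed
  qed
  then have "(INF j\<in>free_ideal. pT (x - j)) < pX x + e"
    using e by (simp add: T.quotient_seminorm_def)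
  then show ?thesis
    using that J0 bdd[of x] cINF_less_iff[of free_ideal "\<lambda>j. pT (x - j)" "pX x + e"] by auto
qed

lemma kernel_subset_redundancy_ideal: "canonical_kernel \<subseteq> exel_ideal"
proof
  fix t assume t: "t \<in> canonical_kernel"
  then obtain Z where Z: "Z \<in> cauchy_seqs pT" "t = seq_class pT Z"
    by (auto simp: canonical_kernel_def completion_carrier[OF pT])
  have ZX: "Z \<in> cauchy_seqs pX" using Z cauchy_pT_pX by simp
  have "(\<lambda>n. pX (Z n)) \<longlonglongrightarrow> 0"
    using seq_norm_tendsto[OF pX ZX] t Z canonical_kernel_iff by simp
  have "t \<in> nrm_closure toeplitz_alg exel_ideal" unfolding nrm_closure_def
  proof (intro CollectI conjI allI impI)
    show "t \<in> carrier toeplitz_alg" using t by (simp add: canonical_kernel_def)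
    fix e :: real assume "0 < e"
    then have e: "0 < e / 4" by simp
    obtain N where N: "\<And>n. n \<ge> N \<Longrightarrow> seq_norm pT (Z - (\<lambda>_. Z n)) \<le> e / 4"
      using const_dense[OF pT Z(1) e] by blast
    obtain M where M: "\<And>n. n \<ge> M \<Longrightarrow> pX (Z n) < e / 4"
      using order_tendstoD(2)[OF \<open>(\<lambda>n. pX (Z n)) \<longlonglongrightarrow> 0\<close> e] unfolding eventually_sequentially by blast
    define z where "z = Z (max M N)"
    have z: "seq_norm pT (Z - (\<lambda>_. z)) \<le> e / 4" "pX z < e / 4"
      using N[of "max M N"] M[of "max M N"] by (simp_all add: z_def)
    obtain j where j: "j \<in> free_ideal" "pT (z - j) < pX z + e / 4"
      using approximation_modulo_ideal[OF e] by metis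
    note c = const_Cauchy[OF pT]
    have "nrm toeplitz_alg (t \<ominus>\<^bsub>toeplitz_alg\<^esub> const_class pT j) = seq_norm pT (Z - (\<lambda>_. j))"
      by (simp add: Z const_class_def completion_ops[OF pT] completion_nrm[OF pT] c sT.C_diff)
    moreover have "seq_norm pT (Z - (\<lambda>_. j)) \<le> seq_norm pT (Z - (\<lambda>_. z)) + seq_norm pT ((\<lambda>_. z) - (\<lambda>_. j))"
      by (intro sT.p_triangle Z c)
    moreover have "seq_norm pT ((\<lambda>_. z) - (\<lambda>_. j)) = pT (z - j)"
      by (simp add: fun_diff_def seq_norm_const[OF pT])
    ultimately have "nrm toeplitz_alg (t \<ominus>\<^bsub>toeplitz_alg\<^esub> const_class pT j) < e" using z j e by linarith
    then show "\<exists>y\<in>exel_ideal. nrm toeplitz_alg (t \<ominus>\<^bsub>toeplitz_alg\<^esub> y) < e" using j by (auto simp: free_ideal_def)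
  qed
  then show "t \<in> exel_ideal" using redundancy_ideal_closed by blast
qed

lemma redundancy_ideal_eq_kernel: "exel_ideal = canonical_kernel"
  using redundancy_ideal_subset_kernel kernel_subset_redundancy_ideal by blast

lemma free_ideal_pX: "j \<in> free_ideal \<Longrightarrow> pX j = 0"
  using canonical_kernel_iff[OF const_Cauchy[OF pT], of j] seq_norm_const[OF pX, of j]
  by (simp add: free_ideal_def redundancy_ideal_eq_kernel const_class_def)

text \<open>A Cauchy sequence for \<open>pX\<close>, thinned out, becomes Cauchy for \<open>pT\<close> after subtracting from its
  increments suitable elements of the ideal, which \<open>pX\<close> does not see.\<close>

lemma toeplitz_to_crossed_surj: "toeplitz_to_crossed ` carrier toeplitz_alg = carrier crossed_alg"
proof
  show "toeplitz_to_crossed ` carrier toeplitz_alg \<subseteq> carrier crossed_alg"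
    using star_homD(1)[OF toeplitz_to_crossed_hom] by blast
  show "carrier crossed_alg \<subseteq> toeplitz_to_crossed ` carrier toeplitz_alg"
  proof
    fix x assume "x \<in> carrier crossed_alg"
    then obtain Y where Y: "Y \<in> cauchy_seqs pX" "x = seq_class pX Y"
      by (auto simp: completion_carrier[OF pX])
    have "\<exists>z. seq_norm pX (Y - (\<lambda>_. z)) \<le> (1/2) ^ k / 4" for k
    proof -
      have "0 < (1/2::real) ^ k / 4" by simp
      then obtain N where "\<And>n. n \<ge> N \<Longrightarrow> seq_norm pX (Y - (\<lambda>_. Y n)) \<le> (1/2) ^ k / 4"
        using const_dense[OF pX Y(1)] by blast
      then show ?thesis by blast
    qed
    then obtain y where y: "\<And>k. seq_norm pX (Y - (\<lambda>_. y k)) \<le> (1/2) ^ k / 4" by metis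
    note cX = const_Cauchy[OF pX] and cT = const_Cauchy[OF pT]
    have step: "pX (y (Suc k) - y k) \<le> (1/2) ^ k / 2" for k
    proof -
      have "seq_norm pX ((\<lambda>_. y (Suc k)) - (\<lambda>_. y k))
          \<le> seq_norm pX ((\<lambda>_. y (Suc k)) - Y) + seq_norm pX (Y - (\<lambda>_. y k))"
        by (intro sX.p_triangle Y cX)
      moreover have "seq_norm pX ((\<lambda>_. y (Suc k)) - Y) = seq_norm pX (Y - (\<lambda>_. y (Suc k)))"
        by (intro sX.p_commute Y cX)
      moreover have "seq_norm pX ((\<lambda>_. y (Suc k)) - (\<lambda>_. y k)) = pX (y (Suc k) - y k)"
        by (simp add: fun_diff_def seq_norm_const[OF pX])
      moreover have "(1/2::real) ^ Suc k \<le> (1/2) ^ k" by simp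
      ultimately show ?thesis using y[of k] y[of "Suc k"] by linarith
    qed
    have "\<exists>j\<in>free_ideal. pT (y (Suc k) - y k - j) < pX (y (Suc k) - y k) + (1/2) ^ k / 2" for k
      using approximation_modulo_ideal[of "(1/2) ^ k / 2" "y (Suc k) - y k"] by fastforce
    then obtain j where j: "\<And>k. j k \<in> free_ideal"
      "\<And>k. pT (y (Suc k) - y k - j k) < pX (y (Suc k) - y k) + (1/2) ^ k / 2" by metis
    define Z where "Z k = y k - (\<Sum>i<k. j i)" for k
    have "pT (Z (Suc k) - Z k) \<le> (1/2) ^ k" for k
    proof -
      have "Z (Suc k) - Z k = y (Suc k) - y k - j k" by (simp add: Z_def)
      then show ?thesis using j(2)[of k] step[of k] by simp
    qed
    then have ZT: "Z \<in> cauchy_seqs pT"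
      unfolding cauchy_seqs_iff using T.geometric_Cauchy[of Z "1/2"] by simp
    have "pX (\<Sum>i<k. j i) = 0" for k
    proof (induction k)
      case (Suc k)
      then show ?case using X.p_add_zero[OF _ _ Suc.IH free_ideal_pX[OF j(1)[of k]]] by simp
    qed (simp add: X.p_zero)
    then have Zy: "pX (y k - Z k) = 0" for k by (simp add: Z_def)
    have "seq_norm pX (Y - Z) \<le> 0"
    proof (rule field_le_epsilon)
      fix e :: real assume "0 < e"
      then have e: "0 < e / 2" by simp
      obtain N where N: "\<And>n. n \<ge> N \<Longrightarrow> seq_norm pX (Z - (\<lambda>_. Z n)) \<le> e / 2"
        using const_dense[OF pX cauchy_pT_pX[OF ZT] e] by blast
      have "(\<lambda>k. (1/2::real) ^ k / 4) \<longlonglongrightarrow> 0 / 4"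
        by (intro tendsto_intros LIMSEQ_realpow_zero) auto
      then obtain M where M: "\<And>k. k \<ge> M \<Longrightarrow> (1/2::real) ^ k / 4 < e / 2"
        using order_tendstoD(2)[of _ "0/4" sequentially "e / 2"] e
        unfolding eventually_sequentially by force
      define k where "k = max M N"
      have "seq_norm pX (Y - Z) \<le> seq_norm pX (Y - (\<lambda>_. y k)) + seq_norm pX ((\<lambda>_. y k) - Z)"
        by (intro sX.p_triangle Y cX cauchy_pT_pX ZT)
      moreover have "seq_norm pX ((\<lambda>_. y k) - Z)
          \<le> seq_norm pX ((\<lambda>_. y k) - (\<lambda>_. Z k)) + seq_norm pX ((\<lambda>_. Z k) - Z)"
        by (intro sX.p_triangle cX cauchy_pT_pX ZT)
      moreover have "seq_norm pX ((\<lambda>_. Z k) - Z) = seq_norm pX (Z - (\<lambda>_. Z k))"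
        by (intro sX.p_commute cX cauchy_pT_pX ZT)
      moreover have "seq_norm pX ((\<lambda>_. y k) - (\<lambda>_. Z k)) = 0"
        using Zy[of k] by (simp add: fun_diff_def seq_norm_const[OF pX])
      ultimately show "seq_norm pX (Y - Z) \<le> 0 + e"
        using y[of k] M[of k] N[of k] by (simp add: k_def)
    qed
    then have "seq_norm pX (Y - Z) = 0"
      using sX.p_nonneg[OF sX.C_diff[OF Y(1) cauchy_pT_pX[OF ZT]]] by simp
    then have "x = toeplitz_to_crossed (seq_class pT Z)"
      using Y ZT cauchy_pT_pX by (simp add: toeplitz_to_crossed_class seq_class_eq[OF pX])
    then show "x \<in> toeplitz_to_crossed ` carrier toeplitz_alg"
      using ZT by (auto simp: completion_carrier[OF pT])
  qed
qed

section \<open>The isomorphism\<close>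

sublocale K: star_ideal toeplitz_alg canonical_kernel by (rule canonical_kernel_star_ideal)

lemma exel_names:
  "exel_crossed_product \<delta> L = star_quotient toeplitz_alg canonical_kernel"
  "exel_elem \<delta> L a = canonical_kernel +>\<^bsub>toeplitz_alg\<^esub> const_class pT (el a)"
  "exel_S \<delta> L = canonical_kernel +>\<^bsub>toeplitz_alg\<^esub> const_class pT ext"
  by (simp_all add: exel_crossed_product_def exel_elem_def exel_S_def algebra_names
      redundancy_ideal_eq_kernel)

lemma exel_to_crossed:
  obtains g where "g \<in> star_iso (exel_crossed_product \<delta> L) (crossed_product \<delta> L)"
    "g (exel_S \<delta> L) = crossed_U \<delta> L" "\<And>a. g (exel_elem \<delta> L a) = crossed_elem \<delta> L a"
proof -
  let ?E = "star_quotient toeplitz_alg canonical_kernel"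
  have k0: "toeplitz_to_crossed t = \<zero>\<^bsub>crossed_alg\<^esub>" if "t \<in> canonical_kernel" for t
    using that unfolding canonical_kernel_def by blast
  obtain g where g: "g \<in> star_hom ?E crossed_alg"
    and g_coset: "\<And>t. t \<in> carrier toeplitz_alg \<Longrightarrow> g (canonical_kernel +>\<^bsub>toeplitz_alg\<^esub> t) = toeplitz_to_crossed t"
    using K.factor_star_hom[OF toeplitz_to_crossed_hom crossed_alg.ring_axioms k0] by blast
  have "inj_on g (carrier ?E)"
  proof (rule inj_onI)
    fix P Q assume PQ: "P \<in> carrier ?E" "Q \<in> carrier ?E" "g P = g Q"
    obtain s where s: "s \<in> carrier toeplitz_alg" "P = canonical_kernel +>\<^bsub>toeplitz_alg\<^esub> s"
      using PQ(1) unfolding K.quotient_carrier by (rule imageE)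
    obtain t where t: "t \<in> carrier toeplitz_alg" "Q = canonical_kernel +>\<^bsub>toeplitz_alg\<^esub> t"
      using PQ(2) unfolding K.quotient_carrier by (rule imageE)
    note st = s t
    then have "toeplitz_to_crossed s = toeplitz_to_crossed t" using PQ(3) g_coset by simp
    then have "toeplitz_to_crossed (s \<ominus>\<^bsub>toeplitz_alg\<^esub> t) = \<zero>\<^bsub>crossed_alg\<^esub>"
      using star_hom_diff[OF toeplitz_to_crossed_hom toeplitz_alg.ring_axioms crossed_alg.ring_axioms st(1,3)]
        star_homD(1)[OF toeplitz_to_crossed_hom st(3)] by (simp add: a_minus_def crossed_alg.r_neg)
    then have "s \<ominus>\<^bsub>toeplitz_alg\<^esub> t \<in> canonical_kernel"
      unfolding canonical_kernel_def by (intro CollectI conjI toeplitz_alg.minus_closed st)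
    then show "P = Q" unfolding st K.coset_eq[OF st(1,3)] .
  qed
  moreover have "g ` carrier ?E = carrier crossed_alg"
    using toeplitz_to_crossed_surj g_coset by (auto simp: K.quotient_carrier image_image)
  ultimately have "g \<in> star_iso ?E crossed_alg" using g by (simp add: star_iso_def bij_betw_def)
  then show ?thesis
    by (rule that[unfolded exel_names algebra_names])
      (simp_all add: g_coset const_class_closed[OF pT] toeplitz_to_crossed_const)
qed

text \<open>This yields uniqueness of \<open>\<phi>\<close>: a competitor followed by the isomorphism back to
  \<open>X\<close> is an endomorphism of \<open>X\<close> that fixes the generators.\<close>

lemma crossed_endomorphism_identity:
  assumes f: "f \<in> star_hom crossed_alg crossed_alg" and U: "f (const_class pX ext) = const_class pX ext"
    and el: "\<And>a. f (const_class pX (el a)) = const_class pX (el a)"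
    and x: "x \<in> carrier crossed_alg"
  shows "f x = x"
proof (rule star_hom_fixing_constants[OF pX f _ x])
  fix y
  note hom = star_homD[OF f] and cl = const_class_closed[OF pX] and ops = const_class_ops[OF pX]
  show "f (const_class pX y) = const_class pX y"
  proof (induction y rule: free_star_alg_induct)
    case one
    show ?case using hom(4) by (simp add: ops)
  next
    case (gen g)
    show ?case using U el by (cases g) auto
  next
    case (add x y)
    then show ?case using hom(3)[OF cl cl, of x y] by (simp add: ops)
  next
    case (mult x y)
    then show ?case using hom(2)[OF cl cl, of x y] by (simp add: ops)
  next
    case (scal c x)
    then show ?case using hom(5)[OF cl, of c x] by (simp add: ops)
  next
    case (star x)
    then show ?case using hom(6)[OF cl, of x] by (simp add: ops)
  qed
qed

end

theorem theorem4p15: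
  fixes \<delta> \<delta>s :: "'a::unital_cstar_algebra \<Rightarrow> 'a"
  assumes "star_endomorphism \<delta>"
    and "finely_representable TYPE('h::complex_hilbert_space) \<delta>"
    and "complete_transfer_operator \<delta> \<delta>s"
  shows "\<exists>\<phi> \<in> star_iso (crossed_product \<delta> \<delta>s) (exel_crossed_product \<delta> \<delta>s).
           \<phi> (crossed_U \<delta> \<delta>s) = exel_S \<delta> \<delta>s \<and>
           (\<forall>a. \<phi> (crossed_elem \<delta> \<delta>s a) = exel_elem \<delta> \<delta>s a) \<and>
           (\<forall>\<psi> \<in> star_hom (crossed_product \<delta> \<delta>s) (exel_crossed_product \<delta> \<delta>s).
              \<psi> (crossed_U \<delta> \<delta>s) = exel_S \<delta> \<delta>s \<and>
              (\<forall>a. \<psi> (crossed_elem \<delta> \<delta>s a) = exel_elem \<delta> \<delta>s a) \<longrightarrow>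
              (\<forall>x \<in> carrier (crossed_product \<delta> \<delta>s). \<psi> x = \<phi> x))"
proof -
  interpret transfer_pair \<delta> \<delta>s using assms by unfold_locales
  let ?X = "crossed_product \<delta> \<delta>s" and ?E = "exel_crossed_product \<delta> \<delta>s"
  obtain g where iso: "g \<in> star_iso ?E ?X" and gS: "g (exel_S \<delta> \<delta>s) = crossed_U \<delta> \<delta>s"
    and gel: "\<And>a. g (exel_elem \<delta> \<delta>s a) = crossed_elem \<delta> \<delta>s a"
    using exel_to_crossed by metis
  have g: "g \<in> star_hom ?E ?X" and bij: "bij_betw g (carrier ?E) (carrier ?X)"
    using iso by (auto simp: star_iso_def)
  have E: "star_ring ?E" unfolding exel_names by (rule K.quotient_star_ring)
  have coset_E: "canonical_kernel +>\<^bsub>toeplitz_alg\<^esub> const_class pT x \<in> carrier ?E" for x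
    unfolding exel_names K.quotient_carrier by (rule imageI[OF const_class_closed[OF pT]])
  define \<phi> where "\<phi> = inv_into (carrier ?E) g"
  have inv: "\<phi> (g y) = y" if "y \<in> carrier ?E" for y
    using bij that by (simp add: \<phi>_def bij_betw_def)
  have \<phi>_iso: "\<phi> \<in> star_iso ?X ?E"
    using inv_into_star_hom[OF g bij E] bij_betw_inv_into[OF bij] by (simp add: star_iso_def \<phi>_def)
  have \<phi>_U: "\<phi> (crossed_U \<delta> \<delta>s) = exel_S \<delta> \<delta>s"
    using inv[of "exel_S \<delta> \<delta>s"] gS coset_E[of ext] unfolding exel_names(3) by simp
  have \<phi>_el: "\<phi> (crossed_elem \<delta> \<delta>s a) = exel_elem \<delta> \<delta>s a" for a
    using inv[of "exel_elem \<delta> \<delta>s a"] gel[of a] coset_E[of "el a"] unfolding exel_names(2) by simp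
  have unique: "\<psi> x = \<phi> x"
    if \<psi>: "\<psi> \<in> star_hom ?X ?E" "\<psi> (crossed_U \<delta> \<delta>s) = exel_S \<delta> \<delta>s"
      "\<And>a. \<psi> (crossed_elem \<delta> \<delta>s a) = exel_elem \<delta> \<delta>s a" and x: "x \<in> carrier ?X" for \<psi> x
  proof -
    have "(g \<circ> \<psi>) x = x"
    proof (rule crossed_endomorphism_identity)
      show "g \<circ> \<psi> \<in> star_hom crossed_alg crossed_alg" using star_hom_comp[OF \<psi>(1) g] by (simp add: algebra_names)
      show "(g \<circ> \<psi>) (const_class pX ext) = const_class pX ext"
        using \<psi>(2) gS by (simp add: algebra_names)
      show "(g \<circ> \<psi>) (const_class pX (el a)) = const_class pX (el a)" for a
        using \<psi>(3)[of a] gel[of a] by (simp add: algebra_names)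
    qed (use x in \<open>simp add: algebra_names\<close>)
    then show ?thesis using inv[OF star_homD(1)[OF \<psi>(1) x]] by simp
  qed
  show ?thesis
  proof (intro bexI[OF _ \<phi>_iso] conjI allI ballI impI)
    fix \<psi> x
    assume "\<psi> \<in> star_hom ?X ?E" "x \<in> carrier ?X"
      "\<psi> (crossed_U \<delta> \<delta>s) = exel_S \<delta> \<delta>s \<and>
        (\<forall>a. \<psi> (crossed_elem \<delta> \<delta>s a) = exel_elem \<delta> \<delta>s a)"
    then show "\<psi> x = \<phi> x" by (elim conjE) (rule unique, simp_all)
  qed (fact \<phi>_U, fact \<phi>_el)
qed

end
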